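(* Let $\mathscr A$ be a finitary abelian category with the finite length property. Then $\mathrm{Exp}_{\mathscr A}=\sum_{[A]\in\mathrm{Iso}\,\mathscr A}[A]$ is invertible in the completed Hall algebra $\widehat H_{\mathscr A}$ and $$ \mathrm{Exp}_{\mathscr A}^{-1}=\sum_{[M]\,:\,M\text{ semisimple}} c_{[M]}\cdot [M], \qquad c_{[M]}=\prod_{[S]\,:\,S\text{ simple}} (-1)^{[M:S]}\,|\mathrm{End}_{\mathscr A} S|^{\binom{[M:S]}{2}}, $$ where $[M:S]$ denotes the Jordan--Hölder multiplicity of $S$ in $M$.
   Context: An (essentially small) abelian category $\mathscr A$ is finitary if $\mathrm{Hom}_{\mathscr A}(M,N)$ and $\mathrm{Ext}^1_{\mathscr A}(M,N)$ are finite sets for all objects $M,N$. It has the finite length property if every object has a finite composition series. $\mathrm{Iso}\,\mathscr A$ is the set of isomorphism classes $[M]$ of objects. The Hall algebra $H_{\mathscr A}$ is the $\mathbb Q$-vector space with basis $\mathrm{Iso}\,\mathscr A$ and multiplication $[M][N]=\sum_{[K]}F_{MN}^K[K]$, where $F_{MN}^K$ is the number of subobjects $U\subset K$ with $U\cong N$ and $K/U\cong M$. It is graded by the Grothendieck group $K_0(\mathscr A)$, with $[M]$ in degree $|M|$ (the class of $M$ in $K_0(\mathscr A)$), and $\widehat H_{\mathscr A}=\prod_{\gamma\in K_0(\mathscr A)}H_{\mathscr A,\gamma}$ is its completion with respect to this grading. *)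

theory Defs
  imports
    Complex_Main
    "HOL-Library.Groups_Big_Fun"
    "HOL-Library.FuncSet"
    "HOL-Algebra.Coset"
    "HOL-Algebra.Ring"
    "HOL-Algebra.Free_Abelian_Groups"
begin

section \<open>Abelian categories\<close>

text \<open>
  A category with sets of objects and arrows, together with an addition of parallel arrows.
  \<open>g \<cdot> f\<close> is the composite of \<open>f\<close> followed by \<open>g\<close>.
\<close>

record ('o, 'm) preadditive =
  Obj :: "'o set"
  Arr :: "'m set"
  Dom :: "'m \<Rightarrow> 'o"
  Cod :: "'m \<Rightarrow> 'o"
  Id :: "'o \<Rightarrow> 'm"
  Comp :: "'m \<Rightarrow> 'm \<Rightarrow> 'm" (infixl "\<cdot>\<index>" 75)
  Add :: "'m \<Rightarrow> 'm \<Rightarrow> 'm"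
  Zero :: "'o \<Rightarrow> 'o \<Rightarrow> 'm"

definition Hom :: "('o, 'm, 'x) preadditive_scheme \<Rightarrow> 'o \<Rightarrow> 'o \<Rightarrow> 'm set" where
  "Hom C X Y = {f \<in> Arr C. Dom C f = X \<and> Cod C f = Y}"

locale category =
  fixes C :: "('o, 'm, 'x) preadditive_scheme" (structure)
  assumes Dom_in_Obj: "f \<in> Arr C \<Longrightarrow> Dom C f \<in> Obj C"
    and Cod_in_Obj: "f \<in> Arr C \<Longrightarrow> Cod C f \<in> Obj C"
    and Id_in_Hom: "X \<in> Obj C \<Longrightarrow> Id C X \<in> Hom C X X"
    and Comp_in_Hom: "\<lbrakk>f \<in> Hom C X Y; g \<in> Hom C Y Z\<rbrakk> \<Longrightarrow> g \<cdot> f \<in> Hom C X Z"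
    and Comp_Id: "f \<in> Hom C X Y \<Longrightarrow> f \<cdot> Id C X = f"
    and Id_Comp: "f \<in> Hom C X Y \<Longrightarrow> Id C Y \<cdot> f = f"
    and Comp_assoc:
      "\<lbrakk>f \<in> Hom C W X; g \<in> Hom C X Y; h \<in> Hom C Y Z\<rbrakk> \<Longrightarrow> (h \<cdot> g) \<cdot> f = h \<cdot> (g \<cdot> f)"

text \<open>The additive group of arrows from \<open>X\<close> to \<open>Y\<close>, in the multiplicative notation of
  HOL-Algebra.\<close>

definition Hom_group :: "('o, 'm, 'x) preadditive_scheme \<Rightarrow> 'o \<Rightarrow> 'o \<Rightarrow> 'm monoid" where
  "Hom_group C X Y = \<lparr>carrier = Hom C X Y, monoid.mult = Add C, one = Zero C X Y\<rparr>"

locale preadditive_category = category +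
  assumes comm_group_Hom: "\<lbrakk>X \<in> Obj C; Y \<in> Obj C\<rbrakk> \<Longrightarrow> comm_group (Hom_group C X Y)"
    and Comp_Add_left:
      "\<lbrakk>f \<in> Hom C X Y; g \<in> Hom C Y Z; g' \<in> Hom C Y Z\<rbrakk> \<Longrightarrow>
        Add C g g' \<cdot> f = Add C (g \<cdot> f) (g' \<cdot> f)"
    and Comp_Add_right:
      "\<lbrakk>f \<in> Hom C X Y; f' \<in> Hom C X Y; g \<in> Hom C Y Z\<rbrakk> \<Longrightarrow>
        g \<cdot> Add C f f' = Add C (g \<cdot> f) (g \<cdot> f')"

text \<open>\<open>M\<close> is the direct sum (biproduct) of \<open>S 0, \<dots>, S (n - 1)\<close> with injections \<open>i k\<close> and
  projections \<open>p k\<close>. The last conjunct says \<open>\<Sum>k. i k \<cdot> p k = 1\<close>; for \<open>n = 0\<close> it says that the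
  identity of \<open>M\<close> is zero, i.e. that \<open>M\<close> is a zero object.\<close>

definition direct_sum ::
  "('o, 'm, 'x) preadditive_scheme \<Rightarrow> nat \<Rightarrow> (nat \<Rightarrow> 'o) \<Rightarrow> 'o \<Rightarrow> (nat \<Rightarrow> 'm) \<Rightarrow> (nat \<Rightarrow> 'm) \<Rightarrow> bool"
  where
  "direct_sum C n S M i p \<longleftrightarrow>
    M \<in> Obj C \<and>
    (\<forall>k<n. i k \<in> Hom C (S k) M \<and> p k \<in> Hom C M (S k)) \<and>
    (\<forall>j<n. \<forall>k<n. p j \<cdot>\<^bsub>C\<^esub> i k = (if j = k then Id C (S k) else Zero C (S k) (S j))) \<and>
    finprod (Hom_group C M M) (\<lambda>k. i k \<cdot>\<^bsub>C\<^esub> p k) {..<n} = Id C M"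

definition mono_arr :: "('o, 'm, 'x) preadditive_scheme \<Rightarrow> 'm \<Rightarrow> bool" where
  "mono_arr C f \<longleftrightarrow> f \<in> Arr C \<and>
    (\<forall>X\<in>Obj C. \<forall>g\<in>Hom C X (Dom C f). \<forall>h\<in>Hom C X (Dom C f). f \<cdot>\<^bsub>C\<^esub> g = f \<cdot>\<^bsub>C\<^esub> h \<longrightarrow> g = h)"

definition epi_arr :: "('o, 'm, 'x) preadditive_scheme \<Rightarrow> 'm \<Rightarrow> bool" where
  "epi_arr C f \<longleftrightarrow> f \<in> Arr C \<and>
    (\<forall>Y\<in>Obj C. \<forall>g\<in>Hom C (Cod C f) Y. \<forall>h\<in>Hom C (Cod C f) Y. g \<cdot>\<^bsub>C\<^esub> f = h \<cdot>\<^bsub>C\<^esub> f \<longrightarrow> g = h)"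

definition iso_arr :: "('o, 'm, 'x) preadditive_scheme \<Rightarrow> 'm \<Rightarrow> bool" where
  "iso_arr C f \<longleftrightarrow> f \<in> Arr C \<and>
    (\<exists>g\<in>Hom C (Cod C f) (Dom C f). g \<cdot>\<^bsub>C\<^esub> f = Id C (Dom C f) \<and> f \<cdot>\<^bsub>C\<^esub> g = Id C (Cod C f))"

definition isomorphic :: "('o, 'm, 'x) preadditive_scheme \<Rightarrow> 'o \<Rightarrow> 'o \<Rightarrow> bool" where
  "isomorphic C X Y \<longleftrightarrow> (\<exists>f\<in>Hom C X Y. iso_arr C f)"

definition is_kernel :: "('o, 'm, 'x) preadditive_scheme \<Rightarrow> 'm \<Rightarrow> 'm \<Rightarrow> bool" where
  "is_kernel C k f \<longleftrightarrow>
    k \<in> Arr C \<and> f \<in> Arr C \<and> Cod C k = Dom C f \<and>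
    f \<cdot>\<^bsub>C\<^esub> k = Zero C (Dom C k) (Cod C f) \<and>
    (\<forall>X\<in>Obj C. \<forall>h\<in>Hom C X (Dom C f). f \<cdot>\<^bsub>C\<^esub> h = Zero C X (Cod C f) \<longrightarrow>
      (\<exists>!u. u \<in> Hom C X (Dom C k) \<and> k \<cdot>\<^bsub>C\<^esub> u = h))"

definition is_cokernel :: "('o, 'm, 'x) preadditive_scheme \<Rightarrow> 'm \<Rightarrow> 'm \<Rightarrow> bool" where
  "is_cokernel C p f \<longleftrightarrow>
    p \<in> Arr C \<and> f \<in> Arr C \<and> Dom C p = Cod C f \<and>
    p \<cdot>\<^bsub>C\<^esub> f = Zero C (Dom C f) (Cod C p) \<and>
    (\<forall>Y\<in>Obj C. \<forall>h\<in>Hom C (Cod C f) Y. h \<cdot>\<^bsub>C\<^esub> f = Zero C (Dom C f) Y \<longrightarrow>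
      (\<exists>!u. u \<in> Hom C (Cod C p) Y \<and> u \<cdot>\<^bsub>C\<^esub> p = h))"

locale abelian_category = preadditive_category +
  assumes ex_direct_sum: "(\<forall>k<n. S k \<in> Obj C) \<Longrightarrow> \<exists>M i p. direct_sum C n S M i p"
    and ex_kernel: "f \<in> Arr C \<Longrightarrow> \<exists>k. is_kernel C k f"
    and ex_cokernel: "f \<in> Arr C \<Longrightarrow> \<exists>p. is_cokernel C p f"
    and mono_is_kernel: "mono_arr C f \<Longrightarrow> \<exists>g. is_kernel C f g"
    and epi_is_cokernel: "epi_arr C f \<Longrightarrow> \<exists>g. is_cokernel C f g"

definition zero_obj :: "('o, 'm, 'x) preadditive_scheme \<Rightarrow> 'o \<Rightarrow> bool" where
  "zero_obj C Z \<longleftrightarrow>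
    Z \<in> Obj C \<and> (\<forall>X\<in>Obj C. (\<exists>!f. f \<in> Hom C Z X) \<and> (\<exists>!f. f \<in> Hom C X Z))"

text \<open>\<open>0 \<rightarrow> Dom i \<rightarrow> Cod i = Dom p \<rightarrow> Cod p \<rightarrow> 0\<close> is exact.\<close>

definition short_exact :: "('o, 'm, 'x) preadditive_scheme \<Rightarrow> 'm \<Rightarrow> 'm \<Rightarrow> bool" where
  "short_exact C i p \<longleftrightarrow> is_kernel C i p \<and> is_cokernel C p i"


section \<open>Finitary categories\<close>

text \<open>\<open>Ext\<^sup>1(M, N)\<close> is Yoneda's: the set of extensions \<open>0 \<rightarrow> N \<rightarrow> E \<rightarrow> M \<rightarrow> 0\<close> up to
  isomorphisms of the middle terms that are compatible with the identities of \<open>N\<close> and \<open>M\<close>.\<close>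

definition extensions :: "('o, 'm, 'x) preadditive_scheme \<Rightarrow> 'o \<Rightarrow> 'o \<Rightarrow> ('m \<times> 'm) set" where
  "extensions C M N = {(i, p). short_exact C i p \<and> Dom C i = N \<and> Cod C p = M}"

definition ext_rel ::
  "('o, 'm, 'x) preadditive_scheme \<Rightarrow> 'o \<Rightarrow> 'o \<Rightarrow> (('m \<times> 'm) \<times> ('m \<times> 'm)) set" where
  "ext_rel C M N = {((i, p), (i', p')).
    (i, p) \<in> extensions C M N \<and> (i', p') \<in> extensions C M N \<and>
    (\<exists>f\<in>Hom C (Cod C i) (Cod C i'). iso_arr C f \<and> f \<cdot>\<^bsub>C\<^esub> i = i' \<and> p' \<cdot>\<^bsub>C\<^esub> f = p)}"

definition Ext1 :: "('o, 'm, 'x) preadditive_scheme \<Rightarrow> 'o \<Rightarrow> 'o \<Rightarrow> ('m \<times> 'm) set set" where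
  "Ext1 C M N = extensions C M N // ext_rel C M N"

definition finitary :: "('o, 'm, 'x) preadditive_scheme \<Rightarrow> bool" where
  "finitary C \<longleftrightarrow> (\<forall>M\<in>Obj C. \<forall>N\<in>Obj C. finite (Hom C M N) \<and> finite (Ext1 C M N))"


section \<open>Simple and semisimple objects, composition series\<close>

definition simple_obj :: "('o, 'm, 'x) preadditive_scheme \<Rightarrow> 'o \<Rightarrow> bool" where
  "simple_obj C S \<longleftrightarrow>
    S \<in> Obj C \<and> \<not> zero_obj C S \<and>
    (\<forall>u. mono_arr C u \<and> Cod C u = S \<longrightarrow> zero_obj C (Dom C u) \<or> iso_arr C u)"

definition semisimple_obj :: "('o, 'm, 'x) preadditive_scheme \<Rightarrow> 'o \<Rightarrow> bool" where
  "semisimple_obj C M \<longleftrightarrow> (\<exists>n S i p. (\<forall>k<n. simple_obj C (S k)) \<and> direct_sum C n S M i p)"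

text \<open>A composition series \<open>0 = X 0 \<subset> X 1 \<subset> \<dots> \<subset> X n = M\<close>, given by the inclusions
  \<open>i k : X k \<rightarrow> X (k + 1)\<close> and the quotient maps \<open>p k\<close> onto the simple factors \<open>Cod (p k)\<close>.\<close>

definition composition_series ::
  "('o, 'm, 'x) preadditive_scheme \<Rightarrow> 'o \<Rightarrow> nat \<Rightarrow> (nat \<Rightarrow> 'o) \<Rightarrow> (nat \<Rightarrow> 'm) \<Rightarrow> (nat \<Rightarrow> 'm) \<Rightarrow> bool"
  where
  "composition_series C M n X i p \<longleftrightarrow>
    zero_obj C (X 0) \<and> X n = M \<and>
    (\<forall>k<n. i k \<in> Hom C (X k) (X (Suc k)) \<and> short_exact C (i k) (p k) \<and>
      simple_obj C (Cod C (p k)))"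

definition finite_length :: "('o, 'm, 'x) preadditive_scheme \<Rightarrow> bool" where
  "finite_length C \<longleftrightarrow> (\<forall>M\<in>Obj C. \<exists>n X i p. composition_series C M n X i p)"

text \<open>The multiplicity \<open>[M : S]\<close>, independent of the composition series by the Jordan--Hoelder theorem.\<close>

definition JH_mult :: "('o, 'm, 'x) preadditive_scheme \<Rightarrow> 'o \<Rightarrow> 'o \<Rightarrow> nat" where
  "JH_mult C M S = (THE r. \<exists>n X i p. composition_series C M n X i p \<and>
    r = card {k. k < n \<and> isomorphic C (Cod C (p k)) S})"


section \<open>Isomorphism classes and the Grothendieck group\<close>

definition iso_rel :: "('o, 'm, 'x) preadditive_scheme \<Rightarrow> ('o \<times> 'o) set" where
  "iso_rel C = {(X, Y). X \<in> Obj C \<and> Y \<in> Obj C \<and> isomorphic C X Y}"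

definition Iso :: "('o, 'm, 'x) preadditive_scheme \<Rightarrow> 'o set set" where
  "Iso C = Obj C // iso_rel C"

definition iso_class :: "('o, 'm, 'x) preadditive_scheme \<Rightarrow> 'o \<Rightarrow> 'o set" where
  "iso_class C M = iso_rel C `` {M}"

definition rep :: "'o set \<Rightarrow> 'o" where
  "rep m = (SOME M. M \<in> m)"

definition K0_relations :: "('o, 'm, 'x) preadditive_scheme \<Rightarrow> ('o set \<Rightarrow>\<^sub>0 int) set" where
  "K0_relations C =
    {frag_of (iso_class C (Cod C i)) - frag_of (iso_class C (Dom C i))
        - frag_of (iso_class C (Cod C p)) | i p. short_exact C i p}"

definition K0_relation_subgroup :: "('o, 'm, 'x) preadditive_scheme \<Rightarrow> ('o set \<Rightarrow>\<^sub>0 int) set" where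
  "K0_relation_subgroup C = generate (free_Abelian_group (Iso C)) (K0_relations C)"

text \<open>Written multiplicatively, like all groups of HOL-Algebra.\<close>

definition K0 :: "('o, 'm, 'x) preadditive_scheme \<Rightarrow> ('o set \<Rightarrow>\<^sub>0 int) set monoid" where
  "K0 C = free_Abelian_group (Iso C) Mod K0_relation_subgroup C"

text \<open>\<open>|M|\<close> as a function of the isomorphism class \<open>m = [M]\<close>.\<close>

definition K0_class :: "('o, 'm, 'x) preadditive_scheme \<Rightarrow> 'o set \<Rightarrow> ('o set \<Rightarrow>\<^sub>0 int) set" where
  "K0_class C m = K0_relation_subgroup C #>\<^bsub>free_Abelian_group (Iso C)\<^esub> frag_of m"


section \<open>The Hall algebra and its completion\<close>

definition sub_rel :: "('o, 'm, 'x) preadditive_scheme \<Rightarrow> ('m \<times> 'm) set" where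
  "sub_rel C = {(u, v). mono_arr C u \<and> mono_arr C v \<and>
    (\<exists>w\<in>Hom C (Dom C u) (Dom C v). iso_arr C w \<and> v \<cdot>\<^bsub>C\<^esub> w = u)}"

definition subobjects :: "('o, 'm, 'x) preadditive_scheme \<Rightarrow> 'o \<Rightarrow> 'm set set" where
  "subobjects C K = {u. mono_arr C u \<and> Cod C u = K} // sub_rel C"

text \<open>\<open>F\<^sub>M\<^sub>N\<^sup>K\<close>: the number of subobjects \<open>U \<subseteq> K\<close> with \<open>U \<cong> N\<close> and \<open>K / U \<cong> M\<close>.\<close>

definition hall_number :: "('o, 'm, 'x) preadditive_scheme \<Rightarrow> 'o \<Rightarrow> 'o \<Rightarrow> 'o \<Rightarrow> nat" where
  "hall_number C M N K =
    card {U \<in> subobjects C K. \<exists>u\<in>U. isomorphic C (Dom C u) N \<and>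
      (\<exists>p. is_cokernel C p u \<and> isomorphic C (Cod C p) M)}"

text \<open>An element of the Hall algebra is encoded by its coefficients with respect to the basis
  \<open>Iso C\<close>; the multiplication is the bilinear extension of \<open>[M] [N] = \<Sum>K. F\<^sub>M\<^sub>N\<^sup>K [K]\<close>.\<close>

definition hall_carrier :: "('o, 'm, 'x) preadditive_scheme \<Rightarrow> ('o set \<Rightarrow> rat) set" where
  "hall_carrier C = {x. {m. x m \<noteq> 0} \<subseteq> Iso C \<and> finite {m. x m \<noteq> 0}}"

definition hall_mult ::
  "('o, 'm, 'x) preadditive_scheme \<Rightarrow> ('o set \<Rightarrow> rat) \<Rightarrow> ('o set \<Rightarrow> rat) \<Rightarrow> 'o set \<Rightarrow> rat" where
  "hall_mult C x y k =
    (if k \<in> Iso C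
     then \<Sum>m | x m \<noteq> 0. \<Sum>n | y n \<noteq> 0. x m * y n * of_nat (hall_number C (rep m) (rep n) (rep k))
     else 0)"

text \<open>The unit is \<open>[0]\<close>; the zero objects form a single isomorphism class.\<close>

definition hall_algebra :: "('o, 'm, 'x) preadditive_scheme \<Rightarrow> ('o set \<Rightarrow> rat) ring" where
  "hall_algebra C =
    \<lparr>carrier = hall_carrier C,
     monoid.mult = hall_mult C,
     one = (\<lambda>m. if m = {Z. zero_obj C Z} then 1 else 0),
     ring.zero = (\<lambda>m. 0),
     ring.add = (\<lambda>x y m. x m + y m)\<rparr>"

definition hall_graded ::
  "('o, 'm, 'x) preadditive_scheme \<Rightarrow> ('o set \<Rightarrow>\<^sub>0 int) set \<Rightarrow> ('o set \<Rightarrow> rat) set" where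
  "hall_graded C \<gamma> =
    {x \<in> carrier (hall_algebra C). \<forall>m. x m \<noteq> 0 \<longrightarrow> K0_class C m = \<gamma>}"

text \<open>The formal sum \<open>\<Sum>m\<in>Iso C. a m \<cdot> [m]\<close> as an element of \<open>\<Prod>\<gamma>. H\<^sub>\<gamma>\<close>: its component in
  degree \<open>\<gamma>\<close> is the sum over all \<open>m\<close> of degree \<open>\<gamma>\<close>.\<close>

definition hall_formal_sum ::
  "('o, 'm, 'x) preadditive_scheme \<Rightarrow> ('o set \<Rightarrow> rat) \<Rightarrow> ('o set \<Rightarrow>\<^sub>0 int) set \<Rightarrow> 'o set \<Rightarrow> rat" where
  "hall_formal_sum C a =
    (\<lambda>\<gamma>\<in>carrier (K0 C). \<lambda>m. if m \<in> Iso C \<and> K0_class C m = \<gamma> then a m else 0)"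

text \<open>The product in the completion has components
  \<open>(x y)\<^sub>\<gamma> = \<Sum>\<alpha> + \<beta> = \<gamma>. x\<^sub>\<alpha> y\<^sub>\<beta>\<close>, where the sum, taken coefficientwise by \<open>Sum_any\<close>,
  has only finitely many nonzero terms.\<close>

definition completed_hall_mult ::
  "('o, 'm, 'x) preadditive_scheme \<Rightarrow>
    (('o set \<Rightarrow>\<^sub>0 int) set \<Rightarrow> 'o set \<Rightarrow> rat) \<Rightarrow> (('o set \<Rightarrow>\<^sub>0 int) set \<Rightarrow> 'o set \<Rightarrow> rat) \<Rightarrow>
    ('o set \<Rightarrow>\<^sub>0 int) set \<Rightarrow> 'o set \<Rightarrow> rat" where
  "completed_hall_mult C x y =
    (\<lambda>\<gamma>\<in>carrier (K0 C). \<lambda>k.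
      Sum_any (\<lambda>(\<alpha>, \<beta>).
        if \<alpha> \<in> carrier (K0 C) \<and> \<beta> \<in> carrier (K0 C) \<and> \<alpha> \<otimes>\<^bsub>K0 C\<^esub> \<beta> = \<gamma>
        then (x \<alpha> \<otimes>\<^bsub>hall_algebra C\<^esub> y \<beta>) k else 0))"

definition completed_hall_algebra ::
  "('o, 'm, 'x) preadditive_scheme \<Rightarrow> (('o set \<Rightarrow>\<^sub>0 int) set \<Rightarrow> 'o set \<Rightarrow> rat) ring" where
  "completed_hall_algebra C =
    \<lparr>carrier = (\<Pi>\<^sub>E \<gamma>\<in>carrier (K0 C). hall_graded C \<gamma>),
     monoid.mult = completed_hall_mult C,
     one = hall_formal_sum C \<one>\<^bsub>hall_algebra C\<^esub>,
     ring.zero = hall_formal_sum C \<zero>\<^bsub>hall_algebra C\<^esub>,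
     ring.add = (\<lambda>x y. \<lambda>\<gamma>\<in>carrier (K0 C). x \<gamma> \<oplus>\<^bsub>hall_algebra C\<^esub> y \<gamma>)\<rparr>"

definition hall_Exp ::
  "('o, 'm, 'x) preadditive_scheme \<Rightarrow> ('o set \<Rightarrow>\<^sub>0 int) set \<Rightarrow> 'o set \<Rightarrow> rat" where
  "hall_Exp C = hall_formal_sum C (\<lambda>a. 1)"

text \<open>All but finitely many factors are \<open>1\<close>, since \<open>[M : S] = 0\<close> for almost all \<open>[S]\<close>.\<close>

definition inverse_coeff :: "('o, 'm, 'x) preadditive_scheme \<Rightarrow> 'o set \<Rightarrow> rat" where
  "inverse_coeff C m =
    Prod_any (\<lambda>s. if s \<in> Iso C \<and> simple_obj C (rep s)
      then (-1) ^ JH_mult C (rep m) (rep s)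
        * of_nat (card (Hom C (rep s) (rep s))) ^ (JH_mult C (rep m) (rep s) choose 2)
      else 1)"

end

(* Product coefficients in the completed Hall algebra are sums over subobjects: the coefficient of
   (sum of a[M] [M]) (sum of b[M] [M]) at [K] is the sum of a[K/U] b[U] over the subobjects U of K.
   Hence an inverse of Exp is determined recursively by length, and it suffices to show that
   the sums of c[U] and of c[K/U] over the subobjects U of a nonzero K vanish.
   For the first, fix a simple subobject S of K. The subobjects U that do not contain S are the
   complements of S in V = U + S; these are a torsor under Hom(U, S), and
   c[V] = - |Hom(U, S)| c[U], so they cancel the term of V. If S is no direct summand of V, then V is
   not semisimple and c[V] = 0. The second sum is the first one in the opposite category. *)

theory Submission
  imports Defs "HOL-Library.Multiset"
begin

section \<open>Arrows in a category and its opposite\<close>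

text \<open>The constant comes from a recursion. For semisimple U and simple S one has |Hom(U, S)| =
  |End S|^[U:S], and binom(m + 1, 2) = binom(m, 2) + m, so adding a copy of S to U multiplies the
  coefficient by - |Hom(U, S)|. In the opposite category Hom(S, U) takes the place of Hom(U, S); for
  semisimple U both have the same size, so one coefficient serves on both sides. Two obstacles shape
  the rest. The completion is graded by K_0, which may identify many isomorphism classes, so an
  infinite sum is an element of it only if each degree contains finitely many classes:
  Jordan-Hoelder shows that the degree determines the composition factors, and finiteness of Ext^1
  bounds the objects with given factors. And the inverse is a definite description in a structure
  whose associativity is not established here, so its uniqueness has to come from the equations for
  the coefficients rather than from the monoid laws.\<close>

definition opposite :: "('o, 'm, 'x) preadditive_scheme \<Rightarrow> ('o, 'm, 'x) preadditive_scheme" where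
  "opposite C = C\<lparr>Dom := Cod C, Cod := Dom C, Comp := (\<lambda>g f. Comp C f g), Zero := (\<lambda>X Y. Zero C Y X)\<rparr>"

lemma opposite_simps [simp]:
  "Obj (opposite C) = Obj C" "Arr (opposite C) = Arr C"
  "Dom (opposite C) = Cod C" "Cod (opposite C) = Dom C" "Id (opposite C) = Id C"
  "Comp (opposite C) g f = Comp C f g" "Add (opposite C) = Add C"
  "Zero (opposite C) X Y = Zero C Y X"
  by (simp_all add: opposite_def)

text \<open>An equation of records, so dualising twice simplifies away. Dual statements are obtained
  as instances at \<open>opposite C\<close>, translated back by these simp rules.\<close>

lemma opposite_opposite [simp]: "opposite (opposite C) = C"
  by (simp add: opposite_def)

lemma Hom_opposite [simp]: "Hom (opposite C) X Y = Hom C Y X"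
  by (auto simp: Hom_def)

lemma Hom_group_opposite [simp]: "Hom_group (opposite C) X Y = Hom_group C Y X"
  by (simp add: Hom_group_def)

lemma mono_arr_opposite [simp]: "mono_arr (opposite C) f \<longleftrightarrow> epi_arr C f"
  by (simp add: mono_arr_def epi_arr_def)

lemma epi_arr_opposite [simp]: "epi_arr (opposite C) f \<longleftrightarrow> mono_arr C f"
  by (simp add: mono_arr_def epi_arr_def)

lemma iso_arr_opposite [simp]: "iso_arr (opposite C) f \<longleftrightarrow> iso_arr C f"
  by (auto simp: iso_arr_def)

lemma is_kernel_opposite [simp]: "is_kernel (opposite C) k f \<longleftrightarrow> is_cokernel C k f"
  by (simp add: is_kernel_def is_cokernel_def)

lemma is_cokernel_opposite [simp]: "is_cokernel (opposite C) k f \<longleftrightarrow> is_kernel C k f"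
  by (simp add: is_kernel_def is_cokernel_def)

lemma zero_obj_opposite [simp]: "zero_obj (opposite C) Z \<longleftrightarrow> zero_obj C Z"
  by (auto simp: zero_obj_def)

text \<open>As a simp rule this turns every typing condition into equations between domains and
  codomains, which the rules for composites then solve.\<close>

lemma in_Hom [simp]: "f \<in> Hom C X Y \<longleftrightarrow> f \<in> Arr C \<and> Dom C f = X \<and> Cod C f = Y"
  by (simp add: Hom_def)

lemma Hom_group_simps [simp]:
  "carrier (Hom_group C X Y) = Hom C X Y" "monoid.mult (Hom_group C X Y) = Add C"
  "one (Hom_group C X Y) = Zero C X Y"
  by (simp_all add: Hom_group_def)

context category
begin

lemma Id_simps [simp]:
  "X \<in> Obj C \<Longrightarrow> Id C X \<in> Arr C" "X \<in> Obj C \<Longrightarrow> Dom C (Id C X) = X"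
  "X \<in> Obj C \<Longrightarrow> Cod C (Id C X) = X"
  using Id_in_Hom by auto

lemma Comp_simps [simp]:
  "\<lbrakk>f \<in> Arr C; g \<in> Arr C; Cod C f = Dom C g\<rbrakk> \<Longrightarrow> g \<cdot> f \<in> Arr C"
  "\<lbrakk>f \<in> Arr C; g \<in> Arr C; Cod C f = Dom C g\<rbrakk> \<Longrightarrow> Dom C (g \<cdot> f) = Dom C f"
  "\<lbrakk>f \<in> Arr C; g \<in> Arr C; Cod C f = Dom C g\<rbrakk> \<Longrightarrow> Cod C (g \<cdot> f) = Cod C g"
  using Comp_in_Hom[of f "Dom C f" "Cod C f" g "Cod C g"] by auto

lemma Comp_Id_simps [simp]:
  "\<lbrakk>f \<in> Arr C; Dom C f = X\<rbrakk> \<Longrightarrow> f \<cdot> Id C X = f"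
  "\<lbrakk>f \<in> Arr C; Cod C f = X\<rbrakk> \<Longrightarrow> Id C X \<cdot> f = f"
  using Comp_Id Id_Comp by auto

lemma assoc [simp]:
  "\<lbrakk>f \<in> Arr C; g \<in> Arr C; h \<in> Arr C; Cod C f = Dom C g; Cod C g = Dom C h\<rbrakk> \<Longrightarrow>
    (h \<cdot> g) \<cdot> f = h \<cdot> (g \<cdot> f)"
  using Comp_assoc[of f "Dom C f" "Cod C f" g "Cod C g" h "Cod C h"] by auto

declare Dom_in_Obj [simp] Cod_in_Obj [simp]

text \<open>\<open>assoc\<close> nests composites to the right, so a known product
  \<open>h \<cdot> g\<close> is no longer a subterm of \<open>h \<cdot> (g \<cdot> f)\<close>; this
  form rewrites it there.\<close>

lemma reassoc:
  "\<lbrakk>h \<cdot> g = k; f \<in> Arr C; g \<in> Arr C; h \<in> Arr C; Cod C f = Dom C g; Cod C g = Dom C h\<rbrakk> \<Longrightarrow>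
    h \<cdot> (g \<cdot> f) = k \<cdot> f"
  using assoc by metis

lemma category_opposite: "category (opposite C)"
  by unfold_locales auto

lemma mono_cancel:
  "\<lbrakk>mono_arr C f; g \<in> Arr C; h \<in> Arr C; Cod C g = Dom C f; Cod C h = Dom C f; Dom C g = Dom C h;
    f \<cdot> g = f \<cdot> h\<rbrakk> \<Longrightarrow> g = h"
  unfolding mono_arr_def by (metis Dom_in_Obj in_Hom)

lemma epi_cancel:
  "\<lbrakk>epi_arr C f; g \<in> Arr C; h \<in> Arr C; Dom C g = Cod C f; Dom C h = Cod C f; Cod C g = Cod C h;
    g \<cdot> f = h \<cdot> f\<rbrakk> \<Longrightarrow> g = h"
  unfolding epi_arr_def by (metis Cod_in_Obj in_Hom)

lemma mono_Arr: "mono_arr C f \<Longrightarrow> f \<in> Arr C"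
  by (simp add: mono_arr_def)

lemma epi_Arr: "epi_arr C f \<Longrightarrow> f \<in> Arr C"
  by (simp add: epi_arr_def)

lemma iso_Arr: "iso_arr C f \<Longrightarrow> f \<in> Arr C"
  by (simp add: iso_arr_def)

lemma isoE:
  assumes "iso_arr C f"
  obtains g where "f \<in> Arr C" "g \<in> Arr C" "Dom C g = Cod C f" "Cod C g = Dom C f"
    "g \<cdot> f = Id C (Dom C f)" "f \<cdot> g = Id C (Cod C f)"
  using assms by (auto simp: iso_arr_def)

lemma isoI:
  "\<lbrakk>f \<in> Arr C; g \<in> Arr C; Dom C g = Cod C f; Cod C g = Dom C f;
    g \<cdot> f = Id C (Dom C f); f \<cdot> g = Id C (Cod C f)\<rbrakk> \<Longrightarrow> iso_arr C f"
  by (auto simp: iso_arr_def)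

lemma iso_Id [simp]: "X \<in> Obj C \<Longrightarrow> iso_arr C (Id C X)"
  by (rule isoI[of _ "Id C X"]) simp_all

lemma iso_comp:
  assumes "iso_arr C f" "iso_arr C g" "Cod C f = Dom C g"
  shows "iso_arr C (g \<cdot> f)"
proof -
  obtain f' where f: "f \<in> Arr C" "f' \<in> Arr C" "Dom C f' = Cod C f" "Cod C f' = Dom C f"
    "f' \<cdot> f = Id C (Dom C f)" "f \<cdot> f' = Id C (Cod C f)" using isoE[OF assms(1)] .
  obtain g' where g: "g \<in> Arr C" "g' \<in> Arr C" "Dom C g' = Cod C g" "Cod C g' = Dom C g"
    "g' \<cdot> g = Id C (Dom C g)" "g \<cdot> g' = Id C (Cod C g)" using isoE[OF assms(2)] .
  show ?thesis
    by (rule isoI[of _ "f' \<cdot> g'"])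
      (use f g assms(3) in \<open>simp_all add: reassoc[OF f(6)] reassoc[OF g(5)]\<close>)
qed

lemma iso_mono: assumes "iso_arr C f" shows "mono_arr C f"
proof -
  obtain g where g: "f \<in> Arr C" "g \<in> Arr C" "Dom C g = Cod C f" "Cod C g = Dom C f"
    "g \<cdot> f = Id C (Dom C f)" "f \<cdot> g = Id C (Cod C f)" using isoE[OF assms] .
  have "a = b" if "a \<in> Arr C" "b \<in> Arr C" "Cod C a = Dom C f" "Cod C b = Dom C f" "f \<cdot> a = f \<cdot> b" for a b
    using that g assoc[of a f g] assoc[of b f g] Comp_Id_simps(2)[of a] Comp_Id_simps(2)[of b] by metis
  then show ?thesis using g by (auto simp: mono_arr_def)
qed

lemma mono_comp:
  assumes "mono_arr C f" "mono_arr C g" "Cod C f = Dom C g" shows "mono_arr C (g \<cdot> f)"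
proof -
  have "a = b" if "a \<in> Arr C" "b \<in> Arr C" "Cod C a = Dom C f" "Cod C b = Dom C f" "Dom C a = Dom C b"
    "g \<cdot> (f \<cdot> a) = g \<cdot> (f \<cdot> b)" for a b
    using mono_cancel[OF assms(2), of "f \<cdot> a" "f \<cdot> b"] mono_cancel[OF assms(1), of a b] that assms
    by (simp add: mono_Arr)
  then show ?thesis using assms by (auto simp: mono_arr_def)
qed

lemma mono_of_comp:
  assumes "mono_arr C (g \<cdot> f)" "f \<in> Arr C" "g \<in> Arr C" "Cod C f = Dom C g" shows "mono_arr C f"
proof -
  have "a = b" if "a \<in> Arr C" "b \<in> Arr C" "Cod C a = Dom C f" "Cod C b = Dom C f" "Dom C a = Dom C b"
    "f \<cdot> a = f \<cdot> b" for a b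
    using mono_cancel[OF assms(1), of a b] that assms by simp
  then show ?thesis using assms by (auto simp: mono_arr_def)
qed

declare mono_Arr [simp] epi_Arr [simp] iso_Arr [simp]

lemma isomorphic_refl: "X \<in> Obj C \<Longrightarrow> isomorphic C X X"
  unfolding isomorphic_def by (rule bexI[of _ "Id C X"]) simp_all

lemma isomorphic_sym: "isomorphic C X Y \<Longrightarrow> isomorphic C Y X"
  proof -
  assume "isomorphic C X Y"
  then obtain f where f: "iso_arr C f" "Dom C f = X" "Cod C f = Y" by (auto simp: isomorphic_def)
  obtain g where g: "f \<in> Arr C" "g \<in> Arr C" "Dom C g = Cod C f" "Cod C g = Dom C f"
    "g \<cdot> f = Id C (Dom C f)" "f \<cdot> g = Id C (Cod C f)" using isoE[OF f(1)] .
  have "iso_arr C g" by (rule isoI[of _ f]) (use g in simp_all)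
  with g f show ?thesis unfolding isomorphic_def by (intro bexI[of _ g]) simp_all
qed

lemma isomorphic_trans: "isomorphic C X Y \<Longrightarrow> isomorphic C Y Z \<Longrightarrow> isomorphic C X Z"
  proof -
  assume "isomorphic C X Y" "isomorphic C Y Z"
  then obtain f g where "iso_arr C f" "iso_arr C g" "Dom C f = X" "Cod C f = Y" "Dom C g = Y" "Cod C g = Z"
    by (auto simp: isomorphic_def)
  with iso_comp[of f g] show ?thesis unfolding isomorphic_def by (intro bexI[of _ "g \<cdot> f"]) simp_all
qed

lemma isomorphic_Obj: "isomorphic C X Y \<Longrightarrow> X \<in> Obj C \<and> Y \<in> Obj C"
  by (auto simp: isomorphic_def)

lemma isomorphicI: "iso_arr C f \<Longrightarrow> isomorphic C (Dom C f) (Cod C f)"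
  by (auto simp: isomorphic_def)

lemma equiv_iso_rel: "equiv (Obj C) (iso_rel C)"
  by (rule equivI)
    (auto simp: iso_rel_def refl_on_def sym_def trans_def
      intro: isomorphic_refl isomorphic_sym isomorphic_trans)

lemma iso_class_eq_iff: "\<lbrakk>X \<in> Obj C; Y \<in> Obj C\<rbrakk> \<Longrightarrow> iso_class C X = iso_class C Y \<longleftrightarrow> isomorphic C X Y"
  using eq_equiv_class_iff[OF equiv_iso_rel] by (simp add: iso_class_def iso_rel_def)

lemma iso_class_in_Iso [simp]: "X \<in> Obj C \<Longrightarrow> iso_class C X \<in> Iso C"
  by (simp add: Iso_def iso_class_def quotientI)

lemma rep_props:
  assumes "m \<in> Iso C" shows "rep m \<in> Obj C" "iso_class C (rep m) = m" "rep m \<in> m"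
proof -
  obtain X where X: "X \<in> Obj C" "m = iso_class C X"
    using assms by (auto simp: Iso_def iso_class_def elim: quotientE)
  then have "X \<in> m" by (simp add: iso_class_def iso_rel_def isomorphic_refl)
  then show r: "rep m \<in> m" unfolding rep_def by (rule someI)
  then show "rep m \<in> Obj C" using X by (simp add: iso_class_def iso_rel_def)
  with X r show "iso_class C (rep m) = m"
    using iso_class_eq_iff[of X "rep m"] by (simp add: iso_class_def iso_rel_def)
qed

lemma isomorphic_rep: "X \<in> Obj C \<Longrightarrow> isomorphic C (rep (iso_class C X)) X"
  using rep_props[of "iso_class C X"] iso_class_eq_iff by simp

lemma kernelD:
  assumes "is_kernel C k f"
  shows "k \<in> Arr C" "f \<in> Arr C" "Cod C k = Dom C f" "f \<cdot> k = Zero C (Dom C k) (Cod C f)"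
  using assms by (auto simp: is_kernel_def)

lemma cokernelD:
  assumes "is_cokernel C k f"
  shows "k \<in> Arr C" "f \<in> Arr C" "Dom C k = Cod C f" "k \<cdot> f = Zero C (Dom C f) (Cod C k)"
  using assms by (auto simp: is_cokernel_def)

lemma kernel_factor:
  assumes "is_kernel C k f" "h \<in> Arr C" "Cod C h = Dom C f" "f \<cdot> h = Zero C (Dom C h) (Cod C f)"
  obtains u where "u \<in> Arr C" "Dom C u = Dom C h" "Cod C u = Dom C k" "k \<cdot> u = h"
  using assms unfolding is_kernel_def by (metis Dom_in_Obj in_Hom)

lemma cokernel_factor:
  assumes "is_cokernel C k f" "h \<in> Arr C" "Dom C h = Cod C f" "h \<cdot> f = Zero C (Dom C f) (Cod C h)"
  obtains u where "u \<in> Arr C" "Cod C u = Cod C h" "Dom C u = Cod C k" "u \<cdot> k = h"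
  using assms unfolding is_cokernel_def by (metis Cod_in_Obj in_Hom)

end

lemmas (in category) iso_epi = category.iso_mono[OF category_opposite, simplified]
  and epi_comp = category.mono_comp[OF category_opposite, simplified]
  and epi_of_comp = category.mono_of_comp[OF category_opposite, simplified]

section \<open>Additive structure and zero objects\<close>

lemma isomorphic_opposite: "isomorphic (opposite C) X Y \<longleftrightarrow> isomorphic C Y X"
  by (auto simp: isomorphic_def)

lemma short_exact_opposite [simp]: "short_exact (opposite C) p i \<longleftrightarrow> short_exact C i p"
  by (auto simp: short_exact_def)

context preadditive_category
begin

lemma preadditive_opposite: "preadditive_category (opposite C)"
  by (intro preadditive_category.intro preadditive_category_axioms.intro category_opposite)
    (simp_all only: opposite_simps Hom_opposite Hom_group_opposite comm_group_Hom Comp_Add_left Comp_Add_right)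

definition neg :: "'b \<Rightarrow> 'b" where
  "neg f = inv\<^bsub>Hom_group C (Dom C f) (Cod C f)\<^esub> f"

lemma Zero_simps [simp]:
  assumes "X \<in> Obj C" "Y \<in> Obj C"
  shows "Zero C X Y \<in> Arr C" "Dom C (Zero C X Y) = X" "Cod C (Zero C X Y) = Y"
proof -
  interpret comm_group "Hom_group C X Y" using assms by (rule comm_group_Hom)
  show "Zero C X Y \<in> Arr C" "Dom C (Zero C X Y) = X" "Cod C (Zero C X Y) = Y"
    using one_closed by auto
qed

lemma Add_simps [simp]:
  assumes "f \<in> Arr C" "g \<in> Arr C" "Dom C f = Dom C g" "Cod C f = Cod C g"
  shows "Add C f g \<in> Arr C" "Dom C (Add C f g) = Dom C g" "Cod C (Add C f g) = Cod C g"
proof -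
  interpret comm_group "Hom_group C (Dom C g) (Cod C g)" by (rule comm_group_Hom) (use assms in auto)
  show "Add C f g \<in> Arr C" "Dom C (Add C f g) = Dom C g" "Cod C (Add C f g) = Cod C g"
    using m_closed[of f g] assms by auto
qed

lemma Add_commute:
  assumes "f \<in> Arr C" "g \<in> Arr C" "Dom C f = Dom C g" "Cod C f = Cod C g"
  shows "Add C f g = Add C g f"
proof -
  interpret comm_group "Hom_group C (Dom C g) (Cod C g)" by (rule comm_group_Hom) (use assms in auto)
  show ?thesis using m_comm[of f g] assms by auto
qed

lemma Add_assoc:
  assumes "f \<in> Arr C" "g \<in> Arr C" "h \<in> Arr C" "Dom C f = Dom C h" "Cod C f = Cod C h"
    "Dom C g = Dom C h" "Cod C g = Cod C h"
  shows "Add C (Add C f g) h = Add C f (Add C g h)"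
proof -
  interpret comm_group "Hom_group C (Dom C h) (Cod C h)" by (rule comm_group_Hom) (use assms in auto)
  show ?thesis using m_assoc[of f g h] assms by auto
qed

lemma Add_Zero [simp]:
  assumes "f \<in> Arr C" "Dom C f = X" "Cod C f = Y"
  shows "Add C f (Zero C X Y) = f" "Add C (Zero C X Y) f = f"
proof -
  interpret comm_group "Hom_group C X Y" by (rule comm_group_Hom) (use assms in auto)
  show "Add C f (Zero C X Y) = f" "Add C (Zero C X Y) f = f"
    using r_one[of f] l_one[of f] assms by auto
qed

lemma neg_simps [simp]:
  assumes "f \<in> Arr C"
  shows "neg f \<in> Arr C" "Dom C (neg f) = Dom C f" "Cod C (neg f) = Cod C f"
    "Add C f (neg f) = Zero C (Dom C f) (Cod C f)" "Add C (neg f) f = Zero C (Dom C f) (Cod C f)"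
proof -
  interpret comm_group "Hom_group C (Dom C f) (Cod C f)" by (rule comm_group_Hom) (use assms in auto)
  show "neg f \<in> Arr C" "Dom C (neg f) = Dom C f" "Cod C (neg f) = Cod C f"
    "Add C f (neg f) = Zero C (Dom C f) (Cod C f)" "Add C (neg f) f = Zero C (Dom C f) (Cod C f)"
    using inv_closed[of f] l_inv[of f] r_inv[of f] assms by (auto simp: neg_def)
qed

lemma Add_cancel:
  assumes "f \<in> Arr C" "g \<in> Arr C" "h \<in> Arr C" "Dom C f = Dom C h" "Cod C f = Cod C h"
    "Dom C g = Dom C h" "Cod C g = Cod C h" "Add C f h = Add C g h"
  shows "f = g"
proof -
  interpret comm_group "Hom_group C (Dom C h) (Cod C h)" by (rule comm_group_Hom) (use assms in auto)
  show ?thesis using right_cancel[of h f g] assms by auto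
qed

lemma Add_neg_eq_Zero:
  assumes "f \<in> Arr C" "g \<in> Arr C" "Dom C f = Dom C g" "Cod C f = Cod C g"
    "Add C f (neg g) = Zero C (Dom C g) (Cod C g)"
  shows "f = g"
  by (rule Add_cancel[of f g "neg g"]) (use assms in simp_all)

lemma Comp_Add [simp]:
  "\<lbrakk>f \<in> Arr C; g \<in> Arr C; g' \<in> Arr C; Cod C f = Dom C g; Dom C g' = Dom C g; Cod C g' = Cod C g\<rbrakk> \<Longrightarrow>
    Add C g g' \<cdot> f = Add C (g \<cdot> f) (g' \<cdot> f)"
  "\<lbrakk>f \<in> Arr C; f' \<in> Arr C; g \<in> Arr C; Cod C f = Dom C g; Cod C f' = Dom C g; Dom C f = Dom C f'\<rbrakk> \<Longrightarrow>
    g \<cdot> Add C f f' = Add C (g \<cdot> f) (g \<cdot> f')"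
  by (rule Comp_Add_left Comp_Add_right; auto)+

text \<open>By distributivity the composite z satisfies z + z = z, and cancellation in the hom group
  gives z = 0.\<close>

lemma Comp_Zero [simp]:
  assumes "f \<in> Arr C" "Z \<in> Obj C"
  shows "Cod C f = Y \<Longrightarrow> Zero C Y Z \<cdot> f = Zero C (Dom C f) Z"
    "Dom C f = Y \<Longrightarrow> f \<cdot> Zero C Z Y = Zero C Z (Cod C f)"
proof -
  show "Zero C Y Z \<cdot> f = Zero C (Dom C f) Z" if "Cod C f = Y"
  proof -
    let ?z = "Zero C Y Z \<cdot> f"
    have Y: "Y \<in> Obj C" using that assms by auto
    have "Add C (Zero C Y Z) (Zero C Y Z) \<cdot> f = Add C ?z ?z"
      by (rule Comp_Add) (use assms that Y in simp_all)
    then have "Add C ?z ?z = Add C (Zero C (Dom C f) Z) ?z" using assms that Y by simp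
    then show ?thesis by (rule Add_cancel[rotated 7]) (use assms that Y in simp_all)
  qed
  show "f \<cdot> Zero C Z Y = Zero C Z (Cod C f)" if "Dom C f = Y"
  proof -
    let ?z = "f \<cdot> Zero C Z Y"
    have Y: "Y \<in> Obj C" using that assms by auto
    have "f \<cdot> Add C (Zero C Z Y) (Zero C Z Y) = Add C ?z ?z"
      by (rule Comp_Add) (use assms that Y in simp_all)
    then have "Add C ?z ?z = Add C (Zero C Z (Cod C f)) ?z" using assms that Y by simp
    then show ?thesis by (rule Add_cancel[rotated 7]) (use assms that Y in simp_all)
  qed
qed

lemma Comp_neg [simp]:
  assumes "f \<in> Arr C" "g \<in> Arr C" "Cod C f = Dom C g"
  shows "neg g \<cdot> f = neg (g \<cdot> f)" "g \<cdot> neg f = neg (g \<cdot> f)"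
proof -
  have "Add C (neg g) g \<cdot> f = Add C (neg g \<cdot> f) (g \<cdot> f)"
    by (rule Comp_Add) (use assms in simp_all)
  then have "Add C (neg g \<cdot> f) (g \<cdot> f) = Add C (neg (g \<cdot> f)) (g \<cdot> f)" using assms by simp
  then show "neg g \<cdot> f = neg (g \<cdot> f)" by (rule Add_cancel[rotated 7]) (use assms in simp_all)
  have "g \<cdot> Add C (neg f) f = Add C (g \<cdot> neg f) (g \<cdot> f)"
    by (rule Comp_Add) (use assms in simp_all)
  then have "Add C (g \<cdot> neg f) (g \<cdot> f) = Add C (neg (g \<cdot> f)) (g \<cdot> f)" using assms by simp
  then show "g \<cdot> neg f = neg (g \<cdot> f)" by (rule Add_cancel[rotated 7]) (use assms in simp_all)
qed

text \<open>Two arrows with equal composites differ by an arrow whose composite is zero, so only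
  zero composites need testing.\<close>

lemma monoI:
  assumes f: "f \<in> Arr C"
    and z: "\<And>g. \<lbrakk>g \<in> Arr C; Cod C g = Dom C f; f \<cdot> g = Zero C (Dom C g) (Cod C f)\<rbrakk> \<Longrightarrow>
      g = Zero C (Dom C g) (Dom C f)"
  shows "mono_arr C f"
  unfolding mono_arr_def
proof (intro conjI ballI impI f)
  fix X g h assume gh: "g \<in> Hom C X (Dom C f)" "h \<in> Hom C X (Dom C f)" "f \<cdot> g = f \<cdot> h"
  then have "Add C g (neg h) = Zero C X (Dom C f)"
    using z[of "Add C g (neg h)"] f by simp
  then show "g = h" using Add_neg_eq_Zero[of g h] gh f by simp
qed

lemma mono_zero:
  "\<lbrakk>mono_arr C f; g \<in> Arr C; Cod C g = Dom C f; f \<cdot> g = Zero C (Dom C g) (Cod C f)\<rbrakk> \<Longrightarrow>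
    g = Zero C (Dom C g) (Dom C f)"
  by (rule mono_cancel[of f]) simp_all

end

lemmas (in preadditive_category)
  epiI = preadditive_category.monoI[OF preadditive_opposite, simplified]
  and epi_zero = preadditive_category.mono_zero[OF preadditive_opposite, simplified]

context preadditive_category
begin

lemma kernel_mono:
  assumes "is_kernel C k f" shows "mono_arr C k"
  unfolding mono_arr_def
proof (intro conjI ballI impI)
  show "k \<in> Arr C" using kernelD assms by blast
  fix X g h assume X: "X \<in> Obj C" and gh: "g \<in> Hom C X (Dom C k)" "h \<in> Hom C X (Dom C k)"
    and e: "k \<cdot> g = k \<cdot> h"
  note k = kernelD[OF assms]
  have "f \<cdot> (k \<cdot> h) = Zero C X (Cod C f)" using gh k by (simp add: reassoc[OF k(4)])
  moreover have "k \<cdot> h \<in> Hom C X (Dom C f)" using gh k by simp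
  ultimately have "\<exists>!u. u \<in> Hom C X (Dom C k) \<and> k \<cdot> u = k \<cdot> h"
    using assms X unfolding is_kernel_def by blast
  with gh e show "g = h" by blast
qed

text \<open>Uniqueness of the factorization comes from the monomorphism, so only existence has to be
  checked.\<close>

lemma kernelI:
  assumes "mono_arr C k" "f \<in> Arr C" "Cod C k = Dom C f" "f \<cdot> k = Zero C (Dom C k) (Cod C f)"
    and "\<And>h. \<lbrakk>h \<in> Arr C; Cod C h = Dom C f; f \<cdot> h = Zero C (Dom C h) (Cod C f)\<rbrakk> \<Longrightarrow>
      \<exists>u. u \<in> Arr C \<and> Dom C u = Dom C h \<and> Cod C u = Dom C k \<and> k \<cdot> u = h"
  shows "is_kernel C k f"
  unfolding is_kernel_def
proof (intro conjI ballI impI)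
  fix X h assume "h \<in> Hom C X (Dom C f)" "f \<cdot> h = Zero C X (Cod C f)"
  then obtain u where u: "u \<in> Arr C" "Dom C u = X" "Cod C u = Dom C k" "k \<cdot> u = h"
    using assms(5)[of h] by auto
  show "\<exists>!u. u \<in> Hom C X (Dom C k) \<and> k \<cdot> u = h"
    by (rule ex1I[of _ u]) (use u mono_cancel[OF assms(1)] in auto)
qed (use assms in auto)

end

lemmas (in preadditive_category)
  cokernel_epi = preadditive_category.kernel_mono[OF preadditive_opposite, simplified]
  and cokernelI = preadditive_category.kernelI[OF preadditive_opposite, simplified]

section \<open>Zero objects, split arrows and uniqueness of kernels\<close>

context preadditive_category
begin

text \<open>Every arrow into or out of \<open>Z\<close> is its own composite with the identity of
  \<open>Z\<close>, hence zero as soon as that identity is.\<close>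

lemma zero_obj_iff: "zero_obj C Z \<longleftrightarrow> Z \<in> Obj C \<and> Id C Z = Zero C Z Z"
proof
  assume "zero_obj C Z"
  then have "Z \<in> Obj C" "\<exists>!f. f \<in> Hom C Z Z" by (auto simp: zero_obj_def)
  moreover from this have "Id C Z \<in> Hom C Z Z" "Zero C Z Z \<in> Hom C Z Z" by simp_all
  ultimately show "Z \<in> Obj C \<and> Id C Z = Zero C Z Z" by blast
next
  assume Z: "Z \<in> Obj C \<and> Id C Z = Zero C Z Z"
  have "f = Zero C Z X" if "f \<in> Hom C Z X" "X \<in> Obj C" for X f
    using that Z Comp_Id_simps(1)[of f Z] by simp
  moreover have "f = Zero C X Z" if "f \<in> Hom C X Z" "X \<in> Obj C" for X f
    using that Z Comp_Id_simps(2)[of f Z] by simp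
  moreover have "Zero C Z X \<in> Hom C Z X" "Zero C X Z \<in> Hom C X Z" if "X \<in> Obj C" for X
    using that Z by simp_all
  ultimately show "zero_obj C Z" using Z unfolding zero_obj_def by blast
qed

lemma zero_obj_Obj: "zero_obj C Z \<Longrightarrow> Z \<in> Obj C"
  by (simp add: zero_obj_iff)

lemma to_zero_obj: "\<lbrakk>zero_obj C (Cod C f); f \<in> Arr C\<rbrakk> \<Longrightarrow> f = Zero C (Dom C f) (Cod C f)"
  using Comp_Id_simps(2)[of f "Cod C f"] by (simp add: zero_obj_iff)

lemma from_zero_obj: "\<lbrakk>zero_obj C (Dom C f); f \<in> Arr C\<rbrakk> \<Longrightarrow> f = Zero C (Dom C f) (Cod C f)"
  using Comp_Id_simps(1)[of f "Dom C f"] by (simp add: zero_obj_iff)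

lemma zero_obj_isomorphic:
  assumes "zero_obj C X" "zero_obj C Y" shows "isomorphic C X Y"
proof -
  have o: "X \<in> Obj C" "Y \<in> Obj C" using assms by (simp_all add: zero_obj_Obj)
  have "iso_arr C (Zero C X Y)" by (rule isoI[of _ "Zero C Y X"]) (use assms o in \<open>simp_all add: zero_obj_iff\<close>)
  from isomorphicI[OF this] show ?thesis using o by simp
qed

lemma zero_obj_mono: assumes "zero_obj C (Cod C f)" "mono_arr C f" shows "zero_obj C (Dom C f)"
proof -
  have "f \<cdot> Id C (Dom C f) = f \<cdot> Zero C (Dom C f) (Dom C f)"
    using to_zero_obj[OF assms(1)] assms(2) by simp
  then have "Id C (Dom C f) = Zero C (Dom C f) (Dom C f)"
    by (rule mono_cancel[OF assms(2), rotated 5]) (use assms(2) in simp_all)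
  then show ?thesis using assms by (simp add: zero_obj_iff)
qed

lemma zero_obj_epi: assumes "zero_obj C (Dom C f)" "epi_arr C f" shows "zero_obj C (Cod C f)"
proof -
  have "Id C (Cod C f) \<cdot> f = Zero C (Cod C f) (Cod C f) \<cdot> f"
    using from_zero_obj[OF assms(1)] assms(2) by simp
  then have "Id C (Cod C f) = Zero C (Cod C f) (Cod C f)"
    by (rule epi_cancel[OF assms(2), rotated 5]) (use assms(2) in simp_all)
  then show ?thesis using assms by (simp add: zero_obj_iff)
qed

lemma zero_obj_isomorphic_zero: assumes "zero_obj C X" "isomorphic C X Y" shows "zero_obj C Y"
  using assms zero_obj_epi iso_epi by (fastforce simp: isomorphic_def)

lemma split_epi:
  assumes "r \<in> Arr C" "s \<in> Arr C" "Dom C r = Cod C s" "r \<cdot> s = Id C (Cod C r)"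
  shows "epi_arr C r"
  by (rule epi_of_comp[of r s]) (use assms in \<open>simp_all add: iso_epi\<close>)

lemma split_mono:
  assumes "r \<in> Arr C" "s \<in> Arr C" "Dom C r = Cod C s" "r \<cdot> s = Id C (Dom C s)"
  shows "mono_arr C s"
  by (rule mono_of_comp[of r s]) (use assms in \<open>simp_all add: iso_mono\<close>)

lemma kernel_unique:
  assumes "is_kernel C k f" "is_kernel C k' f"
  obtains w where "iso_arr C w" "Dom C w = Dom C k'" "Cod C w = Dom C k" "k \<cdot> w = k'"
proof -
  note k = kernelD[OF assms(1)] and k' = kernelD[OF assms(2)]
  obtain w where w: "w \<in> Arr C" "Dom C w = Dom C k'" "Cod C w = Dom C k" "k \<cdot> w = k'"
    using kernel_factor[OF assms(1), of k'] k' by auto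
  obtain v where v: "v \<in> Arr C" "Dom C v = Dom C k" "Cod C v = Dom C k'" "k' \<cdot> v = k"
    using kernel_factor[OF assms(2), of k] k by auto
  have "w \<cdot> v = Id C (Dom C k)"
    by (rule mono_cancel[OF kernel_mono[OF assms(1)]])
      (use w v k in \<open>simp_all add: reassoc[OF w(4)]\<close>)
  moreover have "v \<cdot> w = Id C (Dom C k')"
    by (rule mono_cancel[OF kernel_mono[OF assms(2)]])
      (use w v k' in \<open>simp_all add: reassoc[OF v(4)]\<close>)
  ultimately have "iso_arr C w" by (intro isoI[of w v]) (use w v in simp_all)
  with w that show thesis by blast
qed

end

lemma (in preadditive_category) cokernel_unique:
  assumes "is_cokernel C k f" "is_cokernel C k' f"
  obtains w where "iso_arr C w" "Cod C w = Cod C k'" "Dom C w = Cod C k" "w \<cdot> k = k'"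
  using preadditive_category.kernel_unique[OF preadditive_opposite, simplified, OF assms] by metis

section \<open>Images and simple objects\<close>

lemma direct_sum_opposite:
  "direct_sum (opposite C) n S M i p \<longleftrightarrow> direct_sum C n S M p i"
proof -
  have "(\<forall>j<n::nat. \<forall>k<n. i k \<cdot>\<^bsub>C\<^esub> p j = (if j = k then Id C (S k) else Zero C (S j) (S k))) \<longleftrightarrow>
    (\<forall>j<n. \<forall>k<n. i j \<cdot>\<^bsub>C\<^esub> p k = (if j = k then Id C (S k) else Zero C (S k) (S j)))"
    by (metis (full_types))
  then show ?thesis unfolding direct_sum_def by auto
qed

section \<open>Kernels, cokernels and images\<close>

context abelian_category
begin

lemma abelian_opposite: "abelian_category (opposite C)"
proof (intro abelian_category.intro abelian_category_axioms.intro preadditive_opposite)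
  fix S and n :: nat assume "\<forall>k<n. S k \<in> Obj (opposite C)"
  then show "\<exists>M i p. direct_sum (opposite C) n S M i p"
    using ex_direct_sum[of n S] by (auto simp: direct_sum_opposite)
qed (simp_all add: ex_kernel ex_cokernel mono_is_kernel epi_is_cokernel)

text \<open>The direct sum of no objects: an empty product in the hom group is its unit, so the
  identity is zero.\<close>

lemma ex_zero_obj: "\<exists>Z. zero_obj C Z"
proof -
  obtain M i p where M: "direct_sum C 0 undefined M i p" using ex_direct_sum[of 0 undefined] by auto
  then have "M \<in> Obj C" by (simp add: direct_sum_def)
  then interpret comm_group "Hom_group C M M" by (intro comm_group_Hom)
  show ?thesis using M by (auto simp: direct_sum_def zero_obj_iff)
qed

text \<open>\<open>u\<close> is the kernel of some \<open>g\<close>, and \<open>g\<close> factors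
  through the cokernel \<open>c\<close>; whatever \<open>c\<close> kills is therefore killed by
  \<open>g\<close> and factors through \<open>u\<close>.\<close>

lemma mono_kernel:
  assumes "mono_arr C u" "is_cokernel C c u" shows "is_kernel C u c"
proof -
  obtain g where g: "is_kernel C u g" using mono_is_kernel assms(1) by blast
  note u = kernelD[OF g] and c = cokernelD[OF assms(2)]
  obtain g' where g': "g' \<in> Arr C" "Cod C g' = Cod C g" "Dom C g' = Cod C c" "g' \<cdot> c = g"
    using cokernel_factor[OF assms(2), of g] u by auto
  show ?thesis
  proof (rule kernelI[OF assms(1)])
    fix h assume h: "h \<in> Arr C" "Cod C h = Dom C c" "c \<cdot> h = Zero C (Dom C h) (Cod C c)"
    have "g \<cdot> h = g' \<cdot> (c \<cdot> h)" using g'(1-3) h c by (simp flip: g'(4))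
    also have "\<dots> = Zero C (Dom C h) (Cod C g)" using h g' by simp
    finally show "\<exists>v. v \<in> Arr C \<and> Dom C v = Dom C h \<and> Cod C v = Dom C u \<and> u \<cdot> v = h"
      using kernel_factor[OF g, of h] h u c by metis
  qed (use c in simp_all)
qed

lemma short_exact_mono: "\<lbrakk>mono_arr C u; is_cokernel C c u\<rbrakk> \<Longrightarrow> short_exact C u c"
  by (simp add: short_exact_def mono_kernel)

end

lemmas (in abelian_category)
  epi_cokernel = abelian_category.mono_kernel[OF abelian_opposite, simplified]
  and short_exact_epi = abelian_category.short_exact_mono[OF abelian_opposite, simplified]

context abelian_category
begin

lemma short_exactD:
  assumes "short_exact C i p"
  shows "mono_arr C i" "epi_arr C p" "is_kernel C i p" "is_cokernel C p i" "i \<in> Arr C" "p \<in> Arr C"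
    "Dom C p = Cod C i" "p \<cdot> i = Zero C (Dom C i) (Cod C p)"
proof -
  show "is_kernel C i p" "is_cokernel C p i" using assms by (simp_all add: short_exact_def)
  then show "mono_arr C i" "epi_arr C p" "i \<in> Arr C" "p \<in> Arr C"
    "Dom C p = Cod C i" "p \<cdot> i = Zero C (Dom C i) (Cod C p)"
    using kernel_mono[of i p] cokernel_epi[of p i] kernelD[of i p] by simp_all
qed

lemma mono_epi_iso:
  assumes "mono_arr C f" "epi_arr C f" shows "iso_arr C f"
proof -
  obtain g where g: "is_kernel C f g" using mono_is_kernel assms(1) by blast
  note k = kernelD[OF g]
  have "g = Zero C (Cod C f) (Cod C g)"
    using epi_zero[OF assms(2), of g] k by simp
  then have "g \<cdot> Id C (Cod C f) = Zero C (Cod C f) (Cod C g)" using k by simp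
  then obtain u where u: "u \<in> Arr C" "Dom C u = Cod C f" "Cod C u = Dom C f" "f \<cdot> u = Id C (Cod C f)"
    using kernel_factor[OF g, of "Id C (Cod C f)"] k by auto
  have "u \<cdot> f = Id C (Dom C f)"
    by (rule mono_cancel[OF assms(1)]) (use u k in \<open>simp_all add: reassoc[OF u(4)]\<close>)
  then show ?thesis by (intro isoI[of f u]) (use u k in simp_all)
qed

text \<open>\<open>m\<close> is the kernel of the cokernel of \<open>f\<close>. If \<open>g\<close>
  kills \<open>e\<close>, then \<open>f\<close> factors through the mono \<open>m \<cdot> k\<close>
  with \<open>k\<close> the kernel of \<open>g\<close>; the cokernel of \<open>m \<cdot> k\<close>
  then kills \<open>f\<close>, hence \<open>m\<close>, so \<open>k\<close> is a split epimorphism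
  and \<open>g\<close> is zero.\<close>

lemma image_factorization:
  assumes "f \<in> Arr C"
  obtains m e where "mono_arr C m" "epi_arr C e" "Dom C m = Cod C e" "Dom C e = Dom C f"
    "Cod C m = Cod C f" "m \<cdot> e = f"
proof -
  obtain c where c: "is_cokernel C c f" using ex_cokernel assms by blast
  note cf = cokernelD[OF c]
  obtain m where m: "is_kernel C m c" using ex_kernel cf by blast
  note mc = kernelD[OF m] and mm = kernel_mono[OF m]
  obtain e where e: "e \<in> Arr C" "Dom C e = Dom C f" "Cod C e = Dom C m" "m \<cdot> e = f"
    using kernel_factor[OF m, of f] cf by auto
  have "epi_arr C e"
  proof (rule epiI)
    fix g assume g: "g \<in> Arr C" "Dom C g = Cod C e" "g \<cdot> e = Zero C (Dom C e) (Cod C g)"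
    obtain k where k: "is_kernel C k g" using ex_kernel g by blast
    note kg = kernelD[OF k]
    obtain e' where e': "e' \<in> Arr C" "Dom C e' = Dom C e" "Cod C e' = Dom C k" "k \<cdot> e' = e"
      using kernel_factor[OF k, of e] g e by auto
    have mk: "mono_arr C (m \<cdot> k)" by (rule mono_comp[OF kernel_mono[OF k] mm]) (use kg g e in simp)
    then obtain d where d: "is_cokernel C d (m \<cdot> k)" using ex_cokernel mono_Arr by blast
    have dd: "d \<in> Arr C" "Dom C d = Cod C m" "d \<cdot> (m \<cdot> k) = Zero C (Dom C k) (Cod C d)"
      using cokernelD[OF d] kg g e mc by simp_all
    have "d \<cdot> f = (d \<cdot> (m \<cdot> k)) \<cdot> e'"
      using dd(1,2) e' e kg g mc by simp
    also have "\<dots> = Zero C (Dom C f) (Cod C d)"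
      unfolding dd(3) using dd(1,2) e' e kg by simp
    finally obtain d' where d': "d' \<in> Arr C" "Cod C d' = Cod C d" "Dom C d' = Cod C c" "d' \<cdot> c = d"
      using cokernel_factor[OF c, of d] dd mc cf by auto
    have "d \<cdot> m = Zero C (Dom C m) (Cod C d)"
      using d'(1-3) mc cf by (simp flip: d'(4))
    then obtain v where v: "v \<in> Arr C" "Dom C v = Dom C m" "Cod C v = Dom C k" "m \<cdot> k \<cdot> v = m"
      using kernel_factor[OF mono_kernel[OF mk d], of m] dd mc kg g e by auto
    have "k \<cdot> v = Id C (Dom C m)"
      by (rule mono_cancel[OF mm]) (use v mc kg g e in simp_all)
    then have "g = g \<cdot> (k \<cdot> v)" using g e by simp
    also have "\<dots> = Zero C (Cod C e) (Cod C g)" using v e(1-3) g(1,2) kg by (simp add: reassoc[OF kg(4)])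
    finally show "g = Zero C (Cod C e) (Cod C g)" .
  qed (use e in simp)
  with that[of m e] mm e mc cf show thesis by simp
qed

lemma kernel_zero_obj_mono:
  assumes "is_kernel C k f" "zero_obj C (Dom C k)" shows "mono_arr C f"
proof (rule monoI)
  note k = kernelD[OF assms(1)]
  show "f \<in> Arr C" using k by simp
  fix g assume g: "g \<in> Arr C" "Cod C g = Dom C f" "f \<cdot> g = Zero C (Dom C g) (Cod C f)"
  obtain u where u: "u \<in> Arr C" "Dom C u = Dom C g" "Cod C u = Dom C k" "k \<cdot> u = g"
    using kernel_factor[OF assms(1) g] by auto
  then show "g = Zero C (Dom C g) (Dom C f)"
    using to_zero_obj[of u] assms(2) k by (metis Comp_Zero(2) Dom_in_Obj)
qed

end

lemmas (in abelian_category)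
  cokernel_zero_obj_epi = abelian_category.kernel_zero_obj_mono[OF abelian_opposite, simplified]

section \<open>Simple objects and Schur's lemma\<close>

context abelian_category
begin

lemma simple_Obj: "simple_obj C S \<Longrightarrow> S \<in> Obj C"
  by (simp add: simple_obj_def)

text \<open>The kernel of an epimorphism out of \<open>S\<close> is zero or everything, so the
  epimorphism is invertible or zero: simplicity can be tested on quotients as well as on
  subobjects.\<close>

lemma simple_opposite_imp: assumes "simple_obj C S" shows "simple_obj (opposite C) S"
  unfolding simple_obj_def
proof (intro conjI allI impI)
  show "S \<in> Obj (opposite C)" "\<not> zero_obj (opposite C) S"
    using assms by (simp_all add: simple_obj_def)
  fix p assume "mono_arr (opposite C) p \<and> Cod (opposite C) p = S"
  then have p: "epi_arr C p" "Dom C p = S" by simp_all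
  obtain k where k: "is_kernel C k p" using ex_kernel p epi_Arr by blast
  note kp = kernelD[OF k]
  have "zero_obj C (Dom C k) \<or> iso_arr C k"
    using assms kernel_mono[OF k] kp p by (simp add: simple_obj_def)
  then show "zero_obj (opposite C) (Dom (opposite C) p) \<or> iso_arr (opposite C) p"
  proof
    assume "zero_obj C (Dom C k)"
    then have "iso_arr C p" using kernel_zero_obj_mono[OF k] p mono_epi_iso by blast
    then show ?thesis by simp
  next
    assume "iso_arr C k"
    then have "p = Zero C (Dom C p) (Cod C p)" using epi_zero[OF iso_epi, of k p] kp by simp
    then have "Id C (Cod C p) \<cdot> p = Zero C (Cod C p) (Cod C p) \<cdot> p" using kp by simp
    then have "Id C (Cod C p) = Zero C (Cod C p) (Cod C p)"
      by (rule epi_cancel[OF p(1), rotated 5]) (use kp in simp_all)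
    then show ?thesis using kp by (simp add: zero_obj_iff)
  qed
qed

end

lemma (in abelian_category) simple_opposite [simp]: "simple_obj (opposite C) S \<longleftrightarrow> simple_obj C S"
  using simple_opposite_imp abelian_category.simple_opposite_imp[OF abelian_opposite] by auto

context abelian_category
begin

text \<open>The image of a nonzero arrow is a nonzero subobject of \<open>T\<close>, hence all of
  it.\<close>

lemma to_simple_epi:
  assumes "simple_obj C T" "f \<in> Arr C" "Cod C f = T" "f \<noteq> Zero C (Dom C f) T"
  shows "epi_arr C f"
proof -
  obtain m e where me: "mono_arr C m" "epi_arr C e" "Dom C m = Cod C e" "Dom C e = Dom C f"
    "Cod C m = Cod C f" "m \<cdot> e = f" using image_factorization[OF assms(2)] .
  have "\<not> zero_obj C (Dom C m)"
  proof
    assume "zero_obj C (Dom C m)"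
    then have "f = Zero C (Dom C f) T"
      using from_zero_obj[of m] me assms Comp_Zero(1) by (metis Cod_in_Obj epi_Arr mono_Arr)
    with assms show False by simp
  qed
  then have "iso_arr C m" using assms(1,3) me(1,5) unfolding simple_obj_def by blast
  then show ?thesis using epi_comp[of m e] me iso_epi by auto
qed

end

lemmas (in abelian_category)
  from_simple_mono = abelian_category.to_simple_epi[OF abelian_opposite, simplified]

context abelian_category
begin

lemma schur:
  assumes "simple_obj C S" "simple_obj C T" "f \<in> Arr C" "Dom C f = S" "Cod C f = T" "f \<noteq> Zero C S T"
  shows "iso_arr C f"
  using to_simple_epi[of T f] from_simple_mono[of S f] mono_epi_iso assms by auto

lemma simple_iso: assumes "simple_obj C S" "isomorphic C S T" shows "simple_obj C T"
proof -
  obtain w where w: "iso_arr C w" "Dom C w = T" "Cod C w = S"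
    using isomorphic_sym[OF assms(2)] by (auto simp: isomorphic_def)
  have "\<not> zero_obj C T"
    using assms isomorphic_sym zero_obj_isomorphic_zero by (metis simple_obj_def)
  moreover have "zero_obj C (Dom C u) \<or> iso_arr C u" if u: "mono_arr C u" "Cod C u = T" for u
  proof -
    have "mono_arr C (w \<cdot> u)" using mono_comp[of u w] u w iso_mono by auto
    then have "zero_obj C (Dom C u) \<or> iso_arr C (w \<cdot> u)"
      using assms u w by (auto simp: simple_obj_def)
    moreover have "iso_arr C u" if "iso_arr C (w \<cdot> u)"
    proof -
      obtain w' where w': "w \<in> Arr C" "w' \<in> Arr C" "Dom C w' = Cod C w" "Cod C w' = Dom C w"
        "w' \<cdot> w = Id C (Dom C w)" "w \<cdot> w' = Id C (Cod C w)" using isoE[OF w(1)] .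
      have "iso_arr C (w' \<cdot> (w \<cdot> u))"
        by (rule iso_comp[OF that isoI[of w' w]]) (use w w' u in simp_all)
      then show ?thesis using u w w' by (simp add: reassoc[OF w'(5)])
    qed
    ultimately show ?thesis by blast
  qed
  ultimately show ?thesis using w by (auto simp: simple_obj_def)
qed

text \<open>\<open>e\<close> is the restriction of \<open>p\<close> to the preimage of Ker t. With
  \<open>j \<cdot> m\<close> the image of \<open>p \<cdot> k\<close>, its cokernel \<open>d\<close>
  satisfies \<open>d \<cdot> p \<cdot> k = 0\<close>, so \<open>d\<close> factors as
  \<open>w \<cdot> t\<close> and kills \<open>j\<close>; hence \<open>j\<close> factors through
  \<open>j \<cdot> m\<close>, and \<open>m\<close> is a split epimorphism.\<close>

lemma pullback_epi:
  assumes p: "epi_arr C p" and t: "epi_arr C t" and j: "is_kernel C j t" and k: "is_kernel C k (t \<cdot> p)"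
    and pt: "Dom C t = Cod C p"
    and e: "e \<in> Arr C" "Dom C e = Dom C k" "Cod C e = Dom C j" "j \<cdot> e = p \<cdot> k"
  shows "epi_arr C e"
proof -
  note jt = kernelD[OF j] and ktp = kernelD[OF k]
  have tp: "epi_arr C (t \<cdot> p)" using epi_comp t p pt by auto
  obtain m e' where me: "mono_arr C m" "epi_arr C e'" "Dom C m = Cod C e'" "Dom C e' = Dom C e"
    "Cod C m = Cod C e" "m \<cdot> e' = e" using image_factorization[OF e(1)] .
  have jm: "mono_arr C (j \<cdot> m)" using mono_comp[OF me(1) kernel_mono[OF j]] me e by simp
  then obtain d where d: "is_cokernel C d (j \<cdot> m)" using ex_cokernel mono_Arr by blast
  have dd: "d \<in> Arr C" "Dom C d = Cod C j" "d \<cdot> (j \<cdot> m) = Zero C (Dom C m) (Cod C d)"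
    using cokernelD[OF d] jt me e by simp_all
  have "d \<cdot> p \<cdot> k = (d \<cdot> (j \<cdot> m)) \<cdot> e'"
    using dd(1,2) me(1-5) e jt ktp pt p t by (simp add: me(6))
  also have "\<dots> = Zero C (Dom C k) (Cod C d)"
    unfolding dd(3) using dd(1,2) me e by simp
  finally obtain w where w: "w \<in> Arr C" "Cod C w = Cod C d" "Dom C w = Cod C t" "w \<cdot> (t \<cdot> p) = d \<cdot> p"
    using cokernel_factor[OF epi_cokernel[OF tp k], of "d \<cdot> p"] dd jt pt p t ktp by auto
  have "d = w \<cdot> t"
    by (rule epi_cancel[OF p]) (use w dd jt pt p t in simp_all)
  then have "d \<cdot> j = Zero C (Dom C j) (Cod C d)" using w dd jt by simp
  then obtain v where v: "v \<in> Arr C" "Dom C v = Dom C j" "Cod C v = Dom C m" "j \<cdot> m \<cdot> v = j"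
    using kernel_factor[OF mono_kernel[OF jm d], of j] dd jt me e by auto
  have "m \<cdot> v = Id C (Dom C j)"
    by (rule mono_cancel[OF kernel_mono[OF j]]) (use v me e jt in simp_all)
  then have "epi_arr C m" using split_epi[of m v] v me e by simp
  then show ?thesis using epi_comp[of m e'] me by auto
qed

end

section \<open>The Jordan--Hoelder theorem\<close>

text \<open>A composition series read from the top, of which only the multiset of factors is
  recorded; unlike the indexed chain of \<open>composition_series\<close> it supports rule
  induction.\<close>

inductive composition_factors ::
  "('o, 'm, 'x) preadditive_scheme \<Rightarrow> 'o \<Rightarrow> 'o set multiset \<Rightarrow> bool" for C where
  zero: "zero_obj C Z \<Longrightarrow> composition_factors C Z {#}"
| step: "\<lbrakk>short_exact C i p; simple_obj C (Cod C p); composition_factors C (Dom C i) ms\<rbrakk> \<Longrightarrow>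
    composition_factors C (Cod C i) (add_mset (iso_class C (Cod C p)) ms)"

context abelian_category
begin

text \<open>With its dual \<open>short_exact_iso_right\<close>, this allows both ends of a short
  exact sequence to be replaced by isomorphic objects.\<close>

lemma short_exact_iso_left:
  assumes "short_exact C i p" "iso_arr C w" "Cod C w = Dom C i"
  shows "short_exact C (i \<cdot> w) p"
proof -
  note ip = short_exactD[OF assms(1)]
  obtain v where v: "w \<in> Arr C" "v \<in> Arr C" "Dom C v = Cod C w" "Cod C v = Dom C w"
    "v \<cdot> w = Id C (Dom C w)" "w \<cdot> v = Id C (Cod C w)" using isoE[OF assms(2)] .
  have "is_kernel C (i \<cdot> w) p"
  proof (rule kernelI)
    show "mono_arr C (i \<cdot> w)" using mono_comp[OF iso_mono[OF assms(2)] ip(1)] assms by simp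
    show "p \<in> Arr C" "Cod C (i \<cdot> w) = Dom C p" using ip v assms by simp_all
    show "p \<cdot> (i \<cdot> w) = Zero C (Dom C (i \<cdot> w)) (Cod C p)"
      using ip(5-7) v(1) assms(3) by (simp add: reassoc[OF ip(8)])
    fix h assume h: "h \<in> Arr C" "Cod C h = Dom C p" "p \<cdot> h = Zero C (Dom C h) (Cod C p)"
    obtain u where u: "u \<in> Arr C" "Dom C u = Dom C h" "Cod C u = Dom C i" "i \<cdot> u = h"
      using kernel_factor[OF ip(3) h] .
    have "i \<cdot> w \<cdot> (v \<cdot> u) = h"
      using u ip(5) v(1,2,4) assms(3) v(3) by (simp add: reassoc[OF v(6)])
    with u v assms show "\<exists>u. u \<in> Arr C \<and> Dom C u = Dom C h \<and> Cod C u = Dom C (i \<cdot> w) \<and> i \<cdot> w \<cdot> u = h"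
      using ip by (intro exI[of _ "v \<cdot> u"]) simp
  qed
  then show ?thesis using short_exact_epi ip by blast
qed

end

lemmas (in abelian_category)
  short_exact_iso_right = abelian_category.short_exact_iso_left[OF abelian_opposite, simplified]

context abelian_category
begin

lemma short_exact_iso_mid:
  assumes "short_exact C i p" "iso_arr C w" "Dom C w = Cod C i"
  obtains p' where "short_exact C (w \<cdot> i) p'" "Cod C p' = Cod C p"
proof -
  note ip = short_exactD[OF assms(1)]
  obtain v where v: "w \<in> Arr C" "v \<in> Arr C" "Dom C v = Cod C w" "Cod C v = Dom C w"
    "v \<cdot> w = Id C (Dom C w)" "w \<cdot> v = Id C (Cod C w)" using isoE[OF assms(2)] .
  have vi: "iso_arr C v" by (rule isoI[of v w]) (use v in simp_all)
  have "is_cokernel C (p \<cdot> v) (w \<cdot> i)"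
  proof (rule cokernelI)
    show "epi_arr C (p \<cdot> v)" using epi_comp[OF ip(2) iso_epi[OF vi]] v assms(3) ip(7) by simp
    show "w \<cdot> i \<in> Arr C" "Dom C (p \<cdot> v) = Cod C (w \<cdot> i)" using ip v assms by simp_all
    show "p \<cdot> v \<cdot> (w \<cdot> i) = Zero C (Dom C (w \<cdot> i)) (Cod C (p \<cdot> v))"
      using ip(5-8) v(1-4) assms(3) by (simp add: reassoc[OF v(5)])
    fix h assume h: "h \<in> Arr C" "Dom C h = Cod C (w \<cdot> i)"
      "h \<cdot> (w \<cdot> i) = Zero C (Dom C (w \<cdot> i)) (Cod C h)"
    have h': "Dom C h = Cod C w" "h \<cdot> w \<cdot> i = Zero C (Dom C i) (Cod C h)"
      using h ip(5) v(1) assms(3) by simp_all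
    obtain u where u: "u \<in> Arr C" "Cod C u = Cod C h" "Dom C u = Cod C p" "u \<cdot> p = h \<cdot> w"
      using cokernel_factor[OF ip(4), of "h \<cdot> w"] h h' ip assms by auto
    have "u \<cdot> (p \<cdot> v) = h"
      using reassoc[OF u(4), of v] h(1) h'(1) v ip u assms(3) by simp
    with u v assms ip h show "\<exists>u. u \<in> Arr C \<and> Cod C u = Cod C h \<and> Dom C u = Cod C (p \<cdot> v) \<and> u \<cdot> (p \<cdot> v) = h"
      by (intro exI[of _ "u"]) simp
  qed
  moreover have "mono_arr C (w \<cdot> i)" using mono_comp[OF ip(1) iso_mono[OF assms(2)]] assms by simp
  ultimately have "short_exact C (w \<cdot> i) (p \<cdot> v)" using short_exact_mono by blast
  moreover have "Cod C (p \<cdot> v) = Cod C p" using ip v assms by simp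
  ultimately show thesis using that by blast
qed

lemma epi_not_zero:
  assumes "epi_arr C p" "\<not> zero_obj C (Cod C p)" shows "p \<noteq> Zero C (Dom C p) (Cod C p)"
proof
  assume "p = Zero C (Dom C p) (Cod C p)"
  then have "Id C (Cod C p) \<cdot> p = Zero C (Cod C p) (Cod C p) \<cdot> p" using assms by simp
  then have "Id C (Cod C p) = Zero C (Cod C p) (Cod C p)"
    by (rule epi_cancel[OF assms(1), rotated 5]) (use assms in simp_all)
  then show False using assms by (simp add: zero_obj_iff)
qed

lemma composition_factors_iso:
  assumes "composition_factors C M ms" "isomorphic C M M'" shows "composition_factors C M' ms"
  using assms(1)
proof cases
  case zero
  with zero_obj_isomorphic_zero[OF zero(2) assms(2)] show ?thesis by (simp add: composition_factors.zero)
next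
  case (step i p ms')
  obtain w where w: "iso_arr C w" "Dom C w = M" "Cod C w = M'"
    using assms(2) by (auto simp: isomorphic_def)
  obtain p' where p: "short_exact C (w \<cdot> i) p'" "Cod C p' = Cod C p"
    using short_exact_iso_mid[OF step(3) w(1)] w(2) step(1) by auto
  have "composition_factors C (Cod C (w \<cdot> i)) (add_mset (iso_class C (Cod C p')) ms')"
    by (rule composition_factors.step[OF p(1)]) (use step p w short_exactD[OF step(3)] in simp_all)
  then show ?thesis using w step p short_exactD[OF step(3)] by simp
qed

lemma composition_factors_zero_iff:
  assumes "composition_factors C M ms" shows "zero_obj C M \<longleftrightarrow> ms = {#}"
  using assms
proof cases
  case (step i p ms')
  have "\<not> zero_obj C M"
    using zero_obj_epi[of p] short_exactD[OF step(3)] step by (auto simp: simple_obj_def)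
  then show ?thesis using step by simp
qed auto

lemma composition_series_factors:
  assumes "composition_series C M n X i p"
  shows "composition_factors C M (image_mset (\<lambda>k. iso_class C (Cod C (p k))) (mset_set {..<n}))"
  using assms
proof (induction n arbitrary: M)
  case 0
  then show ?case by (auto simp: composition_series_def intro: composition_factors.zero)
next
  case (Suc n)
  then have "composition_series C (X n) n X i p" by (simp add: composition_series_def)
  from Suc.IH[OF this]
  have "composition_factors C (Cod C (i n)) (add_mset (iso_class C (Cod C (p n)))
      (image_mset (\<lambda>k. iso_class C (Cod C (p k))) (mset_set {..<n})))"
    using Suc.prems by (intro composition_factors.step) (simp_all add: composition_series_def)
  then show ?case using Suc.prems by (simp add: composition_series_def lessThan_Suc)
qed

end

locale finite_length_category = abelian_category +
  assumes fin_length: "finite_length C"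
begin

lemma ex_composition_factors: "M \<in> Obj C \<Longrightarrow> \<exists>ms. composition_factors C M ms"
  using fin_length composition_series_factors unfolding finite_length_def by blast

text \<open>Jordan-Hoelder, by induction on the length. Two maximal subobjects
  \<open>Dom C i\<close> and \<open>Dom C j\<close> of \<open>M\<close> coincide or meet in a
  subobject that is maximal in both, with the two simple quotients interchanged; a series through
  the intersection compares the two given ones.\<close>

lemma composition_factors_unique:
  assumes "composition_factors C M ms" "composition_factors C M ms'"
  shows "ms = ms'"
  using assms
proof (induction "size ms" arbitrary: M ms ms' rule: less_induct)
  case less
  show ?case
  proof (cases "zero_obj C M")
    case True
    then show ?thesis using less.prems composition_factors_zero_iff by blast
  next
    case False
    obtain i p a where ip: "short_exact C i p" "simple_obj C (Cod C p)" "Cod C i = M"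
      "composition_factors C (Dom C i) a" "ms = add_mset (iso_class C (Cod C p)) a"
      using less.prems(1) by cases (use False in auto)
    obtain j q b where jq: "short_exact C j q" "simple_obj C (Cod C q)" "Cod C j = M"
      "composition_factors C (Dom C j) b" "ms' = add_mset (iso_class C (Cod C q)) b"
      using less.prems(2) by cases (use False in auto)
    note ip' = short_exactD[OF ip(1)] and jq' = short_exactD[OF jq(1)]
    have IH: "a = c" if "composition_factors C (Dom C i) c" for c
      using less.hyps[of a "Dom C i" c] ip that by simp
    have nz: "q \<noteq> Zero C (Dom C q) (Cod C q)" "p \<noteq> Zero C (Dom C p) (Cod C p)"
      using epi_not_zero ip(2) jq(2) ip'(2) jq'(2) by (auto simp: simple_obj_def)
    \<comment> \<open>If \<open>q\<close> kills \<open>i\<close>, it factors through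
      \<open>p\<close> by a nonzero arrow between simple objects, an isomorphism by Schur.\<close>
    have fac: "\<exists>t. iso_arr C t \<and> Dom C t = Cod C p \<and> Cod C t = Cod C q \<and> t \<cdot> p = q"
      if qi: "q \<cdot> i = Zero C (Dom C i) (Cod C q)"
    proof -
      obtain t where t: "t \<in> Arr C" "Cod C t = Cod C q" "Dom C t = Cod C p" "t \<cdot> p = q"
        using cokernel_factor[OF ip'(4), of q] qi ip jq ip' jq' by auto
      have "t \<noteq> Zero C (Cod C p) (Cod C q)"
      proof
        assume "t = Zero C (Cod C p) (Cod C q)"
        then have "q = Zero C (Dom C q) (Cod C q)" using t(4) ip'(6,7) jq'(6,7) ip(3) jq(3) by simp
        with nz show False by blast
      qed
      then have "iso_arr C t" using schur[OF ip(2) jq(2), of t] t by simp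
      with t show ?thesis by blast
    qed
    show ?thesis
    proof (cases "q \<cdot> i = Zero C (Dom C i) (Cod C q)")
      case True
      then obtain t where t: "iso_arr C t" "Dom C t = Cod C p" "Cod C t = Cod C q" "t \<cdot> p = q"
        using fac by blast
      have "t \<cdot> (p \<cdot> j) = Zero C (Dom C j) (Cod C q)"
        using reassoc[OF t(4), of j] t(1-3) ip' jq' ip jq by simp
      then have pj: "p \<cdot> j = Zero C (Dom C j) (Cod C p)"
        using mono_zero[OF iso_mono[OF t(1)], of "p \<cdot> j"] t(1-3) ip' jq' ip jq by simp
      \<comment> \<open>\<open>p\<close> and \<open>q\<close> have the same kernel, so the two
        maximal subobjects coincide.\<close>
      have "is_kernel C j p"
      proof (rule kernelI[OF jq'(1)])
        fix h assume h: "h \<in> Arr C" "Cod C h = Dom C p" "p \<cdot> h = Zero C (Dom C h) (Cod C p)"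
        have "q \<cdot> h = t \<cdot> (p \<cdot> h)" using reassoc[OF t(4), of h] h(1,2) t(1-3) ip' by simp
        also have "\<dots> = Zero C (Dom C h) (Cod C q)" using h t(1-3) ip' by simp
        finally show "\<exists>u. u \<in> Arr C \<and> Dom C u = Dom C h \<and> Cod C u = Dom C j \<and> j \<cdot> u = h"
          using kernel_factor[OF jq'(3), of h] h ip' jq' ip jq by metis
      qed (use pj ip' jq' ip jq in simp_all)
      from kernel_unique[OF ip'(3) this]
      have "isomorphic C (Dom C j) (Dom C i)" using isomorphicI by metis
      then have "a = b" using IH composition_factors_iso jq by blast
      moreover have "isomorphic C (Cod C p) (Cod C q)" using isomorphicI[OF t(1)] t by simp
      ultimately show ?thesis using ip jq iso_class_eq_iff simple_Obj by metis
    next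
      case False
      let ?g = "q \<cdot> i"
      have g: "?g \<in> Arr C" "Dom C ?g = Dom C i" "Cod C ?g = Cod C q"
        using ip' jq' ip jq by simp_all
      have ge: "epi_arr C ?g" using to_simple_epi[OF jq(2) g(1)] g False by simp
      have pj: "p \<cdot> j \<noteq> Zero C (Dom C j) (Cod C p)"
      proof
        assume "p \<cdot> j = Zero C (Dom C j) (Cod C p)"
        then obtain t where t: "t \<in> Arr C" "Cod C t = Cod C p" "Dom C t = Cod C q" "t \<cdot> q = p"
          using cokernel_factor[OF jq'(4), of p] ip jq ip' jq' by auto
        have "t \<noteq> Zero C (Cod C q) (Cod C p)"
        proof
          assume "t = Zero C (Cod C q) (Cod C p)"
          then have "p = Zero C (Dom C p) (Cod C p)" using t(4) ip'(6,7) jq'(6,7) ip(3) jq(3) by simp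
          with nz show False by blast
        qed
        then have "mono_arr C t" using schur[OF jq(2) ip(2), of t] t iso_mono by simp
        moreover have "t \<cdot> ?g = Zero C (Dom C i) (Cod C p)"
          using reassoc[OF t(4), of i] t(1-3) ip' jq' ip jq by simp
        ultimately show False using mono_zero[of t ?g] g t False by simp
      qed
      \<comment> \<open>\<open>k\<close> includes the intersection of the two maximal subobjects
        into \<open>Dom C i\<close>; \<open>l\<close> below includes it into
        \<open>Dom C j\<close>.\<close>
      obtain k where k: "is_kernel C k ?g" using ex_kernel g by blast
      note kk = kernelD[OF k] and km = kernel_mono[OF k]
      have se: "short_exact C k ?g" using short_exact_epi ge k by blast
      obtain d where d: "composition_factors C (Dom C k) d" using ex_composition_factors kk by fastforce
      have a: "a = add_mset (iso_class C (Cod C q)) d"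
        using composition_factors.step[OF se _ d] jq(2) g kk IH by simp
      have qik: "q \<cdot> (i \<cdot> k) = Zero C (Dom C k) (Cod C q)"
        using kk ip' jq' g ip jq by simp
      obtain l where l: "l \<in> Arr C" "Dom C l = Dom C k" "Cod C l = Dom C j" "j \<cdot> l = i \<cdot> k"
        using kernel_factor[OF jq'(3), of "i \<cdot> k"] qik kk g ip' jq' ip jq by auto
      have ikm: "mono_arr C (i \<cdot> k)" using mono_comp[OF km ip'(1)] kk g by simp
      have lm: "mono_arr C l" using mono_of_comp[of j l] l ikm jq' by simp
      let ?h = "p \<cdot> j"
      have h: "?h \<in> Arr C" "Dom C ?h = Dom C j" "Cod C ?h = Cod C p"
        using ip' jq' ip jq by simp_all
      have "is_kernel C l ?h"
      proof (rule kernelI[OF lm h(1)])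
        show "Cod C l = Dom C ?h" using h l by simp
        have "?h \<cdot> l = p \<cdot> (i \<cdot> k)" using l ip' jq' ip jq by simp
        also have "\<dots> = Zero C (Dom C l) (Cod C ?h)"
          using l(2) h ip' kk(1,3) g by (simp add: reassoc[OF ip'(8)])
        finally show "?h \<cdot> l = Zero C (Dom C l) (Cod C ?h)" .
        fix x assume x: "x \<in> Arr C" "Cod C x = Dom C ?h" "?h \<cdot> x = Zero C (Dom C x) (Cod C ?h)"
        then obtain y where y: "y \<in> Arr C" "Dom C y = Dom C x" "Cod C y = Dom C i" "i \<cdot> y = j \<cdot> x"
          using kernel_factor[OF ip'(3), of "j \<cdot> x"] h ip' jq' ip jq by auto
        have "?g \<cdot> y = q \<cdot> (j \<cdot> x)" using y ip' jq' ip jq by simp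
        also have "\<dots> = Zero C (Dom C y) (Cod C ?g)"
          using x(1,2) h(2) g(3) y(2) ip' jq' ip jq by (simp add: reassoc[OF jq'(8)])
        finally obtain z where z: "z \<in> Arr C" "Dom C z = Dom C y" "Cod C z = Dom C k" "k \<cdot> z = y"
          using kernel_factor[OF k, of y] y g by auto
        have "j \<cdot> (l \<cdot> z) = i \<cdot> (k \<cdot> z)"
          using reassoc[OF l(4), of z] l(1-3) z(1-3) ip' jq' kk g by simp
        then have "l \<cdot> z = x"
          using mono_cancel[OF jq'(1), of "l \<cdot> z" x] l(1-3) z y x h by simp
        with z y l show "\<exists>u. u \<in> Arr C \<and> Dom C u = Dom C x \<and> Cod C u = Dom C l \<and> l \<cdot> u = x"
          by auto
      qed
      moreover have "epi_arr C ?h" using to_simple_epi[OF ip(2) h(1)] h pj by simp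
      ultimately have "short_exact C l ?h" using short_exact_epi by blast
      from composition_factors.step[OF this, of d]
      have "composition_factors C (Dom C j) (add_mset (iso_class C (Cod C p)) d)"
        using ip(2) h l d by simp
      \<comment> \<open>The induction hypothesis is applied to the series through the intersection:
        its length is that of \<open>a\<close>, while the length of \<open>b\<close> is not known in
        advance.\<close>
      then have "add_mset (iso_class C (Cod C p)) d = b"
        using less.hyps[of "add_mset (iso_class C (Cod C p)) d" "Dom C j" b] jq(4) ip(5) a by simp
      then show ?thesis using ip jq a by (simp add: add_mset_commute)
    qed
  qed
qed

end

text \<open>Induction on a series of \<open>Q\<close>: its maximal subobject \<open>Dom C j\<close>
  has the preimage Ker (t p) in the middle term, and this preimage is an extension of
  \<open>Dom C j\<close> by \<open>Dom C i\<close>.\<close>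

lemma (in abelian_category) composition_factors_short_exact:
  assumes "composition_factors C Q b" "short_exact C i p" "Cod C p = Q" "composition_factors C (Dom C i) a"
  shows "composition_factors C (Cod C i) (a + b)"
  using assms
proof (induction arbitrary: i p rule: composition_factors.induct)
  case (zero Z)
  note ip = short_exactD[OF zero(2)]
  have "epi_arr C i" using cokernel_zero_obj_epi[OF ip(4)] zero by simp
  then have "iso_arr C i" using ip mono_epi_iso by blast
  then show ?case using composition_factors_iso[OF zero(4)] isomorphicI by simp
next
  case (step j t b)
  note ip = short_exactD[OF step.prems(1)] and jt = short_exactD[OF step.hyps(1)]
  have cp: "Cod C p = Cod C j" using step by simp
  have tp: "epi_arr C (t \<cdot> p)" using epi_comp jt ip cp by simp
  obtain k where k: "is_kernel C k (t \<cdot> p)" using ex_kernel tp epi_Arr by blast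
  have kk: "k \<in> Arr C" "Cod C k = Cod C i" "t \<cdot> (p \<cdot> k) = Zero C (Dom C k) (Cod C t)"
    using kernelD[OF k] ip jt cp by simp_all
  note km = kernel_mono[OF k]
  have "t \<cdot> p \<cdot> i = Zero C (Dom C i) (Cod C t)" using ip jt cp by simp
  then obtain i' where i': "i' \<in> Arr C" "Dom C i' = Dom C i" "Cod C i' = Dom C k" "k \<cdot> i' = i"
    using kernel_factor[OF k, of i] ip jt cp by auto
  obtain e where e: "e \<in> Arr C" "Dom C e = Dom C k" "Cod C e = Dom C j" "j \<cdot> e = p \<cdot> k"
    using kernel_factor[OF jt(3), of "p \<cdot> k"] kk ip jt cp by auto
  have ee: "epi_arr C e" by (rule pullback_epi[OF ip(2) jt(2,3) k _ e]) (use jt cp in simp)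
  have im: "mono_arr C i'" by (rule mono_of_comp[of k i']) (use i' kk ip in simp_all)
  have "is_kernel C i' e"
  proof (rule kernelI[OF im e(1)])
    show "Cod C i' = Dom C e" using i' e by simp
    have "j \<cdot> (e \<cdot> i') = p \<cdot> (k \<cdot> i')"
      using reassoc[OF e(4), of i'] e(1-3) i'(1-3) kk jt ip cp by simp
    then have "j \<cdot> (e \<cdot> i') = Zero C (Dom C i) (Cod C j)" using i'(4) ip cp by simp
    then show "e \<cdot> i' = Zero C (Dom C i') (Cod C e)"
      using mono_zero[OF jt(1), of "e \<cdot> i'"] e(1-3) i'(1-3) by simp
    fix h assume h: "h \<in> Arr C" "Cod C h = Dom C e" "e \<cdot> h = Zero C (Dom C h) (Cod C e)"
    have "p \<cdot> (k \<cdot> h) = j \<cdot> (e \<cdot> h)"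
      using reassoc[OF e(4), of h] e(1-3) h(1,2) kk jt ip cp by simp
    then have "p \<cdot> (k \<cdot> h) = Zero C (Dom C h) (Cod C p)" using h e jt cp by simp
    then obtain u where u: "u \<in> Arr C" "Dom C u = Dom C h" "Cod C u = Dom C i" "i \<cdot> u = k \<cdot> h"
      using kernel_factor[OF ip(3), of "k \<cdot> h"] h e kk ip by auto
    have "k \<cdot> (i' \<cdot> u) = k \<cdot> h" using reassoc[OF i'(4), of u] u i'(1-3) kk by simp
    then have "i' \<cdot> u = h"
      using mono_cancel[OF km, of "i' \<cdot> u" h] u i'(1-3) h e by simp
    with u i' show "\<exists>u. u \<in> Arr C \<and> Dom C u = Dom C h \<and> Cod C u = Dom C i' \<and> i' \<cdot> u = h"
      by auto
  qed
  then have "short_exact C i' e" using short_exact_epi ee by blast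
  then have "composition_factors C (Dom C k) (a + b)" using step.IH[of i' e] step.prems i' e by simp
  moreover have "short_exact C k (t \<cdot> p)" using short_exact_epi tp k by blast
  moreover have "Cod C (t \<cdot> p) = Cod C t" using jt ip cp by simp
  ultimately have "composition_factors C (Cod C k) (add_mset (iso_class C (Cod C t)) (a + b))"
    using composition_factors.step[of C k "t \<cdot> p"] step.hyps(2) by simp
  then show ?case using kk by simp
qed

section \<open>Multiplicities, the Grothendieck group and finiteness\<close>

lemma finite_submultisets: "finite {A. A \<subseteq># B}"
proof (induction B)
  case (add x B)
  have "{A. A \<subseteq># add_mset x B} \<subseteq> {A. A \<subseteq># B} \<union> add_mset x ` {A. A \<subseteq># B}"
  proof
    fix A assume A: "A \<in> {A. A \<subseteq># add_mset x B}"
    show "A \<in> {A. A \<subseteq># B} \<union> add_mset x ` {A. A \<subseteq># B}"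
    proof (cases "x \<in># A")
      case True
      then obtain A' where A': "A = add_mset x A'" by (meson mset_add)
      with A show ?thesis by simp
    next
      case False
      then have "count A a \<le> count B a" for a
        using A by (cases "a = x") (auto simp: subseteq_mset_def not_in_iff split: if_splits)
      then show ?thesis by (simp add: subseteq_mset_def)
    qed
  qed
  then show ?case using add finite_subset by blast
qed simp

section \<open>Subobjects as classes of monomorphisms\<close>

context category
begin

lemma sub_relE:
  assumes "(u, v) \<in> sub_rel C"
  obtains w where "mono_arr C u" "mono_arr C v" "iso_arr C w" "Dom C w = Dom C u" "Cod C w = Dom C v"
    "v \<cdot> w = u" "Cod C u = Cod C v"
proof -
  have uv: "mono_arr C u" "mono_arr C v" and "\<exists>w\<in>Hom C (Dom C u) (Dom C v). iso_arr C w \<and> v \<cdot> w = u"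
    using assms unfolding sub_rel_def by blast+
  then obtain w where w: "w \<in> Hom C (Dom C u) (Dom C v)" "iso_arr C w" "v \<cdot> w = u" by blast
  have "Cod C (v \<cdot> w) = Cod C v" by (rule Comp_simps(3)) (use w(1,2) uv in simp_all)
  then show thesis using that[OF uv w(2)] w by simp
qed

lemma sub_relI_iso:
  assumes "mono_arr C u" "mono_arr C v" "iso_arr C w" "Dom C w = Dom C u" "Cod C w = Dom C v" "v \<cdot> w = u"
  shows "(u, v) \<in> sub_rel C"
proof -
  have "w \<in> Hom C (Dom C u) (Dom C v)" using assms(3-5) by simp
  with assms show ?thesis unfolding sub_rel_def by blast
qed

text \<open>Two monomorphisms that factor through each other define the same subobject, since
  cancellation makes the factors mutually inverse.\<close>

lemma sub_relI:
  assumes "mono_arr C u" "mono_arr C v"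
    and a: "a \<in> Arr C" "Dom C a = Dom C u" "Cod C a = Dom C v" "v \<cdot> a = u"
    and b: "b \<in> Arr C" "Dom C b = Dom C v" "Cod C b = Dom C u" "u \<cdot> b = v"
  shows "(u, v) \<in> sub_rel C"
proof -
  have "a \<cdot> b = Id C (Dom C v)"
    by (rule mono_cancel[OF assms(2)]) (use assms in \<open>simp_all add: reassoc[OF a(4)]\<close>)
  moreover have "b \<cdot> a = Id C (Dom C u)"
    by (rule mono_cancel[OF assms(1)]) (use assms in \<open>simp_all add: reassoc[OF b(4)]\<close>)
  ultimately have "iso_arr C a" by (intro isoI[of a b]) (use a b in simp_all)
  then show ?thesis using assms by (auto simp: sub_rel_def)
qed

lemma equiv_sub_rel: "equiv {u. mono_arr C u} (sub_rel C)"
proof (rule equivI)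
  show "sub_rel C \<subseteq> {u. mono_arr C u} \<times> {u. mono_arr C u}" by (auto simp: sub_rel_def)
  show "refl_on {u. mono_arr C u} (sub_rel C)"
  proof (rule refl_onI)
    fix u assume "u \<in> {u. mono_arr C u}"
    then show "(u, u) \<in> sub_rel C" by (intro sub_relI[of u u "Id C (Dom C u)" "Id C (Dom C u)"]) simp_all
  qed
  show "sym (sub_rel C)"
  proof (rule symI)
    fix u v assume "(u, v) \<in> sub_rel C"
    then obtain w where w: "mono_arr C u" "mono_arr C v" "iso_arr C w" "Dom C w = Dom C u" "Cod C w = Dom C v"
      "v \<cdot> w = u" "Cod C u = Cod C v" by (rule sub_relE)
    obtain w' where w': "w \<in> Arr C" "w' \<in> Arr C" "Dom C w' = Cod C w" "Cod C w' = Dom C w"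
      "w' \<cdot> w = Id C (Dom C w)" "w \<cdot> w' = Id C (Cod C w)" using isoE[OF w(3)] .
    have "v \<cdot> (w \<cdot> w') = u \<cdot> w'" by (rule reassoc[OF w(6)]) (use w(2,5) w'(1-4) in simp_all)
    then have "u \<cdot> w' = v" using w(2,5) w'(6) by simp
    then show "(v, u) \<in> sub_rel C" by (intro sub_relI[of v u w' w]) (use w w' in simp_all)
  qed
  show "trans (sub_rel C)"
  proof (rule transI)
    fix u v x assume "(u, v) \<in> sub_rel C" "(v, x) \<in> sub_rel C"
    then obtain a b where a: "mono_arr C u" "mono_arr C v" "iso_arr C a" "Dom C a = Dom C u" "Cod C a = Dom C v"
      "v \<cdot> a = u" and b: "mono_arr C x" "iso_arr C b" "Dom C b = Dom C v" "Cod C b = Dom C x" "x \<cdot> b = v"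
      by (metis sub_relE)
    have "x \<cdot> (b \<cdot> a) = u" using reassoc[OF b(5), of a] a b by simp
    moreover have "iso_arr C (b \<cdot> a)" using iso_comp[OF a(3) b(2)] a b by simp
    ultimately show "(u, x) \<in> sub_rel C"
      by (intro sub_relI_iso[of u x "b \<cdot> a"]) (use a(1,3,4,5) b(1-4) in simp_all)
  qed
qed

lemma sub_rel_class_eq_iff:
  "\<lbrakk>mono_arr C u; mono_arr C v\<rbrakk> \<Longrightarrow> sub_rel C `` {u} = sub_rel C `` {v} \<longleftrightarrow> (u, v) \<in> sub_rel C"
  using eq_equiv_class_iff[OF equiv_sub_rel] by simp

end

text \<open>Turns composition factors into an element of a free abelian group, the target of an
  additive map out of the Grothendieck group.\<close>

definition frag_of_mset :: "'a multiset \<Rightarrow> 'a \<Rightarrow>\<^sub>0 int" where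
  "frag_of_mset ms = (\<Sum>s\<in>#ms. frag_of s)"

lemma frag_of_mset_add: "frag_of_mset (a + b) = frag_of_mset a + frag_of_mset b"
  by (simp add: frag_of_mset_def)

lemma lookup_frag_of_mset: "Poly_Mapping.lookup (frag_of_mset ms) s = int (count ms s)"
  by (induction ms) (simp_all add: frag_of_mset_def lookup_add)

lemma frag_of_mset_inject: "frag_of_mset a = frag_of_mset b \<Longrightarrow> a = b"
  by (rule multiset_eqI) (metis lookup_frag_of_mset of_nat_eq_iff)

section \<open>Composition factors and multiplicities\<close>

context finite_length_category
begin

definition factors :: "'a \<Rightarrow> 'a set multiset" where
  "factors M = (THE ms. composition_factors C M ms)"

lemma factors_eq: "composition_factors C M ms \<Longrightarrow> factors M = ms"
  unfolding factors_def using composition_factors_unique by blast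

lemma composition_factors_factors: "M \<in> Obj C \<Longrightarrow> composition_factors C M (factors M)"
  using ex_composition_factors factors_eq by blast

lemma factors_iso: "isomorphic C X Y \<Longrightarrow> factors X = factors Y"
  using composition_factors_iso composition_factors_factors isomorphic_Obj factors_eq by metis

lemma factors_rep: "X \<in> Obj C \<Longrightarrow> factors (rep (iso_class C X)) = factors X"
  using factors_iso isomorphic_rep by blast

lemma factors_zero_iff: "M \<in> Obj C \<Longrightarrow> factors M = {#} \<longleftrightarrow> zero_obj C M"
  using composition_factors_zero_iff composition_factors_factors by blast

lemma factors_short_exact:
  assumes "short_exact C i p" shows "factors (Cod C i) = factors (Dom C i) + factors (Cod C p)"
  using composition_factors_short_exact[OF composition_factors_factors assms refl composition_factors_factors]
    short_exactD[OF assms] factors_eq by simp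

lemma factors_simple: assumes "simple_obj C S" shows "factors S = {#iso_class C S#}"
proof -
  have S: "S \<in> Obj C" using assms simple_Obj by blast
  obtain Z where Z: "zero_obj C Z" using ex_zero_obj by blast
  note Zo = zero_obj_Obj[OF Z]
  \<comment> \<open>The series of length one is 0 \<rightarrow> Z \<rightarrow> S \<rightarrow> S
    \<rightarrow> 0 with the zero object \<open>Z\<close>.\<close>
  have "is_kernel C (Zero C Z S) (Id C S)"
  proof (rule kernelI)
    show "mono_arr C (Zero C Z S)"
      by (rule monoI) (use Z Zo S to_zero_obj in auto)
    fix h assume "h \<in> Arr C" "Cod C h = Dom C (Id C S)" "Id C S \<cdot> h = Zero C (Dom C h) (Cod C (Id C S))"
    then show "\<exists>u. u \<in> Arr C \<and> Dom C u = Dom C h \<and> Cod C u = Dom C (Zero C Z S) \<and> Zero C Z S \<cdot> u = h"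
      using S Zo by (intro exI[of _ "Zero C (Dom C h) Z"]) auto
  qed (use S Zo in simp_all)
  then have "short_exact C (Zero C Z S) (Id C S)"
    using short_exact_epi iso_epi S iso_Id by blast
  from composition_factors.step[OF this]
  have "composition_factors C S {#iso_class C S#}"
    using assms S Zo composition_factors.zero[OF Z] by fastforce
  then show ?thesis by (rule factors_eq)
qed

lemma ex_simple_quotient:
  assumes "M \<in> Obj C" "\<not> zero_obj C M"
  shows "\<exists>i p. short_exact C i p \<and> Cod C i = M \<and> simple_obj C (Cod C p)"
  using composition_factors_factors[OF assms(1)] by cases (use assms(2) in auto)

text \<open>The bottom step of a composition series; if the maximal subobject is zero, the object is
  itself simple.\<close>

lemma ex_simple_subobject:
  assumes "M \<in> Obj C" "\<not> zero_obj C M"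
  shows "\<exists>s. mono_arr C s \<and> simple_obj C (Dom C s) \<and> Cod C s = M"
  using composition_factors_factors[OF assms(1)] assms(2)
proof (induction rule: composition_factors.induct)
  case (step i p ms)
  note ip = short_exactD[OF step(1)]
  show ?case
  proof (cases "zero_obj C (Dom C i)")
    case True
    then have "mono_arr C p" using kernel_zero_obj_mono ip by blast
    then have "isomorphic C (Cod C p) (Cod C i)"
      using mono_epi_iso ip isomorphicI isomorphic_sym by metis
    then have "simple_obj C (Cod C i)" using simple_iso step by blast
    then show ?thesis using ip by (intro exI[of _ "Id C (Cod C i)"]) (simp add: iso_mono)
  next
    case False
    then obtain s where "mono_arr C s" "simple_obj C (Dom C s)" "Cod C s = Dom C i"
      using step by blast
    then show ?thesis using ip mono_comp[of s i] by (intro exI[of _ "i \<cdot> s"]) simp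
  qed
qed simp

lemma ex_composition_series:
  assumes "M \<in> Obj C" obtains n X i p where "composition_series C M n X i p"
  using fin_length assms unfolding finite_length_def by blast

text \<open>The definite description in \<open>JH_mult\<close> is legitimate because all composition
  series have the same multiset of factors.\<close>

lemma JH_mult_eq:
  assumes "M \<in> Obj C" "S \<in> Obj C"
  shows "JH_mult C M S = count (factors M) (iso_class C S)"
proof -
  have *: "count (factors M) (iso_class C S) = card {k. k < n \<and> isomorphic C (Cod C (p k)) S}"
    if cs: "composition_series C M n X i p" for n X i p
  proof -
    have "Cod C (p k) \<in> Obj C" if "k < n" for k
      using cs that simple_Obj by (auto simp: composition_series_def)
    then have "{k. k < n \<and> isomorphic C (Cod C (p k)) S} =
        {..<n} \<inter> {k. iso_class C (Cod C (p k)) = iso_class C S}"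
      using iso_class_eq_iff assms by auto
    moreover have "factors M = image_mset (\<lambda>k. iso_class C (Cod C (p k))) (mset_set {..<n})"
      using composition_series_factors[OF cs] by (rule factors_eq)
    ultimately show ?thesis
      by (simp add: count_image_mset vimage_def Int_commute)
  qed
  show ?thesis unfolding JH_mult_def
    by (rule the_equality) (use * ex_composition_series[OF assms(1)] in metis)+
qed

lemma Obj_of_rep: "m \<in> Iso C \<Longrightarrow> rep m \<in> Obj C"
  using rep_props by blast

section \<open>The Grothendieck group\<close>

lemma K0_relations_carrier: "K0_relations C \<subseteq> carrier (free_Abelian_group (Iso C))"
proof
  fix x assume "x \<in> K0_relations C"
  then obtain i p where ip: "short_exact C i p" and
    x: "x = frag_of (iso_class C (Cod C i)) - frag_of (iso_class C (Dom C i)) - frag_of (iso_class C (Cod C p))"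
    by (auto simp: K0_relations_def)
  have "Poly_Mapping.keys x \<subseteq> {iso_class C (Cod C i), iso_class C (Dom C i), iso_class C (Cod C p)}"
    unfolding x
    using keys_diff[of "frag_of (iso_class C (Cod C i)) - frag_of (iso_class C (Dom C i))" "frag_of (iso_class C (Cod C p))"]
      keys_diff[of "frag_of (iso_class C (Cod C i))" "frag_of (iso_class C (Dom C i))"]
    by (auto simp: keys_frag_of)
  then show "x \<in> carrier (free_Abelian_group (Iso C))"
    using short_exactD[OF ip] by (auto simp: iso_class_in_Iso)
qed

lemma K0_normal: "K0_relation_subgroup C \<lhd> free_Abelian_group (Iso C)"
proof -
  interpret comm_group "free_Abelian_group (Iso C)" by (rule abelian_free_Abelian_group)
  show ?thesis unfolding K0_relation_subgroup_def
    by (rule subgroup_imp_normal[OF generate_is_subgroup[OF K0_relations_carrier]])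
qed

lemma K0_class_carrier: "m \<in> Iso C \<Longrightarrow> K0_class C m \<in> carrier (K0 C)"
proof -
  interpret normal "K0_relation_subgroup C" "free_Abelian_group (Iso C)" by (rule K0_normal)
  show "m \<in> Iso C \<Longrightarrow> K0_class C m \<in> carrier (K0 C)"
    unfolding K0_class_def K0_def FactGroup_def using rcosetsI[OF subset] by simp
qed

lemma K0_class_short_exact:
  assumes "short_exact C i p"
  shows "K0_class C (iso_class C (Cod C p)) \<otimes>\<^bsub>K0 C\<^esub> K0_class C (iso_class C (Dom C i)) =
    K0_class C (iso_class C (Cod C i))"
proof -
  let ?G = "free_Abelian_group (Iso C)" and ?H = "K0_relation_subgroup C"
  interpret normal ?H ?G by (rule K0_normal)
  let ?k = "frag_of (iso_class C (Cod C i))" and ?m = "frag_of (iso_class C (Cod C p))"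
    and ?n = "frag_of (iso_class C (Dom C i))"
  note ip = short_exactD[OF assms]
  have c: "?k \<in> carrier ?G" "?m \<in> carrier ?G" "?n \<in> carrier ?G"
    using ip by (simp_all add: keys_frag_of)
  have "?k - ?n - ?m \<in> ?H"
    unfolding K0_relation_subgroup_def K0_relations_def by (rule generate.incl) (use assms in auto)
  moreover have "?k = (?k - ?n - ?m) \<otimes>\<^bsub>?G\<^esub> (?m + ?n)" by simp
  ultimately have "?k \<in> ?H #>\<^bsub>?G\<^esub> (?m + ?n)" unfolding r_coset_def by blast
  moreover have "?m + ?n \<in> carrier ?G" using m_closed[OF c(2,3)] by simp
  ultimately have "?H #>\<^bsub>?G\<^esub> (?m + ?n) = ?H #>\<^bsub>?G\<^esub> ?k"
    using repr_independence is_subgroup by blast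
  moreover have "(?H #>\<^bsub>?G\<^esub> ?m) <#>\<^bsub>?G\<^esub> (?H #>\<^bsub>?G\<^esub> ?n) = ?H #>\<^bsub>?G\<^esub> (?m + ?n)"
    using rcos_sum[OF c(2,3)] by simp
  ultimately show ?thesis by (simp add: K0_class_def K0_def FactGroup_def)
qed

text \<open>Sending a class to the formal sum of its composition factors is additive on short exact
  sequences, so the extension to the free abelian group kills the relation subgroup. It therefore
  depends on the coset only, and a multiset can be read off its formal sum.\<close>

lemma K0_class_factors:
  assumes "m \<in> Iso C" "m' \<in> Iso C" "K0_class C m = K0_class C m'"
  shows "factors (rep m) = factors (rep m')"
proof -
  let ?G = "free_Abelian_group (Iso C)" and ?H = "K0_relation_subgroup C"
  interpret normal ?H ?G by (rule K0_normal)
  let ?f = "frag_extend (\<lambda>m. frag_of_mset (factors (rep m)))"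
  have kill: "?f x = 0" if "x \<in> generate ?G (K0_relations C)" for x
    using that
  proof (induction rule: generate.induct)
    case one
    then show ?case by simp
  next
    case (incl h)
    then obtain i p where ip: "short_exact C i p" and
      h: "h = frag_of (iso_class C (Cod C i)) - frag_of (iso_class C (Dom C i)) - frag_of (iso_class C (Cod C p))"
      by (auto simp: K0_relations_def)
    show ?case unfolding h using short_exactD[OF ip] factors_short_exact[OF ip]
      by (simp add: frag_extend_diff factors_rep frag_of_mset_add)
  next
    case (inv h)
    then have "h \<in> carrier ?G" using K0_relations_carrier by blast
    then have e: "inv\<^bsub>?G\<^esub> h = - h" by simp
    from inv obtain i p where ip: "short_exact C i p" and
      h: "h = frag_of (iso_class C (Cod C i)) - frag_of (iso_class C (Dom C i)) - frag_of (iso_class C (Cod C p))"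
      by (auto simp: K0_relations_def)
    have "?f h = 0" unfolding h using short_exactD[OF ip] factors_short_exact[OF ip]
      by (simp add: frag_extend_diff factors_rep frag_of_mset_add)
    then show ?case unfolding e by (simp add: frag_extend_minus)
  next
    case (eng h1 h2)
    then show ?case by (simp add: frag_extend_add)
  qed
  have "frag_of m \<in> ?H #>\<^bsub>?G\<^esub> frag_of m"
    using rcos_self[OF _ is_subgroup] assms by simp
  then have "frag_of m \<in> ?H #>\<^bsub>?G\<^esub> frag_of m'"
    using assms(3) by (simp add: K0_class_def)
  then obtain h where h: "h \<in> ?H" "frag_of m = h + frag_of m'" by (auto simp: r_coset_def)
  then have "?f (frag_of m) = ?f h + ?f (frag_of m')" by (simp add: frag_extend_add)
  also have "?f h = 0" using kill h by (simp add: K0_relation_subgroup_def)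
  finally show ?thesis using frag_of_mset_inject by simp
qed

end

section \<open>Finiteness of isomorphism classes and subobjects\<close>

locale finitary_category = finite_length_category +
  assumes fin: "finitary C"
begin

lemma finite_Hom: "X \<in> Obj C \<Longrightarrow> Y \<in> Obj C \<Longrightarrow> finite (Hom C X Y)"
  using fin by (simp add: finitary_def)

text \<open>Equivalent extensions have isomorphic middle terms, so the classes of middle terms are
  indexed by the finite set \<open>Ext1 C M N\<close>.\<close>

lemma finite_extension_classes:
  assumes "M \<in> Obj C" "N \<in> Obj C"
  shows "finite ((\<lambda>(i, p). iso_class C (Cod C i)) ` extensions C M N)"
proof -
  let ?g = "\<lambda>c. iso_class C (Cod C (fst (SOME e. e \<in> c)))"
  have "(\<lambda>(i, p). iso_class C (Cod C i)) ` extensions C M N \<subseteq> ?g ` Ext1 C M N"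
  proof
    fix x assume "x \<in> (\<lambda>(i, p). iso_class C (Cod C i)) ` extensions C M N"
    then obtain i p where e: "(i, p) \<in> extensions C M N" and x: "x = iso_class C (Cod C i)" by auto
    have i: "short_exact C i p" using e by (simp add: extensions_def)
    let ?c = "ext_rel C M N `` {(i, p)}"
    have "(i, p) \<in> ?c"
      using e short_exactD[OF i] by (auto simp: ext_rel_def intro!: bexI[of _ "Id C (Cod C i)"])
    then have "(SOME e. e \<in> ?c) \<in> ?c" by (rule someI)
    moreover obtain i' p' where s: "(SOME e. e \<in> ?c) = (i', p')" by (cases "SOME e. e \<in> ?c")
    ultimately obtain f where f: "iso_arr C f" "Dom C f = Cod C i" "Cod C f = Cod C i'"
      "(i', p') \<in> extensions C M N"
      by (auto simp: ext_rel_def)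
    have "isomorphic C (Cod C i) (Cod C i')" using isomorphicI[OF f(1)] f by simp
    then have "x = ?g ?c" unfolding x s
      using iso_class_eq_iff isomorphic_Obj by (metis fst_conv)
    moreover have "?c \<in> Ext1 C M N" unfolding Ext1_def using e by (rule quotientI)
    ultimately show "x \<in> ?g ` Ext1 C M N" by blast
  qed
  moreover have "finite (Ext1 C M N)" using fin assms by (simp add: finitary_def)
  ultimately show ?thesis by (meson finite_imageI finite_subset)
qed

text \<open>A nonzero object is an extension of one of its simple factors \<open>t\<close> by an
  object with factors \<open>ms - {#t#}\<close>. By induction there are finitely many choices for
  the ends, and finitely many middle terms for each.\<close>

lemma finite_iso_classes_factors: "finite {m \<in> Iso C. factors (rep m) = ms}"
proof (induction "size ms" arbitrary: ms rule: less_induct)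
  case less
  let ?F = "\<lambda>ms. {m \<in> Iso C. factors (rep m) = ms}"
  let ?E = "\<lambda>t x. (\<lambda>(i, p). iso_class C (Cod C i)) ` extensions C (rep t) (rep x)"
  show ?case
  proof (cases "ms = {#}")
    case True
    have "m = iso_class C Z" if "m \<in> ?F ms" "zero_obj C Z" for m Z
    proof -
      have "zero_obj C (rep m)" using that True factors_zero_iff Obj_of_rep by auto
      then have "isomorphic C (rep m) Z" using that zero_obj_isomorphic by blast
      then show ?thesis using rep_props[of m] that iso_class_eq_iff isomorphic_Obj by fastforce
    qed
    then have "?F ms \<subseteq> {iso_class C (SOME Z. zero_obj C Z)}"
      using ex_zero_obj someI_ex[of "zero_obj C"] by blast
    then show ?thesis using finite_subset by blast
  next
    case False
    have "?F ms \<subseteq> (\<Union>t\<in>set_mset ms \<inter> Iso C. \<Union>x\<in>?F (ms - {#t#}). ?E t x)"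
    proof
      fix m assume m: "m \<in> ?F ms"
      then have mo: "rep m \<in> Obj C" using Obj_of_rep by simp
      with m False have "\<not> zero_obj C (rep m)" using factors_zero_iff by auto
      then obtain i p where ip: "short_exact C i p" "Cod C i = rep m" "simple_obj C (Cod C p)"
        using ex_simple_quotient mo by blast
      note ip' = short_exactD[OF ip(1)]
      let ?t = "iso_class C (Cod C p)" and ?x = "iso_class C (Dom C i)"
      have f: "ms = add_mset ?t (factors (Dom C i))"
        using factors_short_exact[OF ip(1)] ip m factors_simple by simp
      have t: "?t \<in> set_mset ms \<inter> Iso C" using f ip' by simp
      have x: "?x \<in> ?F (ms - {#?t#})" using f ip' by (simp add: factors_rep)
      \<comment> \<open>Both ends are moved to the chosen representatives of their classes, because
        the union ranges over these only.\<close>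
      obtain w where w: "iso_arr C w" "Dom C w = rep ?x" "Cod C w = Dom C i"
        using isomorphic_rep[of "Dom C i"] ip' by (auto simp: isomorphic_def)
      obtain v where v: "iso_arr C v" "Dom C v = Cod C p" "Cod C v = rep ?t"
        using isomorphic_sym[OF isomorphic_rep[of "Cod C p"]] ip' by (auto simp: isomorphic_def)
      have "short_exact C (i \<cdot> w) (v \<cdot> p)"
        by (rule short_exact_iso_right[OF short_exact_iso_left[OF ip(1) w(1,3)] v(1,2)])
      then have "(i \<cdot> w, v \<cdot> p) \<in> extensions C (rep ?t) (rep ?x)"
        using w v ip' by (simp add: extensions_def)
      moreover have "iso_class C (Cod C (i \<cdot> w)) = m"
        using w ip' ip m rep_props by simp
      ultimately have "m \<in> ?E ?t ?x" by force
      with t x show "m \<in> (\<Union>t\<in>set_mset ms \<inter> Iso C. \<Union>x\<in>?F (ms - {#t#}). ?E t x)" by blast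
    qed
    moreover have "finite (?F (ms - {#t#}))" if "t \<in># ms" for t
      by (rule less) (use that in \<open>simp add: size_Diff1_less\<close>)
    moreover have "finite (?E t x)" if "t \<in> Iso C" "x \<in> Iso C" for t x
      using finite_extension_classes Obj_of_rep that by blast
    ultimately show ?thesis by (auto elim!: finite_subset)
  qed
qed

text \<open>This puts every component of a formal sum into the Hall algebra itself.\<close>

lemma finite_iso_classes_K0: "finite {m \<in> Iso C. K0_class C m = \<gamma>}"
proof (cases "\<exists>m\<in>Iso C. K0_class C m = \<gamma>")
  case True
  then obtain m' where m': "m' \<in> Iso C" "K0_class C m' = \<gamma>" by blast
  then have "{m \<in> Iso C. K0_class C m = \<gamma>} \<subseteq> {m \<in> Iso C. factors (rep m) = factors (rep m')}"
    using K0_class_factors by blast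
  then show ?thesis using finite_iso_classes_factors finite_subset by blast
next
  case False
  then have "{m \<in> Iso C. K0_class C m = \<gamma>} = {}" by blast
  then show ?thesis by (metis finite.emptyI)
qed

text \<open>Up to an isomorphism of its source, a subobject is an arrow from the representative of a
  class whose composition factors form a submultiset of those of \<open>K\<close>. Finitely many
  classes and finitely many arrows remain.\<close>

lemma finite_subobjects:
  assumes "K \<in> Obj C" shows "finite (subobjects C K)"
proof -
  let ?F = "\<Union>ms\<in>{ms. ms \<subseteq># factors K}. {m \<in> Iso C. factors (rep m) = ms}"
  let ?P = "\<Union>x\<in>?F. Hom C (rep x) K"
  have "subobjects C K \<subseteq> (\<lambda>u. sub_rel C `` {u}) ` ?P"
  proof
    fix U assume "U \<in> subobjects C K"
    then obtain u where u: "mono_arr C u" "Cod C u = K" "U = sub_rel C `` {u}"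
      by (auto simp: subobjects_def quotient_def)
    let ?x = "iso_class C (Dom C u)"
    obtain c where c: "is_cokernel C c u" using ex_cokernel u mono_Arr by blast
    have "factors (Dom C u) \<subseteq># factors K"
      using factors_short_exact[OF short_exact_mono[OF u(1) c]] u by simp
    then have x: "?x \<in> ?F" using u by (simp add: factors_rep)
    obtain w where w: "iso_arr C w" "Dom C w = rep ?x" "Cod C w = Dom C u"
      using isomorphic_rep[of "Dom C u"] u by (auto simp: isomorphic_def)
    have uw: "mono_arr C (u \<cdot> w)" using mono_comp[OF iso_mono[OF w(1)] u(1)] w by simp
    have "(u \<cdot> w, u) \<in> sub_rel C"
      by (rule sub_relI_iso[of _ _ w]) (use uw u w in simp_all)
    then have "sub_rel C `` {u \<cdot> w} = U"
      using equiv_class_eq[OF equiv_sub_rel] u by blast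
    moreover have "u \<cdot> w \<in> Hom C (rep ?x) K" using u w by simp
    ultimately show "U \<in> (\<lambda>u. sub_rel C `` {u}) ` ?P" using x by blast
  qed
  moreover have "finite ?F" using finite_submultisets finite_iso_classes_factors by blast
  then have "finite ?P"
    by (rule finite_UN_I) (use finite_Hom Obj_of_rep assms in blast)
  ultimately show ?thesis by (meson finite_imageI finite_subset)
qed

end

section \<open>The product in the completed Hall algebra\<close>

lemma mult_hall_algebra: "x \<otimes>\<^bsub>hall_algebra C\<^esub> y = hall_mult C x y"
  by (simp add: hall_algebra_def)

section \<open>Classes of subobjects and quotients, Hall numbers\<close>

context abelian_category
begin

text \<open>A subobject is a class of monomorphisms, so the classes of U and of K/U are read off one
  chosen representative; \<open>class_of_member\<close> shows that any other gives the same
  result.\<close>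

definition sub_class :: "'b set \<Rightarrow> 'a set" where
  "sub_class U = iso_class C (Dom C (SOME u. u \<in> U))"

definition quot_class :: "'b set \<Rightarrow> 'a set" where
  "quot_class U = iso_class C (Cod C (SOME p. is_cokernel C p (SOME u. u \<in> U)))"

lemma subobjectE:
  assumes "U \<in> subobjects C K"
  obtains u p where "mono_arr C u" "Cod C u = K" "U = sub_rel C `` {u}" "u \<in> U" "short_exact C u p"
proof -
  obtain u where u: "mono_arr C u" "Cod C u = K" "U = sub_rel C `` {u}"
    using assms by (auto simp: subobjects_def quotient_def)
  moreover from u have "u \<in> U" using equiv_class_self[OF equiv_sub_rel] by simp
  moreover obtain p where "is_cokernel C p u" using ex_cokernel u mono_Arr by blast
  ultimately show thesis using that short_exact_mono by blast
qed

lemma subobjectI: "mono_arr C u \<Longrightarrow> sub_rel C `` {u} \<in> subobjects C (Cod C u)"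
  unfolding subobjects_def by (rule quotientI) simp

text \<open>The isomorphism between the sources makes a cokernel of \<open>v\<close> a cokernel of
  \<open>u\<close> too, and cokernels are unique.\<close>

lemma sub_rel_isomorphic:
  assumes "(u, v) \<in> sub_rel C" "is_cokernel C p u" "is_cokernel C q v"
  shows "isomorphic C (Dom C u) (Dom C v)" "isomorphic C (Cod C p) (Cod C q)"
proof -
  obtain w where w: "mono_arr C u" "mono_arr C v" "iso_arr C w" "Dom C w = Dom C u" "Cod C w = Dom C v"
    "v \<cdot> w = u" "Cod C u = Cod C v" using assms(1) by (rule sub_relE)
  show "isomorphic C (Dom C u) (Dom C v)" using isomorphicI[OF w(3)] w by simp
  have "short_exact C u q"
    using short_exact_iso_left[OF short_exact_mono[OF w(2) assms(3)] w(3)] w by simp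
  then have "is_cokernel C q u" by (simp add: short_exact_def)
  then show "isomorphic C (Cod C p) (Cod C q)"
    using cokernel_unique[OF assms(2)] isomorphicI by metis
qed

lemma class_of_member:
  assumes "U \<in> subobjects C K" "u \<in> U" "is_cokernel C p u"
  shows "sub_class U = iso_class C (Dom C u)" "quot_class U = iso_class C (Cod C p)"
proof -
  obtain v where v: "U = sub_rel C `` {v}" using subobjectE[OF assms(1)] by metis
  let ?u = "SOME u. u \<in> U"
  let ?p = "SOME p. is_cokernel C p ?u"
  have u: "?u \<in> U" using assms(2) by (rule someI)
  have m: "mono_arr C u" "mono_arr C ?u" and r: "(u, ?u) \<in> sub_rel C"
    using assms(2) u v equiv_sub_rel unfolding equiv_def sym_def trans_def by blast+
  have "\<exists>p. is_cokernel C p ?u" using ex_cokernel m mono_Arr by blast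
  then have p: "is_cokernel C ?p ?u" by (rule someI_ex)
  note i = sub_rel_isomorphic[OF r assms(3) p]
  show "sub_class U = iso_class C (Dom C u)" "quot_class U = iso_class C (Cod C p)"
    unfolding sub_class_def quot_class_def using i iso_class_eq_iff isomorphic_Obj by metis+
qed

lemma class_of_mono:
  assumes "mono_arr C u" shows "sub_class (sub_rel C `` {u}) = iso_class C (Dom C u)"
    "is_cokernel C p u \<Longrightarrow> quot_class (sub_rel C `` {u}) = iso_class C (Cod C p)"
proof -
  have "u \<in> sub_rel C `` {u}" using equiv_class_self[OF equiv_sub_rel] assms by simp
  moreover obtain q where "is_cokernel C q u" using ex_cokernel assms mono_Arr by blast
  ultimately show "sub_class (sub_rel C `` {u}) = iso_class C (Dom C u)"
    "is_cokernel C p u \<Longrightarrow> quot_class (sub_rel C `` {u}) = iso_class C (Cod C p)"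
    using class_of_member[OF subobjectI[OF assms]] by blast+
qed

lemma classes_in_Iso:
  assumes "U \<in> subobjects C K" shows "sub_class U \<in> Iso C" "quot_class U \<in> Iso C"
proof -
  obtain u p where u: "mono_arr C u" "Cod C u = K" "U = sub_rel C `` {u}" "u \<in> U" "short_exact C u p"
    using subobjectE[OF assms] .
  note up = short_exactD[OF u(5)]
  show "sub_class U \<in> Iso C" "quot_class U \<in> Iso C"
    using class_of_member[OF assms u(4) up(4)] up by simp_all
qed

text \<open>Expresses Hall numbers as the fibre sizes of a map on subobjects, the form in which
  products become sums over subobjects.\<close>

lemma hall_number_eq:
  assumes "M \<in> Obj C" "N \<in> Obj C"
  shows "hall_number C M N K =
    card {U \<in> subobjects C K. quot_class U = iso_class C M \<and> sub_class U = iso_class C N}"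
proof -
  have "(\<exists>u\<in>U. isomorphic C (Dom C u) N \<and> (\<exists>p. is_cokernel C p u \<and> isomorphic C (Cod C p) M)) \<longleftrightarrow>
    quot_class U = iso_class C M \<and> sub_class U = iso_class C N" if U: "U \<in> subobjects C K" for U
  proof
    assume "\<exists>u\<in>U. isomorphic C (Dom C u) N \<and> (\<exists>p. is_cokernel C p u \<and> isomorphic C (Cod C p) M)"
    then obtain u p where u: "u \<in> U" "isomorphic C (Dom C u) N" "is_cokernel C p u" "isomorphic C (Cod C p) M"
      by blast
    then show "quot_class U = iso_class C M \<and> sub_class U = iso_class C N"
      using class_of_member[OF U u(1,3)] iso_class_eq_iff isomorphic_Obj by metis
  next
    assume e: "quot_class U = iso_class C M \<and> sub_class U = iso_class C N"
    obtain u p where u: "mono_arr C u" "Cod C u = K" "U = sub_rel C `` {u}" "u \<in> U" "short_exact C u p"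
      using subobjectE[OF U] .
    note up = short_exactD[OF u(5)]
    have "iso_class C (Dom C u) = iso_class C N" "iso_class C (Cod C p) = iso_class C M"
      using class_of_member[OF U u(4) up(4)] e by simp_all
    then have "isomorphic C (Dom C u) N" "isomorphic C (Cod C p) M"
      using iso_class_eq_iff assms up(5,6) by (blast intro: Dom_in_Obj Cod_in_Obj)+
    with u(4) up(4) show "\<exists>u\<in>U. isomorphic C (Dom C u) N \<and> (\<exists>p. is_cokernel C p u \<and> isomorphic C (Cod C p) M)"
      by blast
  qed
  then show ?thesis unfolding hall_number_def by (metis (mono_tags, lifting))
qed

end

section \<open>Convolution over subobjects and formal sums\<close>

context finitary_category
begin

lemma K0_class_subobject:
  assumes "k \<in> Iso C" "U \<in> subobjects C (rep k)"
  shows "K0_class C (quot_class U) \<otimes>\<^bsub>K0 C\<^esub> K0_class C (sub_class U) = K0_class C k"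
proof -
  obtain u p where u: "mono_arr C u" "Cod C u = rep k" "U = sub_rel C `` {u}" "u \<in> U" "short_exact C u p"
    using subobjectE[OF assms(2)] .
  show ?thesis
    using K0_class_short_exact[OF u(5)] class_of_member[OF assms(2) u(4) short_exactD(4)[OF u(5)]]
      u(2) rep_props[OF assms(1)] by simp
qed

text \<open>Each subobject lies in exactly one of the fibres counted by the Hall numbers, so the
  weighted double sum runs over every subobject once.\<close>

lemma hall_mult_eq_sum:
  assumes x: "x \<in> hall_carrier C" and y: "y \<in> hall_carrier C" and k: "k \<in> Iso C"
  shows "hall_mult C x y k = (\<Sum>U\<in>subobjects C (rep k). x (quot_class U) * y (sub_class U))"
proof -
  let ?S = "subobjects C (rep k)" and ?X = "{m. x m \<noteq> 0}" and ?Y = "{n. y n \<noteq> 0}"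
  have fX: "finite ?X" "?X \<subseteq> Iso C" and fY: "finite ?Y" "?Y \<subseteq> Iso C"
    using x y by (auto simp: hall_carrier_def)
  have fS: "finite ?S" using finite_subobjects Obj_of_rep[OF k] by blast
  have h: "of_nat (hall_number C (rep m) (rep n) (rep k)) =
      (\<Sum>U\<in>?S. if quot_class U = m \<and> sub_class U = n then 1 else 0 :: rat)" if "m \<in> ?X" "n \<in> ?Y" for m n
  proof -
    have "m \<in> Iso C" "n \<in> Iso C" using that fX fY by auto
    then have "hall_number C (rep m) (rep n) (rep k) = card {U \<in> ?S. quot_class U = m \<and> sub_class U = n}"
      using hall_number_eq[OF Obj_of_rep Obj_of_rep, of m n "rep k"] rep_props by simp
    also have "of_nat \<dots> = (\<Sum>U\<in>?S. if quot_class U = m \<and> sub_class U = n then 1 else 0 :: rat)"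
      using fS by (simp add: sum.If_cases Int_def)
    finally show ?thesis by simp
  qed
  have "hall_mult C x y k = (\<Sum>m\<in>?X. \<Sum>n\<in>?Y. \<Sum>U\<in>?S.
      if quot_class U = m \<and> sub_class U = n then x m * y n else 0)"
    using k by (auto simp: hall_mult_def h sum_distrib_left intro!: sum.cong)
  also have "\<dots> = (\<Sum>U\<in>?S. \<Sum>m\<in>?X. \<Sum>n\<in>?Y.
      if quot_class U = m \<and> sub_class U = n then x m * y n else 0)"
    by (subst sum.swap[of _ ?S ?X, symmetric], subst sum.swap[of _ ?S ?Y, symmetric]) (rule refl)
  also have "\<dots> = (\<Sum>U\<in>?S. x (quot_class U) * y (sub_class U))"
  proof (rule sum.cong[OF refl])
    fix U assume "U \<in> ?S"
    have "(\<Sum>m\<in>?X. \<Sum>n\<in>?Y. if quot_class U = m \<and> sub_class U = n then x m * y n else 0) =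
      (\<Sum>m\<in>?X. if quot_class U = m then \<Sum>n\<in>?Y. if sub_class U = n then x m * y n else 0 else 0)"
      by (intro sum.cong refl) auto
    also have "\<dots> = x (quot_class U) * y (sub_class U)"
      using fX fY by (simp add: sum.delta)
    finally show "(\<Sum>m\<in>?X. \<Sum>n\<in>?Y. if quot_class U = m \<and> sub_class U = n then x m * y n else 0) =
      x (quot_class U) * y (sub_class U)" .
  qed
  finally show ?thesis .
qed

lemma hall_formal_sum_component:
  assumes "\<gamma> \<in> carrier (K0 C)" shows "hall_formal_sum C a \<gamma> \<in> hall_graded C \<gamma>"
proof -
  have "{m. hall_formal_sum C a \<gamma> m \<noteq> 0} \<subseteq> {m \<in> Iso C. K0_class C m = \<gamma>}"
    using assms by (auto simp: hall_formal_sum_def)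
  moreover from this have "finite {m. hall_formal_sum C a \<gamma> m \<noteq> 0}"
    using finite_iso_classes_K0 finite_subset by blast
  ultimately show ?thesis by (auto simp: hall_graded_def hall_algebra_def hall_carrier_def)
qed

lemma hall_formal_sum_carrier: "hall_formal_sum C a \<in> carrier (completed_hall_algebra C)"
  unfolding completed_hall_algebra_def
  using hall_formal_sum_component by (auto simp: hall_formal_sum_def)

text \<open>Each class has exactly one degree, and the component in that degree is the only one that
  can be nonzero on it. An element of the completion thus amounts to a single function on
  isomorphism classes.\<close>

lemma completed_hall_carrierE:
  assumes "x \<in> carrier (completed_hall_algebra C)"
  obtains a where "x = hall_formal_sum C a"
proof -
  have x: "x \<in> (\<Pi>\<^sub>E \<gamma>\<in>carrier (K0 C). hall_graded C \<gamma>)"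
    using assms by (simp add: completed_hall_algebra_def)
  have "x = hall_formal_sum C (\<lambda>m. x (K0_class C m) m)"
  proof (rule ext)
    fix \<gamma>
    show "x \<gamma> = hall_formal_sum C (\<lambda>m. x (K0_class C m) m) \<gamma>"
    proof (cases "\<gamma> \<in> carrier (K0 C)")
      case True
      then have "x \<gamma> \<in> hall_graded C \<gamma>" using x by auto
      then show ?thesis using True
        by (auto simp: hall_formal_sum_def hall_graded_def hall_algebra_def hall_carrier_def fun_eq_iff)
    next
      case False
      then show ?thesis using x by (auto simp: hall_formal_sum_def PiE_def extensional_def)
    qed
  qed
  then show thesis by (rule that)
qed

lemma hall_formal_sum_eqD:
  assumes "hall_formal_sum C a = hall_formal_sum C b" "m \<in> Iso C" shows "a m = b m"
  using fun_cong[OF fun_cong[OF assms(1)], of "K0_class C m" m] assms(2) K0_class_carrier[OF assms(2)]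
  by (simp add: hall_formal_sum_def)

lemma hall_formal_sum_cong:
  "(\<And>m. m \<in> Iso C \<Longrightarrow> a m = b m) \<Longrightarrow> hall_formal_sum C a = hall_formal_sum C b"
  by (auto simp: hall_formal_sum_def fun_eq_iff)

text \<open>The subobjects of \<open>rep k\<close> are sorted by the degrees of their quotient and
  subobject classes. Only the finitely many pairs of degrees that occur contribute to the sum over
  all \<alpha> and \<beta>.\<close>

lemma completed_hall_mult_formal_sum:
  "hall_formal_sum C a \<otimes>\<^bsub>completed_hall_algebra C\<^esub> hall_formal_sum C b =
    hall_formal_sum C (\<lambda>k. \<Sum>U\<in>subobjects C (rep k). a (quot_class U) * b (sub_class U))"
proof (rule ext)
  fix \<gamma>
  let ?x = "hall_formal_sum C a" and ?y = "hall_formal_sum C b"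
  let ?r = "hall_formal_sum C (\<lambda>k. \<Sum>U\<in>subobjects C (rep k). a (quot_class U) * b (sub_class U))"
  show "(?x \<otimes>\<^bsub>completed_hall_algebra C\<^esub> ?y) \<gamma> = ?r \<gamma>"
  proof (cases "\<gamma> \<in> carrier (K0 C)")
    case False
    then show ?thesis
      by (simp add: completed_hall_algebra_def completed_hall_mult_def hall_formal_sum_def)
  next
    case True
    show ?thesis
    proof (rule ext)
      fix k
      let ?T = "\<lambda>(\<alpha>, \<beta>). if \<alpha> \<in> carrier (K0 C) \<and> \<beta> \<in> carrier (K0 C) \<and> \<alpha> \<otimes>\<^bsub>K0 C\<^esub> \<beta> = \<gamma>
        then hall_mult C (?x \<alpha>) (?y \<beta>) k else 0"
      have l: "(?x \<otimes>\<^bsub>completed_hall_algebra C\<^esub> ?y) \<gamma> k = Sum_any ?T"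
        using True unfolding completed_hall_algebra_def completed_hall_mult_def mult_hall_algebra by simp
      show "(?x \<otimes>\<^bsub>completed_hall_algebra C\<^esub> ?y) \<gamma> k = ?r \<gamma> k"
      proof (cases "k \<in> Iso C")
        case False
        then have "?T = (\<lambda>_. 0)" by (auto simp: hall_mult_def fun_eq_iff)
        then show ?thesis unfolding l using False True by (simp add: hall_formal_sum_def)
      next
        case k: True
        let ?S = "subobjects C (rep k)"
        let ?d = "\<lambda>U. (K0_class C (quot_class U), K0_class C (sub_class U))"
        \<comment> \<open>The weight vanishes unless \<open>k\<close> has degree \<gamma>, since the
          two degrees belonging to a subobject multiply to that of \<open>k\<close>.\<close>
        let ?w = "\<lambda>U. if K0_class C k = \<gamma> then a (quot_class U) * b (sub_class U) else 0"
        have fS: "finite ?S" using finite_subobjects Obj_of_rep[OF k] by blast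
        have T: "?T \<delta> = (\<Sum>U\<in>?S. if ?d U = \<delta> then ?w U else 0)" for \<delta>
        proof -
          obtain \<alpha> \<beta> where \<delta>: "\<delta> = (\<alpha>, \<beta>)" by force
          show ?thesis
          proof (cases "\<alpha> \<in> carrier (K0 C) \<and> \<beta> \<in> carrier (K0 C) \<and> \<alpha> \<otimes>\<^bsub>K0 C\<^esub> \<beta> = \<gamma>")
            case T: True
            have "?x \<alpha> \<in> hall_carrier C" "?y \<beta> \<in> hall_carrier C"
              using hall_formal_sum_component[of \<alpha> a] hall_formal_sum_component[of \<beta> b] T
              by (simp_all add: hall_graded_def hall_algebra_def)
            then have "?T \<delta> = (\<Sum>U\<in>?S. ?x \<alpha> (quot_class U) * ?y \<beta> (sub_class U))"
              using T \<delta> hall_mult_eq_sum k by simp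
            also have "\<dots> = (\<Sum>U\<in>?S. if ?d U = \<delta> then ?w U else 0)"
              by (rule sum.cong[OF refl])
                (use T \<delta> classes_in_Iso K0_class_subobject[OF k] in \<open>auto simp: hall_formal_sum_def\<close>)
            finally show ?thesis .
          next
            case F: False
            have "(if ?d U = \<delta> then ?w U else 0) = 0" if "U \<in> ?S" for U
              using F \<delta> classes_in_Iso[OF that] K0_class_subobject[OF k that] K0_class_carrier by auto
            then have "(\<Sum>U\<in>?S. if ?d U = \<delta> then ?w U else 0) = 0" by (intro sum.neutral ballI)
            moreover have "?T \<delta> = 0" using F \<delta> by auto
            ultimately show ?thesis by argo
          qed
        qed
        have "Sum_any ?T = (\<Sum>\<delta>\<in>?d ` ?S. ?T \<delta>)"
        proof (rule Sum_any.expand_superset)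
          show "finite (?d ` ?S)" using fS by simp
          have "?T \<delta> = 0" if "\<delta> \<notin> ?d ` ?S" for \<delta>
            unfolding T by (intro sum.neutral ballI if_not_P) (use that in blast)
          then show "{\<delta>. ?T \<delta> \<noteq> 0} \<subseteq> ?d ` ?S" by blast
        qed
        also have "\<dots> = (\<Sum>\<delta>\<in>?d ` ?S. \<Sum>U\<in>?S. if ?d U = \<delta> then ?w U else 0)"
          by (rule sum.cong[OF refl]) (rule T)
        also have "\<dots> = (\<Sum>U\<in>?S. \<Sum>\<delta>\<in>?d ` ?S. if ?d U = \<delta> then ?w U else 0)"
          by (rule sum.swap)
        also have "\<dots> = (\<Sum>U\<in>?S. ?w U)"
          by (rule sum.cong[OF refl]) (use fS in \<open>simp add: sum.delta\<close>)
        also have "\<dots> = ?r \<gamma> k" using True k by (simp add: hall_formal_sum_def)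
        finally show ?thesis unfolding l .
      qed
    qed
  qed
qed

lemma zero_class_iff: assumes "m \<in> Iso C" shows "m = {Z. zero_obj C Z} \<longleftrightarrow> zero_obj C (rep m)"
proof
  assume "m = {Z. zero_obj C Z}"
  then show "zero_obj C (rep m)" using rep_props(3)[OF assms] by blast
next
  assume z: "zero_obj C (rep m)"
  have "m = iso_class C (rep m)" using rep_props[OF assms] by simp
  also have "\<dots> = {Z. zero_obj C Z}"
    unfolding iso_class_def iso_rel_def
    using z zero_obj_isomorphic zero_obj_isomorphic_zero zero_obj_Obj by blast
  finally show "m = {Z. zero_obj C Z}" .
qed

lemma completed_hall_one:
  "\<one>\<^bsub>completed_hall_algebra C\<^esub> = hall_formal_sum C (\<lambda>m. if zero_obj C (rep m) then 1 else 0)"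
  unfolding completed_hall_algebra_def hall_algebra_def
  by (simp, rule hall_formal_sum_cong) (simp add: zero_class_iff)

text \<open>The system is unitriangular: the whole object contributes the coefficient at
  \<open>k\<close>, and every other subobject has fewer composition factors.\<close>

lemma right_inverse_unique:
  fixes a c :: "'a set \<Rightarrow> rat"
  assumes "\<And>k. k \<in> Iso C \<Longrightarrow>
    (\<Sum>U\<in>subobjects C (rep k). a (sub_class U)) = (\<Sum>U\<in>subobjects C (rep k). c (sub_class U))"
    and "k \<in> Iso C"
  shows "a k = c k"
  using assms(2)
proof (induction "size (factors (rep k))" arbitrary: k rule: less_induct)
  case less
  let ?S = "subobjects C (rep k)"
  have ko: "rep k \<in> Obj C" using Obj_of_rep less by blast
  have fS: "finite ?S" using finite_subobjects ko by blast
  define U0 where "U0 = sub_rel C `` {Id C (rep k)}"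
  have mI: "mono_arr C (Id C (rep k))" using ko by (simp add: iso_mono)
  have U0: "U0 \<in> ?S" "sub_class U0 = k"
    using subobjectI[OF mI] class_of_mono[OF mI] ko rep_props[OF less.prems] by (simp_all add: U0_def)
  have "a (sub_class U) = c (sub_class U)" if U: "U \<in> ?S - {U0}" for U
  proof (rule less.hyps)
    show "sub_class U \<in> Iso C" using classes_in_Iso U by blast
    obtain u p where u: "mono_arr C u" "Cod C u = rep k" "U = sub_rel C `` {u}" "u \<in> U" "short_exact C u p"
      using subobjectE[of U "rep k"] U by blast
    note up = short_exactD[OF u(5)]
    have f: "factors (rep k) = factors (Dom C u) + factors (Cod C p)"
      using factors_short_exact[OF u(5)] u by simp
    \<comment> \<open>A zero quotient would make \<open>u\<close> invertible, and \<open>U\<close>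
      would be the whole object.\<close>
    have "factors (Cod C p) \<noteq> {#}"
    proof
      assume "factors (Cod C p) = {#}"
      then have "epi_arr C u" using cokernel_zero_obj_epi up factors_zero_iff by (metis Cod_in_Obj)
      then have i: "iso_arr C u" using mono_epi_iso u by blast
      have "(u, Id C (rep k)) \<in> sub_rel C"
        by (rule sub_relI_iso[of _ _ u]) (use u mI i ko in simp_all)
      then have "U = U0" using u U0_def sub_rel_class_eq_iff[OF u(1) mI] by simp
      with U show False by blast
    qed
    moreover have "factors (rep (sub_class U)) = factors (Dom C u)"
      using class_of_mono[OF u(1)] u up by (simp add: factors_rep)
    ultimately show "size (factors (rep (sub_class U))) < size (factors (rep k))"
      using f by (simp add: nonempty_has_size)
  qed
  then have "(\<Sum>U\<in>?S - {U0}. a (sub_class U)) = (\<Sum>U\<in>?S - {U0}. c (sub_class U))"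
    by (rule sum.cong[OF refl])
  then show "a k = c k"
    using assms(1)[OF less.prems] U0 fS by (simp add: sum.remove)
qed

lemma Exp_inverse:
  assumes l: "\<And>K. K \<in> Obj C \<Longrightarrow> (\<Sum>U\<in>subobjects C K. c (quot_class U)) = (if zero_obj C K then 1 else 0)"
    and r: "\<And>K. K \<in> Obj C \<Longrightarrow> (\<Sum>U\<in>subobjects C K. c (sub_class U)) = (if zero_obj C K then 1 else 0)"
  shows "hall_Exp C \<in> Units (completed_hall_algebra C) \<and>
    inv\<^bsub>completed_hall_algebra C\<^esub> (hall_Exp C) = hall_formal_sum C c"
proof -
  let ?A = "completed_hall_algebra C" and ?c = "hall_formal_sum C c"
  have 1: "hall_Exp C \<otimes>\<^bsub>?A\<^esub> ?c = \<one>\<^bsub>?A\<^esub>"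
    unfolding hall_Exp_def completed_hall_mult_formal_sum completed_hall_one
    by (rule hall_formal_sum_cong) (simp add: r Obj_of_rep)
  have 2: "?c \<otimes>\<^bsub>?A\<^esub> hall_Exp C = \<one>\<^bsub>?A\<^esub>"
    unfolding hall_Exp_def completed_hall_mult_formal_sum completed_hall_one
    by (rule hall_formal_sum_cong) (simp add: l Obj_of_rep)
  \<comment> \<open>\<open>m_inv\<close> is a definite description and needs uniqueness; right
    inverses alone are already unique, so associativity is not invoked.\<close>
  have 3: "y = ?c" if y: "y \<in> carrier ?A" "hall_Exp C \<otimes>\<^bsub>?A\<^esub> y = \<one>\<^bsub>?A\<^esub>" for y
  proof -
    obtain a where a: "y = hall_formal_sum C a" using completed_hall_carrierE[OF y(1)] .
    have "hall_formal_sum C (\<lambda>k. \<Sum>U\<in>subobjects C (rep k). 1 * a (sub_class U)) =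
      hall_formal_sum C (\<lambda>m. if zero_obj C (rep m) then 1 else 0)"
      using y(2) unfolding a hall_Exp_def completed_hall_mult_formal_sum completed_hall_one .
    from hall_formal_sum_eqD[OF this]
    have "(\<Sum>U\<in>subobjects C (rep k). a (sub_class U)) = (\<Sum>U\<in>subobjects C (rep k). c (sub_class U))"
      if "k \<in> Iso C" for k using that r Obj_of_rep by simp
    then have "a k = c k" if "k \<in> Iso C" for k using right_inverse_unique that by blast
    then show ?thesis unfolding a by (rule hall_formal_sum_cong)
  qed
  have E: "hall_Exp C \<in> carrier ?A" "?c \<in> carrier ?A"
    by (simp_all add: hall_Exp_def hall_formal_sum_carrier)
  have "hall_Exp C \<in> Units ?A" unfolding Units_def using E 1 2 by blast
  moreover have "inv\<^bsub>?A\<^esub> (hall_Exp C) = ?c"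
    unfolding m_inv_def by (rule the_equality) (use E 1 2 3 in blast)+
  ultimately show ?thesis by blast
qed

end

section \<open>Split monomorphisms and biproducts\<close>

context preadditive_category
begin

lemma finprod_Hom_empty: "\<lbrakk>X \<in> Obj C; Y \<in> Obj C\<rbrakk> \<Longrightarrow> finprod (Hom_group C X Y) f {} = Zero C X Y"
proof -
  assume "X \<in> Obj C" "Y \<in> Obj C"
  then interpret comm_group "Hom_group C X Y" by (rule comm_group_Hom)
  show ?thesis by simp
qed

lemma finprod_Hom_closed:
  assumes "X \<in> Obj C" "Y \<in> Obj C" "\<And>k. k \<in> I \<Longrightarrow> f k \<in> Hom C X Y"
  shows "finprod (Hom_group C X Y) f I \<in> Hom C X Y"
proof -
  interpret comm_group "Hom_group C X Y" using assms by (intro comm_group_Hom)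
  show ?thesis using finprod_closed[of f I] assms(3) by (auto simp del: in_Hom)
qed

lemma finprod_Hom_insert:
  assumes "X \<in> Obj C" "Y \<in> Obj C" "finite I" "j \<notin> I" "f j \<in> Hom C X Y" "\<And>k. k \<in> I \<Longrightarrow> f k \<in> Hom C X Y"
  shows "finprod (Hom_group C X Y) f (insert j I) = Add C (f j) (finprod (Hom_group C X Y) f I)"
proof -
  interpret comm_group "Hom_group C X Y" using assms by (intro comm_group_Hom)
  show ?thesis using finprod_insert[of I j f] assms by (auto simp del: in_Hom)
qed

lemma finprod_Hom_cong:
  assumes "X \<in> Obj C" "Y \<in> Obj C" "\<And>k. k \<in> I \<Longrightarrow> f k = g k" "\<And>k. k \<in> I \<Longrightarrow> g k \<in> Hom C X Y"
  shows "finprod (Hom_group C X Y) f I = finprod (Hom_group C X Y) g I"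
proof -
  interpret comm_group "Hom_group C X Y" using assms by (intro comm_group_Hom)
  show ?thesis by (rule finprod_cong') (use assms in \<open>auto simp del: in_Hom\<close>)
qed

lemma Comp_finprod_Hom:
  assumes "finite I" "h \<in> Hom C Y Z" "\<And>k. k \<in> I \<Longrightarrow> f k \<in> Hom C X Y" "X \<in> Obj C"
  shows "h \<cdot> finprod (Hom_group C X Y) f I = finprod (Hom_group C X Z) (\<lambda>k. h \<cdot> f k) I"
  using assms(1,3)
proof (induction I)
  case empty
  then show ?case using assms(2,4) by (auto simp: finprod_Hom_empty)
next
  case (insert j I)
  have o: "X \<in> Obj C" "Y \<in> Obj C" "Z \<in> Obj C" using assms by auto
  have cl: "finprod (Hom_group C X Y) f I \<in> Hom C X Y"
    by (rule finprod_Hom_closed[OF o(1,2)]) (use insert.prems in blast)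
  have "h \<cdot> finprod (Hom_group C X Y) f (insert j I) = h \<cdot> Add C (f j) (finprod (Hom_group C X Y) f I)"
    using finprod_Hom_insert[OF o(1,2) insert.hyps, of f] insert.prems by simp
  also have "\<dots> = Add C (h \<cdot> f j) (h \<cdot> finprod (Hom_group C X Y) f I)"
    using assms(2) insert.prems[of j] cl by simp
  also have "\<dots> = Add C (h \<cdot> f j) (finprod (Hom_group C X Z) (\<lambda>k. h \<cdot> f k) I)"
    using insert by simp
  also have "\<dots> = finprod (Hom_group C X Z) (\<lambda>k. h \<cdot> f k) (insert j I)"
    using finprod_Hom_insert[OF o(1,3) insert.hyps, of "\<lambda>k. h \<cdot> f k"] insert.prems assms(2) by simp
  finally show ?case .
qed

lemma finprod_Hom_zero:
  assumes "X \<in> Obj C" "Y \<in> Obj C" "\<And>k. k \<in> I \<Longrightarrow> f k = Zero C X Y"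
  shows "finprod (Hom_group C X Y) f I = Zero C X Y"
proof -
  interpret comm_group "Hom_group C X Y" using assms by (intro comm_group_Hom)
  show ?thesis using finprod_one_eqI[of I f] assms by simp
qed

lemma neg_Zero [simp]: "\<lbrakk>X \<in> Obj C; Y \<in> Obj C\<rbrakk> \<Longrightarrow> neg (Zero C X Y) = Zero C X Y"
  using Add_Zero(2)[of "neg (Zero C X Y)" X Y] neg_simps(1-4)[of "Zero C X Y"] Zero_simps[of X Y] by metis

text \<open>The idempotent 1 - s r is killed by \<open>r\<close>, so it factors through the kernel
  \<open>k\<close>; the factor \<open>p\<close> is the projection onto Ker r along
  \<open>s\<close>.\<close>

lemma split_complement:
  assumes "s \<in> Arr C" "r \<in> Arr C" "Cod C s = Dom C r" "Cod C r = Dom C s" "r \<cdot> s = Id C (Dom C s)"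
    "is_kernel C k r"
  obtains p where "p \<in> Arr C" "Dom C p = Dom C r" "Cod C p = Dom C k"
    "p \<cdot> k = Id C (Dom C k)" "p \<cdot> s = Zero C (Dom C s) (Dom C k)"
    "Add C (k \<cdot> p) (s \<cdot> r) = Id C (Dom C r)"
proof -
  note k = kernelD[OF assms(6)]
  let ?V = "Dom C r"
  let ?e = "Add C (Id C ?V) (neg (s \<cdot> r))"
  have e: "?e \<in> Arr C" "Dom C ?e = ?V" "Cod C ?e = ?V" using assms(1-4) by simp_all
  have "r \<cdot> ?e = Zero C ?V (Cod C r)"
    using assms(1-4) by (simp add: reassoc[OF assms(5)])
  then obtain p where p: "p \<in> Arr C" "Dom C p = ?V" "Cod C p = Dom C k" "k \<cdot> p = ?e"
    using kernel_factor[OF assms(6), of ?e] e by auto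
  have "k \<cdot> (p \<cdot> k) = ?e \<cdot> k" using reassoc[OF p(4), of k] p(1-3) k(1,3) by simp
  also have "\<dots> = k \<cdot> Id C (Dom C k)" using assms(1-4) k by simp
  finally have 1: "p \<cdot> k = Id C (Dom C k)"
    by (rule mono_cancel[OF kernel_mono[OF assms(6)], rotated 5]) (use p(1-3) k in simp_all)
  have "k \<cdot> (p \<cdot> s) = ?e \<cdot> s" using reassoc[OF p(4), of s] p(1-3) k(1,3) assms(1-4) by simp
  also have "\<dots> = Zero C (Dom C s) (Cod C k)" using assms k(1,3) by simp
  finally have 2: "p \<cdot> s = Zero C (Dom C s) (Dom C k)"
    using mono_zero[OF kernel_mono[OF assms(6)], of "p \<cdot> s"] p(1-3) k(1,3) assms(1-4) by simp
  have "Add C (k \<cdot> p) (s \<cdot> r) = Add C (Id C ?V) (Add C (neg (s \<cdot> r)) (s \<cdot> r))"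
    unfolding p(4) by (rule Add_assoc) (use assms(1-4) in simp_all)
  also have "\<dots> = Id C ?V" using assms(1-4) by simp
  finally show thesis using that p 1 2 by blast
qed

text \<open>Inserting the decomposition of the identity recovers an arrow from its restrictions to
  the two summands.\<close>

lemma retraction_decomp:
  assumes "f \<in> Arr C" "k \<in> Arr C" "p \<in> Arr C" "s \<in> Arr C" "r \<in> Arr C"
    "Add C (k \<cdot> p) (s \<cdot> r) = Id C (Dom C f)" "Dom C p = Dom C f" "Cod C p = Dom C k" "Cod C k = Dom C f"
    "Dom C r = Dom C f" "Cod C r = Dom C s" "Cod C s = Dom C f"
  shows "f = Add C (f \<cdot> k \<cdot> p) (f \<cdot> s \<cdot> r)"
proof -
  have "f = f \<cdot> Add C (k \<cdot> p) (s \<cdot> r)" unfolding assms(6) using assms(1) by simp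
  also have "\<dots> = Add C (f \<cdot> k \<cdot> p) (f \<cdot> s \<cdot> r)" using assms(1-5,7-12) by simp
  finally show ?thesis .
qed

definition retractions :: "'b \<Rightarrow> 'b set" where
  "retractions s = {r \<in> Hom C (Cod C s) (Dom C s). r \<cdot> s = Id C (Dom C s)}"

lemma retractionsD:
  "r \<in> retractions s \<Longrightarrow> r \<in> Arr C" "r \<in> retractions s \<Longrightarrow> Dom C r = Cod C s"
  "r \<in> retractions s \<Longrightarrow> Cod C r = Dom C s" "r \<in> retractions s \<Longrightarrow> r \<cdot> s = Id C (Dom C s)"
  by (simp_all add: retractions_def)

text \<open>All retractions agree on \<open>s\<close>, so each is determined by its restriction to
  Ker r0, and every \<open>g\<close> on Ker r0 extends to the retraction g p + r0. They form a
  torsor under Hom(Ker r0, S) with base point \<open>r0\<close>.\<close>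

lemma bij_retractions:
  assumes s: "s \<in> Arr C" and r0: "r0 \<in> retractions s" and k: "is_kernel C k r0"
  shows "bij_betw (\<lambda>r. r \<cdot> k) (retractions s) (Hom C (Dom C k) (Dom C s))"
proof -
  note r = retractionsD[OF r0] and kk = kernelD[OF k]
  obtain p where p: "p \<in> Arr C" "Dom C p = Dom C r0" "Cod C p = Dom C k"
    "p \<cdot> k = Id C (Dom C k)" "p \<cdot> s = Zero C (Dom C s) (Dom C k)"
    "Add C (k \<cdot> p) (s \<cdot> r0) = Id C (Dom C r0)"
    using split_complement[OF s r(1) r(2)[symmetric] r(3) r(4) k] .
  have 1: "r' = Add C (r' \<cdot> k \<cdot> p) r0" if "r' \<in> retractions s" for r'
  proof -
    note r' = retractionsD[OF that]
    have "r' = Add C (r' \<cdot> k \<cdot> p) (r' \<cdot> s \<cdot> r0)"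
      by (rule retraction_decomp) (use r' r kk p s in simp_all)
    then show ?thesis using r' r by simp
  qed
  have inj: "inj_on (\<lambda>r. r \<cdot> k) (retractions s)"
    by (rule inj_onI) (metis 1)
  have sub: "(\<lambda>r. r \<cdot> k) ` retractions s \<subseteq> Hom C (Dom C k) (Dom C s)"
    using retractionsD kk r by auto
  have "g \<in> (\<lambda>r. r \<cdot> k) ` retractions s" if "g \<in> Hom C (Dom C k) (Dom C s)" for g
  proof -
    let ?r = "Add C (g \<cdot> p) r0"
    have "?r \<in> retractions s"
      unfolding retractions_def using that p(1-3) r(1-3) s by (simp add: p(5) r(4))
    moreover have "?r \<cdot> k = g"
      using that p(1-3) r(1-3) s kk by (simp add: p(4))
    ultimately show ?thesis by force
  qed
  then show ?thesis using inj sub unfolding bij_betw_def by blast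
qed

end

section \<open>Biproducts, and sums of disjoint subobjects\<close>

context abelian_category
begin

lemma ex_biproduct:
  assumes "X \<in> Obj C" "Y \<in> Obj C"
  obtains M i j p q where "M \<in> Obj C" "i \<in> Hom C X M" "j \<in> Hom C Y M" "p \<in> Hom C M X" "q \<in> Hom C M Y"
    "p \<cdot> i = Id C X" "q \<cdot> j = Id C Y" "p \<cdot> j = Zero C Y X" "q \<cdot> i = Zero C X Y"
    "Add C (i \<cdot> p) (j \<cdot> q) = Id C M"
proof -
  let ?S = "\<lambda>k. if k = (0::nat) then X else Y"
  obtain M i p where M: "direct_sum C 2 ?S M i p" proof -
    have "\<forall>k<2. ?S k \<in> Obj C" using assms by simp
    from ex_direct_sum[OF this] show thesis using that by blast
  qed
  have o: "M \<in> Obj C" using M by (simp add: direct_sum_def)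
  have h: "i 0 \<in> Hom C X M" "i 1 \<in> Hom C Y M" "p 0 \<in> Hom C M X" "p 1 \<in> Hom C M Y"
    using M unfolding direct_sum_def by (auto dest: spec[of _ 0] spec[of _ 1])
  have c: "p j \<cdot> i k = (if j = k then Id C (?S k) else Zero C (?S k) (?S j))" if "j < 2" "k < 2" for j k
    using M that unfolding direct_sum_def by blast
  have "finprod (Hom_group C M M) (\<lambda>k. i k \<cdot> p k) {..<2} = Id C M"
    using M by (simp add: direct_sum_def)
  moreover have "{..<2} = insert (0::nat) (insert 1 {})" by auto
  ultimately have "finprod (Hom_group C M M) (\<lambda>k. i k \<cdot> p k) (insert (0::nat) (insert 1 {})) = Id C M" by simp
  moreover have "finprod (Hom_group C M M) (\<lambda>k. i k \<cdot> p k) (insert (0::nat) (insert 1 {})) =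
      Add C (i 0 \<cdot> p 0) (finprod (Hom_group C M M) (\<lambda>k. i k \<cdot> p k) (insert 1 {}))"
    by (rule finprod_Hom_insert[OF o o]) (use h in auto)
  moreover have "finprod (Hom_group C M M) (\<lambda>k. i k \<cdot> p k) (insert (1::nat) {}) =
      Add C (i 1 \<cdot> p 1) (finprod (Hom_group C M M) (\<lambda>k. i k \<cdot> p k) {})"
    by (rule finprod_Hom_insert[OF o o]) (use h in auto)
  ultimately have "Add C (i 0 \<cdot> p 0) (i 1 \<cdot> p 1) = Id C M"
    using h o by (simp add: finprod_Hom_empty[OF o o])
  then show thesis
    using that[OF o h] c[of 0 0] c[of 1 1] c[of 0 1] c[of 1 0] by simp
qed

text \<open>A simple S not contained in U meets it in zero, so U \<oplus> S embeds. If
  \<open>b\<close> were nonzero it would be epi onto S; modulo U the relation says that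
  \<open>s \<cdot> b\<close> vanishes, hence so does \<open>s\<close>, and \<open>s\<close> would
  factor through \<open>u\<close>.\<close>

lemma disjoint_sum_mono:
  assumes u: "mono_arr C u" and s: "mono_arr C s" "simple_obj C (Dom C s)" "Cod C s = Cod C u"
    and n: "\<And>x. \<lbrakk>x \<in> Arr C; Dom C x = Dom C s; Cod C x = Dom C u\<rbrakk> \<Longrightarrow> u \<cdot> x \<noteq> s"
    and a: "a \<in> Arr C" "Cod C a = Dom C u" and b: "b \<in> Arr C" "Cod C b = Dom C s" "Dom C b = Dom C a"
    and z: "Add C (u \<cdot> a) (s \<cdot> b) = Zero C (Dom C a) (Cod C u)"
  shows "a = Zero C (Dom C a) (Dom C u)" "b = Zero C (Dom C a) (Dom C s)"
proof -
  show b0: "b = Zero C (Dom C a) (Dom C s)"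
  proof (rule ccontr)
    assume nb: "b \<noteq> Zero C (Dom C a) (Dom C s)"
    then have be: "epi_arr C b" using to_simple_epi[OF s(2) b(1,2)] b by simp
    obtain c where c: "is_cokernel C c u" using ex_cokernel u mono_Arr by blast
    note cc = cokernelD[OF c]
    have "c \<cdot> Add C (u \<cdot> a) (s \<cdot> b) = Add C (c \<cdot> (u \<cdot> a)) (c \<cdot> (s \<cdot> b))"
      using cc(1,3) u s a b by simp
    also have "c \<cdot> (u \<cdot> a) = Zero C (Dom C a) (Cod C c)"
      using cc(1,3) u a by (simp add: reassoc[OF cc(4)])
    finally have "c \<cdot> (s \<cdot> b) = Zero C (Dom C a) (Cod C c)"
      unfolding z using cc(1,3) u s a b by simp
    then have "c \<cdot> s = Zero C (Dom C s) (Cod C c)"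
      using epi_zero[OF be, of "c \<cdot> s"] cc(1,3) s b by simp
    then obtain x where "x \<in> Arr C" "Dom C x = Dom C s" "Cod C x = Dom C u" "u \<cdot> x = s"
      using kernel_factor[OF mono_kernel[OF u c], of s] s cc by auto
    then show False using n by blast
  qed
  have "u \<cdot> a = Zero C (Dom C a) (Cod C u)"
    using z b0 u s a b by (metis Add_Zero(1) Comp_Zero(2) Comp_simps Dom_in_Obj mono_Arr)
  then show "a = Zero C (Dom C a) (Dom C u)" using mono_zero[OF u a] by simp
qed

text \<open>A subobject of K is a class, so its chosen representative is only isomorphic to the
  biproduct constructed for it; here the kernel of a projection is carried along such an isomorphism
  \<open>w\<close>.\<close>

lemma kernel_of_transported_projection:
  assumes w: "w \<in> Arr C" "w' \<in> Arr C" "Dom C w = M" "Dom C w' = Cod C w" "Cod C w' = M"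
    "w' \<cdot> w = Id C M" "w \<cdot> w' = Id C (Cod C w)"
    and bp: "i \<in> Hom C X M" "j \<in> Hom C Y M" "p \<in> Hom C M X" "q \<in> Hom C M Y"
    "p \<cdot> i = Id C X" "q \<cdot> i = Zero C X Y" "Add C (i \<cdot> p) (j \<cdot> q) = Id C M"
  shows "is_kernel C (w \<cdot> i) (q \<cdot> w')"
proof (rule kernelI)
  have bp': "i \<in> Arr C" "Dom C i = X" "Cod C i = M" "j \<in> Arr C" "Dom C j = Y" "Cod C j = M"
    "p \<in> Arr C" "Dom C p = M" "Cod C p = X" "q \<in> Arr C" "Dom C q = M" "Cod C q = Y" using bp(1-4) by auto
  have o: "X \<in> Obj C" "Y \<in> Obj C" "M \<in> Obj C" using bp' Dom_in_Obj Cod_in_Obj by blast+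
  have wi: "iso_arr C w" by (rule isoI[of w w']) (use w in simp_all)
  have im: "mono_arr C i" using split_mono[of p i] bp' bp(5) by simp
  show "mono_arr C (w \<cdot> i)" using mono_comp[OF im iso_mono[OF wi]] w bp' by simp
  show "q \<cdot> w' \<in> Arr C" "Cod C (w \<cdot> i) = Dom C (q \<cdot> w')" using w(1-5) bp' by simp_all
  show "q \<cdot> w' \<cdot> (w \<cdot> i) = Zero C (Dom C (w \<cdot> i)) (Cod C (q \<cdot> w'))"
    using w(1-5) bp' o by (simp add: reassoc[OF w(6)] bp(6))
  fix h assume h: "h \<in> Arr C" "Cod C h = Dom C (q \<cdot> w')" "q \<cdot> w' \<cdot> h = Zero C (Dom C h) (Cod C (q \<cdot> w'))"
  have h': "Cod C h = Cod C w" "q \<cdot> (w' \<cdot> h) = Zero C (Dom C h) Y"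
    using h w(1-5) bp' by simp_all
  let ?h = "w' \<cdot> h"
  have hh: "?h \<in> Arr C" "Dom C ?h = Dom C h" "Cod C ?h = M" using h(1) h' w(1-5) by simp_all
  have "?h = Add C (i \<cdot> p) (j \<cdot> q) \<cdot> ?h" unfolding bp(7) using hh by simp
  also have "\<dots> = Add C (i \<cdot> (p \<cdot> ?h)) (j \<cdot> (q \<cdot> ?h))"
    using hh bp' by simp
  also have "\<dots> = i \<cdot> (p \<cdot> ?h)" unfolding h'(2) using hh bp' o h(1) by simp
  finally have e: "?h = i \<cdot> (p \<cdot> ?h)" .
  have "w \<cdot> i \<cdot> (p \<cdot> ?h) = w \<cdot> (i \<cdot> (p \<cdot> ?h))" by (rule assoc) (use w(1-5) bp' hh in simp_all)
  also have "\<dots> = w \<cdot> ?h" using e by simp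
  also have "\<dots> = h" using reassoc[OF w(7), of h] w(1-5) h(1) h'(1) by simp
  finally show "\<exists>u. u \<in> Arr C \<and> Dom C u = Dom C h \<and> Cod C u = Dom C (w \<cdot> i) \<and> w \<cdot> i \<cdot> u = h"
    using w(1-5) bp' hh by (intro exI[of _ "p \<cdot> ?h"]) simp
qed

definition kernel_of :: "'b \<Rightarrow> 'b" where "kernel_of f = (SOME k. is_kernel C k f)"

lemma kernel_of: "f \<in> Arr C \<Longrightarrow> is_kernel C (kernel_of f) f"
  unfolding kernel_of_def using ex_kernel by (rule someI_ex)

end

section \<open>Weisner's theorem for subobjects\<close>

context abelian_category
begin

lemma finite_retractions:
  assumes "s \<in> Arr C" "\<And>X Y. \<lbrakk>X \<in> Obj C; Y \<in> Obj C\<rbrakk> \<Longrightarrow> finite (Hom C X Y)"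
  shows "finite (retractions s)"
proof (rule finite_subset)
  show "retractions s \<subseteq> Hom C (Cod C s) (Dom C s)" unfolding retractions_def by blast
  show "finite (Hom C (Cod C s) (Dom C s))" using assms by simp
qed

text \<open>For every retraction r the number n of all retractions equals |Hom(Ker r, S)|, so
  \<open>split\<close> makes each of the n terms equal to - c[V] / n, where V is the target of
  \<open>s\<close>.\<close>

lemma retraction_sum:
  fixes c :: "'a set \<Rightarrow> rat"
  assumes s: "mono_arr C s" "simple_obj C (Dom C s)"
    and fin: "\<And>X Y. \<lbrakk>X \<in> Obj C; Y \<in> Obj C\<rbrakk> \<Longrightarrow> finite (Hom C X Y)"
    and split: "\<And>k r. \<lbrakk>r \<in> retractions s; is_kernel C k r\<rbrakk> \<Longrightarrow>
      c (iso_class C (Cod C s)) = - of_nat (card (Hom C (Dom C k) (Dom C s))) * c (iso_class C (Dom C k))"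
    and nonsplit: "retractions s = {} \<Longrightarrow> c (iso_class C (Cod C s)) = 0"
  shows "(\<Sum>r\<in>retractions s. c (iso_class C (Dom C (kernel_of r)))) = - c (iso_class C (Cod C s))"
proof (cases "retractions s = {}")
  case True
  then show ?thesis using nonsplit by simp
next
  case False
  let ?n = "of_nat (card (retractions s)) :: rat"
  have "finite (retractions s)"
    using finite_retractions[OF mono_Arr[OF s(1)] fin] .
  then have n: "?n \<noteq> 0" using False by simp
  have "c (iso_class C (Dom C (kernel_of r))) = - c (iso_class C (Cod C s)) / ?n"
    if r: "r \<in> retractions s" for r
  proof -
    have k: "is_kernel C (kernel_of r) r" using kernel_of retractionsD[OF r] by blast
    have "card (retractions s) = card (Hom C (Dom C (kernel_of r)) (Dom C s))"
      using bij_betw_same_card[OF bij_retractions[OF _ r k]] s by simp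
    with split[OF r k] n show ?thesis by (simp add: field_simps)
  qed
  then have "(\<Sum>r\<in>retractions s. c (iso_class C (Dom C (kernel_of r)))) =
    (\<Sum>r\<in>retractions s. - c (iso_class C (Cod C s)) / ?n)" by (rule sum.cong[OF refl])
  also have "\<dots> = - c (iso_class C (Cod C s))" using n by simp
  finally show ?thesis .
qed

text \<open>Weisner's theorem for the lattice of subobjects of \<open>K\<close>: a subobject \<open>U\<close> that does not contain
  the simple subobject \<open>S\<close> is the kernel of a unique retraction onto \<open>S\<close> of a unique \<open>V = U \<oplus> S\<close>,
  and the term of \<open>V\<close> cancels those of the kernels of its retractions.\<close>

lemma sum_subobjects_eq_0:
  fixes c :: "'a set \<Rightarrow> rat"
  assumes s: "mono_arr C s" "simple_obj C (Dom C s)"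
    and fin: "\<And>X Y. \<lbrakk>X \<in> Obj C; Y \<in> Obj C\<rbrakk> \<Longrightarrow> finite (Hom C X Y)"
    and finS: "finite (subobjects C (Cod C s))"
    and split: "\<And>k r t. \<lbrakk>simple_obj C (Dom C t); t \<in> Arr C; r \<in> retractions t; is_kernel C k r\<rbrakk> \<Longrightarrow>
      c (iso_class C (Cod C t)) = - of_nat (card (Hom C (Dom C k) (Dom C t))) * c (iso_class C (Dom C k))"
    and nonsplit: "\<And>t. \<lbrakk>mono_arr C t; simple_obj C (Dom C t); retractions t = {}\<rbrakk> \<Longrightarrow>
      c (iso_class C (Cod C t)) = 0"
  shows "(\<Sum>U\<in>subobjects C (Cod C s). c (sub_class U)) = 0"
proof -
  let ?K = "Cod C s" and ?S = "Dom C s"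
  let ?Sub = "subobjects C ?K"
  define v where "v = (\<lambda>V. SOME u :: 'b. u \<in> V)"
  have v: "mono_arr C (v V)" "v V \<in> Arr C" "Cod C (v V) = ?K" "V = sub_rel C `` {v V}" "v V \<in> V"
    if V: "V \<in> ?Sub" for V
  proof -
    obtain u p where u: "mono_arr C u" "Cod C u = ?K" "V = sub_rel C `` {u}" "u \<in> V" using subobjectE[OF V] .
    show 1: "v V \<in> V" unfolding v_def using u(4) by (rule someI)
    then have r: "(u, v V) \<in> sub_rel C" using u by simp
    show m: "mono_arr C (v V)" using r by (rule sub_relE)
    then show "v V \<in> Arr C" by simp
    show "Cod C (v V) = ?K" using u r by (metis sub_relE)
    show "V = sub_rel C `` {v V}" using sub_rel_class_eq_iff[OF u(1) m] r u by simp
  qed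
  \<comment> \<open>\<open>lifts u\<close> is nonempty iff the subobject given by \<open>u\<close>
    contains S. Accordingly \<open>A\<close> below is the set of subobjects containing S, and
    \<open>t V\<close> is the inclusion of S into V.\<close>
  define lifts where "lifts = (\<lambda>u. {x \<in> Hom C ?S (Dom C u). u \<cdot> x = s})"
  have lifts_rel: "lifts u' \<noteq> {}" if uu: "(u, u') \<in> sub_rel C" and x: "x \<in> lifts u" for u u' x
  proof -
    obtain w where w: "mono_arr C u" "mono_arr C u'" "iso_arr C w" "Dom C w = Dom C u" "Cod C w = Dom C u'"
      "u' \<cdot> w = u" "Cod C u = Cod C u'" using uu by (rule sub_relE)
    have "u' \<cdot> (w \<cdot> x) = u \<cdot> x"
      by (rule reassoc[OF w(6)]) (use w x in \<open>simp_all add: lifts_def\<close>)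
    then have "w \<cdot> x \<in> lifts u'" using w(3-5) x by (simp add: lifts_def)
    then show ?thesis by blast
  qed
  define t where "t = (\<lambda>V. SOME x. x \<in> lifts (v V))"
  define A where "A = {V \<in> ?Sub. lifts (v V) \<noteq> {}}"
  have t: "t V \<in> Arr C" "Dom C (t V) = ?S" "Cod C (t V) = Dom C (v V)" "v V \<cdot> t V = s"
    "mono_arr C (t V)" if V: "V \<in> A" for V
  proof -
    have "t V \<in> lifts (v V)" unfolding t_def using V by (auto simp: A_def intro: someI simp del: in_Hom)
    then show *: "t V \<in> Arr C" "Dom C (t V) = ?S" "Cod C (t V) = Dom C (v V)" "v V \<cdot> t V = s"
      by (simp_all add: lifts_def)
    have "V \<in> ?Sub" using V by (simp add: A_def)
    then show "mono_arr C (t V)" using mono_of_comp[of "v V" "t V"] * s v by simp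
  qed
  let ?R = "\<lambda>V. retractions (t V)"
  \<comment> \<open>A subobject V and a retraction of V onto S go to the kernel of the retraction, a
    complement of S in V, viewed as a subobject of K.\<close>
  define \<phi> where "\<phi> = (\<lambda>(V, r). sub_rel C `` {v V \<cdot> kernel_of r})"
  have kr: "r \<in> Arr C" "Dom C r = Dom C (v V)" "Cod C r = ?S" "r \<cdot> t V = Id C ?S"
    "is_kernel C (kernel_of r) r" "kernel_of r \<in> Arr C" "Cod C (kernel_of r) = Dom C (v V)"
    "r \<cdot> kernel_of r = Zero C (Dom C (kernel_of r)) ?S"
    "mono_arr C (v V \<cdot> kernel_of r)"
    if "V \<in> A" "r \<in> ?R V" for V r
  proof -
    show *: "r \<in> Arr C" "Dom C r = Dom C (v V)" "Cod C r = ?S" "r \<cdot> t V = Id C ?S"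
      using retractionsD[OF that(2)] t[OF that(1)] by simp_all
    then show k: "is_kernel C (kernel_of r) r" using kernel_of by blast
    note kk = kernelD[OF k]
    show **: "kernel_of r \<in> Arr C" "Cod C (kernel_of r) = Dom C (v V)"
      "r \<cdot> kernel_of r = Zero C (Dom C (kernel_of r)) ?S"
      using kk * by simp_all
    have "V \<in> ?Sub" using that by (simp add: A_def)
    then show "mono_arr C (v V \<cdot> kernel_of r)"
      using mono_comp[OF kernel_mono[OF k] v(1)] ** by simp
  qed
  have AS: "V \<in> ?Sub" if "V \<in> A" for V using that by (simp add: A_def)
  have nS: "\<not> zero_obj C ?S" and oS: "?S \<in> Obj C" using s by (simp_all add: simple_obj_def)
  have bij: "bij_betw \<phi> (Sigma A ?R) (?Sub - A)"
  proof (rule bij_betw_imageI)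
    show "inj_on \<phi> (Sigma A ?R)"
    proof (rule inj_onI, clarify)
      fix V r V' r'
      assume V: "V \<in> A" "r \<in> ?R V" and V': "V' \<in> A" "r' \<in> ?R V'" and e: "\<phi> (V, r) = \<phi> (V', r')"
      \<comment> \<open>V is recovered as the sum of Ker r and S: if the kernels agree, both
        summands of V lie in V'. Exchanging the roles gives V = V'.\<close>
      have le: "\<exists>a. a \<in> Arr C \<and> Dom C a = Dom C (v V) \<and> Cod C a = Dom C (v V') \<and> v V' \<cdot> a = v V"
        if V: "V \<in> A" "r \<in> ?R V" and V': "V' \<in> A" "r' \<in> ?R V'" and e: "\<phi> (V, r) = \<phi> (V', r')" for V r V' r'
      proof -
        note k = kr[OF V] and k' = kr[OF V'] and tt = t[OF V(1)] and tt' = t[OF V'(1)]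
          and vv = v[OF AS[OF V(1)]] and vv' = v[OF AS[OF V'(1)]]
        have "(v V \<cdot> kernel_of r, v V' \<cdot> kernel_of r') \<in> sub_rel C"
          using e sub_rel_class_eq_iff k k' by (simp add: \<phi>_def)
        then obtain w where w: "iso_arr C w" "Dom C w = Dom C (kernel_of r)" "Cod C w = Dom C (kernel_of r')"
          "v V' \<cdot> (kernel_of r' \<cdot> w) = v V \<cdot> kernel_of r"
          using k(6,7) k'(6,7) vv(2) vv'(2) by (elim sub_relE) simp
        obtain p where p: "p \<in> Arr C" "Dom C p = Dom C r" "Cod C p = Dom C (kernel_of r)"
          "Add C (kernel_of r \<cdot> p) (t V \<cdot> r) = Id C (Dom C r)"
          using split_complement[OF tt(1) k(1) _ _ _ k(5)] tt k by metis
        have "v V = Add C (v V \<cdot> kernel_of r \<cdot> p) (v V \<cdot> t V \<cdot> r)"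
          by (rule retraction_decomp) (use p k tt vv in simp_all)
        also have "v V \<cdot> t V = v V' \<cdot> t V'" using tt tt' by simp
        also have "Add C (v V \<cdot> kernel_of r \<cdot> p) (v V' \<cdot> t V' \<cdot> r) =
            v V' \<cdot> Add C (kernel_of r' \<cdot> w \<cdot> p) (t V' \<cdot> r)"
          unfolding w(4)[symmetric]
          using p(1-3) k(1-3,6,7) k'(6,7) tt(1-3) tt'(1-3) vv(2,3) vv'(2,3) w(1-3) by simp
        finally have e1: "v V = v V' \<cdot> Add C (kernel_of r' \<cdot> w \<cdot> p) (t V' \<cdot> r)" .
        let ?a = "Add C (kernel_of r' \<cdot> w \<cdot> p) (t V' \<cdot> r)"
        have "?a \<in> Arr C" "Dom C ?a = Dom C (v V)" "Cod C ?a = Dom C (v V')"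
          using p(1-3) k(1-3,6,7) k'(6,7) tt(1-3) tt'(1-3) vv(2,3) vv'(2,3) w(1-3) by simp_all
        with e1[symmetric] show ?thesis by blast
      qed
      obtain a where a: "a \<in> Arr C" "Dom C a = Dom C (v V)" "Cod C a = Dom C (v V')" "v V' \<cdot> a = v V"
        using le[OF V V' e] by blast
      obtain b where b: "b \<in> Arr C" "Dom C b = Dom C (v V')" "Cod C b = Dom C (v V)" "v V \<cdot> b = v V'"
        using le[OF V' V e[symmetric]] by blast
      have "(v V, v V') \<in> sub_rel C"
        using sub_relI[OF v(1)[OF AS[OF V(1)]] v(1)[OF AS[OF V'(1)]] a b] .
      then have VV: "V = V'"
        using sub_rel_class_eq_iff v[OF AS[OF V(1)]] v[OF AS[OF V'(1)]] by metis
      note k = kr[OF V] and k' = kr[OF V'[folded VV]] and tt = t[OF V(1)] and vv = v[OF AS[OF V(1)]]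
      have "(v V \<cdot> kernel_of r, v V \<cdot> kernel_of r') \<in> sub_rel C"
        using e sub_rel_class_eq_iff k k' VV by (simp add: \<phi>_def)
      then obtain w where w: "iso_arr C w" "Dom C w = Dom C (kernel_of r)" "Cod C w = Dom C (kernel_of r')"
        "v V \<cdot> (kernel_of r' \<cdot> w) = v V \<cdot> kernel_of r"
        using k(6,7) k'(6,7) vv(2) by (elim sub_relE) simp
      have kw: "kernel_of r' \<cdot> w = kernel_of r"
        by (rule mono_cancel[OF vv(1)]) (use w k(6,7) k'(6,7) in simp_all)
      \<comment> \<open>Both retractions vanish on the same kernel and agree on S, so they are
        equal.\<close>
      have "r' \<cdot> kernel_of r = r' \<cdot> kernel_of r' \<cdot> w"
        unfolding kw[symmetric] using w k'(1,2,6,7) by simp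
      also have "\<dots> = Zero C (Dom C (kernel_of r)) ?S" unfolding k'(8) using w(1-3) oS by simp
      finally have z: "r' \<cdot> kernel_of r = Zero C (Dom C (kernel_of r)) ?S" .
      have "inj_on (\<lambda>r'. r' \<cdot> kernel_of r) (retractions (t V))"
        using bij_retractions[OF tt(1) V(2) k(5)] by (simp add: bij_betw_def)
      moreover have "r \<cdot> kernel_of r = r' \<cdot> kernel_of r" using z k(8) by simp
      moreover have "r \<in> retractions (t V)" "r' \<in> retractions (t V)" using V V' VV by simp_all
      ultimately have "r = r'" by (rule inj_onD)
      with VV show "V = V' \<and> r = r'" by blast
    qed
    show "\<phi> ` Sigma A ?R = ?Sub - A"
    proof (intro subset_antisym subsetI)
      fix U assume "U \<in> \<phi> ` Sigma A ?R"
      then obtain V r where V: "V \<in> A" "r \<in> ?R V" and U: "U = sub_rel C `` {v V \<cdot> kernel_of r}"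
        by (auto simp: \<phi>_def)
      note k = kr[OF V] and tt = t[OF V(1)] and vv = v[OF AS[OF V(1)]]
      have US: "U \<in> ?Sub" using subobjectI[OF k(9)] U k vv by simp
      \<comment> \<open>If Ker r contained S, the identity of S, which is r composed with the
        inclusion of S, would be zero.\<close>
      have "lifts (v V \<cdot> kernel_of r) = {}"
      proof (rule ccontr)
        assume "lifts (v V \<cdot> kernel_of r) \<noteq> {}"
        then obtain x where x: "x \<in> Arr C" "Dom C x = ?S" "Cod C x = Dom C (kernel_of r)"
          "v V \<cdot> kernel_of r \<cdot> x = s" using k vv by (auto simp: lifts_def)
        have "kernel_of r \<cdot> x = t V"
          by (rule mono_cancel[OF vv(1)]) (use x k vv tt in simp_all)
        then have "Id C ?S = r \<cdot> (kernel_of r \<cdot> x)" using k by simp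
        also have "\<dots> = Zero C ?S ?S" using x(1-3) k oS by (simp add: reassoc[OF k(8)])
        finally show False using nS oS by (simp add: zero_obj_iff)
      qed
      moreover have "(v U, v V \<cdot> kernel_of r) \<in> sub_rel C"
        using v[OF US] U k(9) sub_rel_class_eq_iff by metis
      ultimately have "lifts (v U) = {}" using lifts_rel by blast
      then show "U \<in> ?Sub - A" using US by (simp add: A_def)
    next
      fix U assume U: "U \<in> ?Sub - A"
      then have US: "U \<in> ?Sub" and Ul: "lifts (v U) = {}" by (auto simp: A_def)
      note u = v[OF US]
      let ?u = "v U"
      have oU: "Dom C ?u \<in> Obj C" using u by simp
      obtain M i j p q where bp: "M \<in> Obj C" "i \<in> Hom C (Dom C ?u) M" "j \<in> Hom C ?S M"
        "p \<in> Hom C M (Dom C ?u)" "q \<in> Hom C M ?S"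
        "p \<cdot> i = Id C (Dom C ?u)" "q \<cdot> j = Id C ?S" "p \<cdot> j = Zero C ?S (Dom C ?u)" "q \<cdot> i = Zero C (Dom C ?u) ?S"
        "Add C (i \<cdot> p) (j \<cdot> q) = Id C M" using ex_biproduct[OF oU oS] .
      have bp': "i \<in> Arr C" "Dom C i = Dom C ?u" "Cod C i = M" "j \<in> Arr C" "Dom C j = ?S" "Cod C j = M"
        "p \<in> Arr C" "Dom C p = M" "Cod C p = Dom C ?u" "q \<in> Arr C" "Dom C q = M" "Cod C q = ?S"
        using bp(2-5) by auto
      \<comment> \<open>The map U \<oplus> S \<rightarrow> K given by the two inclusions. It is mono
        because U does not contain S, and V is the subobject it defines.\<close>
      let ?b = "Add C (?u \<cdot> p) (s \<cdot> q)"
      have sA: "s \<in> Arr C" using s by simp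
      have bA: "?b \<in> Arr C" "Dom C ?b = M" "Cod C ?b = ?K" using bp' u sA by simp_all
      have bm: "mono_arr C ?b"
      proof (rule monoI[OF bA(1)])
        fix g assume g: "g \<in> Arr C" "Cod C g = Dom C ?b" "?b \<cdot> g = Zero C (Dom C g) (Cod C ?b)"
        have gM: "Cod C g = M" using g bA by simp
        have z: "Add C (?u \<cdot> (p \<cdot> g)) (s \<cdot> (q \<cdot> g)) = Zero C (Dom C g) ?K"
          using g(3) g(1) gM bp' u sA by simp
        have n: "\<And>x. \<lbrakk>x \<in> Arr C; Dom C x = ?S; Cod C x = Dom C ?u\<rbrakk> \<Longrightarrow> ?u \<cdot> x \<noteq> s"
          using Ul by (auto simp: lifts_def)
        have c: "p \<cdot> g \<in> Arr C" "Cod C (p \<cdot> g) = Dom C ?u" "q \<cdot> g \<in> Arr C" "Cod C (q \<cdot> g) = ?S"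
          "Dom C (q \<cdot> g) = Dom C (p \<cdot> g)" "Dom C (p \<cdot> g) = Dom C g"
          using g(1) gM bp' by simp_all
        have z': "Add C (?u \<cdot> (p \<cdot> g)) (s \<cdot> (q \<cdot> g)) = Zero C (Dom C (p \<cdot> g)) (Cod C ?u)"
          using z c(6) u(3) by simp
        note d = disjoint_sum_mono[OF u(1) s u(3)[symmetric] n c(1-5) z', unfolded c(6)]
        have pg: "p \<cdot> g = Zero C (Dom C g) (Dom C ?u)" by (rule d(1))
        have qg: "q \<cdot> g = Zero C (Dom C g) ?S" by (rule d(2))
        have "g = Add C (i \<cdot> p) (j \<cdot> q) \<cdot> g" unfolding bp(10) using g gM by simp
        also have "\<dots> = Add C (i \<cdot> (p \<cdot> g)) (j \<cdot> (q \<cdot> g))" using g(1) gM bp' by simp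
        also have "\<dots> = Zero C (Dom C g) M" unfolding pg qg using g(1) gM bp' bp(1) oU oS by simp
        finally show "g = Zero C (Dom C g) (Dom C ?b)" using bA by simp
      qed
      define V where "V = sub_rel C `` {?b}"
      have VS: "V \<in> ?Sub" using subobjectI[OF bm] bA by (simp add: V_def)
      note vv = v[OF VS]
      have "(?b, v V) \<in> sub_rel C" using vv(5) by (simp add: V_def)
      then obtain w where w: "iso_arr C w" "Dom C w = M" "Cod C w = Dom C (v V)" "v V \<cdot> w = ?b"
        using bA by (metis sub_relE)
      obtain w' where w': "w \<in> Arr C" "w' \<in> Arr C" "Dom C w' = Cod C w" "Cod C w' = Dom C w"
        "w' \<cdot> w = Id C (Dom C w)" "w \<cdot> w' = Id C (Cod C w)" using isoE[OF w(1)] .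
      have bj: "?b \<cdot> j = s" using bp' u sA bp(1) oU oS by (simp add: bp(7,8))
      have bi: "?b \<cdot> i = ?u" using bp' u sA bp(1) oU oS by (simp add: bp(6,9))
      have vwj: "v V \<cdot> (w \<cdot> j) = s" using reassoc[OF w(4), of j] bj vv(2) w(2,3) w'(1) bp' by simp
      have vwi: "v V \<cdot> (w \<cdot> i) = ?u" using reassoc[OF w(4), of i] bi vv(2) w(2,3) w'(1) bp' by simp
      have "w \<cdot> j \<in> lifts (v V)" using vwj w(2,3) w'(1) bp' by (simp add: lifts_def)
      then have VA: "V \<in> A" using VS by (auto simp: A_def)
      note tt = t[OF VA]
      \<comment> \<open>The inclusion of S into V is the second coordinate inclusion, so the second
        projection is a retraction of it with kernel U.\<close>
      have tj: "t V = w \<cdot> j"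
        by (rule mono_cancel[OF vv(1)]) (use tt(1-4) vwj w(2,3) w'(1) bp' in simp_all)
      let ?r = "q \<cdot> w'"
      have "?r \<cdot> t V = q \<cdot> (w' \<cdot> w \<cdot> j)" unfolding tj using w(2,3) w'(1-4) bp' by simp
      also have "\<dots> = Id C ?S" unfolding w'(5) using w(2) bp' bp(7) by simp
      finally have r: "?r \<in> ?R V"
        unfolding retractions_def using tt(1-3) w(2,3) w'(1-4) bp' by simp
      have k1: "is_kernel C (w \<cdot> i) ?r"
        by (rule kernel_of_transported_projection[OF w'(1,2) w(2) w'(3) _ _ w'(6) bp(2-6) bp(9,10)])
          (use w(2) w'(4,5) in simp_all)
      note k = kr[OF VA r]
      obtain x where x: "iso_arr C x" "Dom C x = Dom C (w \<cdot> i)" "Cod C x = Dom C (kernel_of ?r)"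
        "kernel_of ?r \<cdot> x = w \<cdot> i" using kernel_unique[OF k(5) k1] .
      have dwi: "Dom C (w \<cdot> i) = Dom C ?u" using w(2,3) w'(1) bp' by simp
      have "v V \<cdot> kernel_of ?r \<cdot> x = v V \<cdot> (kernel_of ?r \<cdot> x)"
        by (rule assoc) (use x(1,3) k(6,7) vv(2) in simp_all)
      then have "v V \<cdot> kernel_of ?r \<cdot> x = ?u" using x(4) vwi by simp
      then have "(?u, v V \<cdot> kernel_of ?r) \<in> sub_rel C"
        by (intro sub_relI_iso[OF u(1) k(9) x(1)]) (use x(2,3) dwi k(6,7) vv(2) in simp_all)
      then have "\<phi> (V, ?r) = sub_rel C `` {?u}"
        unfolding \<phi>_def using iffD2[OF sub_rel_class_eq_iff[OF u(1) k(9)]] by simp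
      then have "U = \<phi> (V, ?r)" using u(4) by (rule trans[OF _ sym, rotated])
      then show "U \<in> \<phi> ` Sigma A ?R" using VA r by blast
    qed
  qed
  have finA: "finite A" using finS by (simp add: A_def)
  have finR: "finite (?R V)" if "V \<in> A" for V
    using finite_retractions[OF t(1)[OF that] fin] .
  \<comment> \<open>The subobjects that do not contain S are grouped by V = U + S.\<close>
  have "(\<Sum>U\<in>?Sub - A. c (sub_class U)) = (\<Sum>x\<in>Sigma A ?R. c (sub_class (\<phi> x)))"
    by (rule sum.reindex_bij_betw[OF bij, symmetric])
  also have "\<dots> = (\<Sum>V\<in>A. \<Sum>r\<in>?R V. c (sub_class (\<phi> (V, r))))"
    using finA finR by (simp add: sum.Sigma)
  also have "\<dots> = (\<Sum>V\<in>A. - c (sub_class V))"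
  proof (rule sum.cong[OF refl])
    fix V assume V: "V \<in> A"
    note tt = t[OF V] and vv = v[OF AS[OF V]]
    have sV: "sub_class V = iso_class C (Cod C (t V))"
      using class_of_mono(1)[OF vv(1)] vv(4) tt by simp
    have "sub_class (\<phi> (V, r)) = iso_class C (Dom C (kernel_of r))" if "r \<in> ?R V" for r
      using class_of_mono(1)[OF kr(9)[OF V that]] kr[OF V that] vv by (simp add: \<phi>_def)
    then have "(\<Sum>r\<in>?R V. c (sub_class (\<phi> (V, r)))) = (\<Sum>r\<in>?R V. c (iso_class C (Dom C (kernel_of r))))"
      by (intro sum.cong refl) simp
    also have "\<dots> = - c (iso_class C (Cod C (t V)))"
    proof (rule retraction_sum[OF tt(5) _ fin])
      show 1: "simple_obj C (Dom C (t V))" using s tt by simp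
      show "c (iso_class C (Cod C (t V))) = - of_nat (card (Hom C (Dom C k) (Dom C (t V)))) * c (iso_class C (Dom C k))"
        if "r \<in> ?R V" "is_kernel C k r" for k r using split[OF 1 tt(1) that] .
      show "c (iso_class C (Cod C (t V))) = 0" if "?R V = {}" using nonsplit[OF tt(5) 1 that] .
    qed
    finally show "(\<Sum>r\<in>?R V. c (sub_class (\<phi> (V, r)))) = - c (sub_class V)" using sV by simp
  qed
  finally have "(\<Sum>U\<in>?Sub - A. c (sub_class U)) = - (\<Sum>V\<in>A. c (sub_class V))"
    by (simp add: sum_negf)
  moreover have "(\<Sum>U\<in>?Sub. c (sub_class U)) = (\<Sum>U\<in>?Sub - A. c (sub_class U)) + (\<Sum>U\<in>A. c (sub_class U))"
    by (rule sum.subset_diff) (use finS in \<open>auto simp: A_def\<close>)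
  ultimately show ?thesis by simp
qed

end

section \<open>Semisimple objects\<close>

text \<open>Arbitrary finite index sets in place of initial segments, so that summands can be
  removed or added without renumbering.\<close>

definition biproduct ::
  "('o, 'm, 'x) preadditive_scheme \<Rightarrow> nat set \<Rightarrow> (nat \<Rightarrow> 'o) \<Rightarrow> 'o \<Rightarrow> (nat \<Rightarrow> 'm) \<Rightarrow> (nat \<Rightarrow> 'm) \<Rightarrow> bool"
  where
  "biproduct C I S M i p \<longleftrightarrow>
    M \<in> Obj C \<and> finite I \<and>
    (\<forall>k\<in>I. i k \<in> Hom C (S k) M \<and> p k \<in> Hom C M (S k)) \<and>
    (\<forall>j\<in>I. \<forall>k\<in>I. p j \<cdot>\<^bsub>C\<^esub> i k = (if j = k then Id C (S k) else Zero C (S k) (S j))) \<and>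
    finprod (Hom_group C M M) (\<lambda>k. i k \<cdot>\<^bsub>C\<^esub> p k) I = Id C M"

lemma direct_sum_biproduct: "direct_sum C n S M i p \<longleftrightarrow> biproduct C {..<n} S M i p"
  by (auto simp: direct_sum_def biproduct_def)

lemma semisimple_opposite_iff:
  "(\<And>S. simple_obj (opposite C) S \<longleftrightarrow> simple_obj C S) \<Longrightarrow>
    semisimple_obj (opposite C) M \<longleftrightarrow> semisimple_obj C M"
  by (auto simp: semisimple_obj_def direct_sum_opposite)

lemmas (in preadditive_category)
  finprod_Hom_Comp = preadditive_category.Comp_finprod_Hom[OF preadditive_opposite, unfolded Hom_opposite Hom_group_opposite opposite_simps]

context preadditive_category
begin

lemma biproductD:
  assumes "biproduct C I S M i p"
  shows "M \<in> Obj C" "finite I"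
    "k \<in> I \<Longrightarrow> i k \<in> Arr C" "k \<in> I \<Longrightarrow> Dom C (i k) = S k" "k \<in> I \<Longrightarrow> Cod C (i k) = M"
    "k \<in> I \<Longrightarrow> p k \<in> Arr C" "k \<in> I \<Longrightarrow> Dom C (p k) = M" "k \<in> I \<Longrightarrow> Cod C (p k) = S k"
    "\<lbrakk>j \<in> I; k \<in> I\<rbrakk> \<Longrightarrow> p j \<cdot> i k = (if j = k then Id C (S k) else Zero C (S k) (S j))"
    "finprod (Hom_group C M M) (\<lambda>k. i k \<cdot> p k) I = Id C M"
    "k \<in> I \<Longrightarrow> S k \<in> Obj C"
  using assms Dom_in_Obj[of "i k"] by (auto simp: biproduct_def)

lemma semisimple_iff:
  "semisimple_obj C M \<longleftrightarrow> (\<exists>I S i p. biproduct C I S M i p \<and> (\<forall>k\<in>I. simple_obj C (S k)))"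
proof
  assume "semisimple_obj C M"
  then obtain n S i p where "\<forall>k<n. simple_obj C (S k)" "direct_sum C n S M i p"
    by (auto simp: semisimple_obj_def)
  then show "\<exists>I S i p. biproduct C I S M i p \<and> (\<forall>k\<in>I. simple_obj C (S k))"
    unfolding direct_sum_biproduct by (meson lessThan_iff)
next
  assume "\<exists>I S i p. biproduct C I S M i p \<and> (\<forall>k\<in>I. simple_obj C (S k))"
  then obtain I S i p where b: "biproduct C I S M i p" and s: "\<forall>k\<in>I. simple_obj C (S k)" by blast
  note b' = biproductD[OF b]
  obtain h where h: "bij_betw h {..<card I} I"
    using ex_bij_betw_nat_finite[OF b'(2)] by (auto simp: atLeast0LessThan)
  then have hI: "h k \<in> I" if "k < card I" for k using that bij_betwE by blast
  have inj: "h j = h k \<longleftrightarrow> j = k" if "j < card I" "k < card I" for j k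
    using h that by (auto simp: bij_betw_def inj_on_def)
  interpret comm_group "Hom_group C M M" using b' by (intro comm_group_Hom)
  have "finprod (Hom_group C M M) (\<lambda>k. i k \<cdot> p k) (h ` {..<card I}) =
    finprod (Hom_group C M M) (\<lambda>k. i (h k) \<cdot> p (h k)) {..<card I}"
  proof (rule finprod_reindex)
    show "(\<lambda>k. i k \<cdot> p k) \<in> h ` {..<card I} \<rightarrow> carrier (Hom_group C M M)"
      using b' hI by auto
    show "inj_on h {..<card I}" using h by (simp add: bij_betw_def)
  qed
  then have "finprod (Hom_group C M M) (\<lambda>k. i (h k) \<cdot> p (h k)) {..<card I} = Id C M"
    using h b'(10) by (simp add: bij_betw_def)
  then have "direct_sum C (card I) (S \<circ> h) M (i \<circ> h) (p \<circ> h)"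
    unfolding direct_sum_def using b' hI inj by simp
  moreover have "\<forall>k<card I. simple_obj C ((S \<circ> h) k)" using s hI by simp
  ultimately show "semisimple_obj C M" unfolding semisimple_obj_def by blast
qed

lemma biproduct_iso:
  assumes b: "biproduct C I S M i p" and w: "iso_arr C w" "Dom C w = M"
  obtains i' p' where "biproduct C I S (Cod C w) i' p'"
proof -
  obtain v where v: "w \<in> Arr C" "v \<in> Arr C" "Dom C v = Cod C w" "Cod C v = Dom C w"
    "v \<cdot> w = Id C (Dom C w)" "w \<cdot> v = Id C (Cod C w)" using isoE[OF w(1)] .
  note b' = biproductD[OF b]
  let ?N = "Cod C w"
  have N: "?N \<in> Obj C" using v by simp
  have vM: "Cod C v = M" "v \<cdot> w = Id C M" using v(4,5) w(2) by simp_all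
  have "finprod (Hom_group C ?N ?N) (\<lambda>k. (w \<cdot> i k) \<cdot> (p k \<cdot> v)) I =
      finprod (Hom_group C ?N ?N) (\<lambda>k. w \<cdot> ((i k \<cdot> p k) \<cdot> v)) I"
    by (rule finprod_Hom_cong[OF N N]) (use b' v(1-3) vM(1) w(2) in simp_all)
  also have "\<dots> = w \<cdot> finprod (Hom_group C ?N M) (\<lambda>k. (i k \<cdot> p k) \<cdot> v) I"
    by (rule Comp_finprod_Hom[symmetric, OF b'(2)]) (use b' v(1-3) vM(1) w(2) N in simp_all)
  also have "finprod (Hom_group C ?N M) (\<lambda>k. (i k \<cdot> p k) \<cdot> v) I =
      finprod (Hom_group C M M) (\<lambda>k. i k \<cdot> p k) I \<cdot> v"
    by (rule finprod_Hom_Comp[symmetric, OF b'(2)]) (use b' v(1-3) vM(1) w(2) N in simp_all)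
  also have "w \<cdot> (finprod (Hom_group C M M) (\<lambda>k. i k \<cdot> p k) I \<cdot> v) = Id C ?N"
    unfolding b'(10) using v(1-3,6) vM(1) by simp
  finally have f: "finprod (Hom_group C ?N ?N) (\<lambda>k. (w \<cdot> i k) \<cdot> (p k \<cdot> v)) I = Id C ?N" .
  have "(p j \<cdot> v) \<cdot> (w \<cdot> i k) = p j \<cdot> i k" if "j \<in> I" "k \<in> I" for j k
    using that b'(3-8) v(1-3) vM(1) w(2) by (simp add: reassoc[OF vM(2)])
  then have "biproduct C I S ?N (\<lambda>k. w \<cdot> i k) (\<lambda>k. p k \<cdot> v)"
    unfolding biproduct_def using f b' v(1-3) vM(1) w(2) N by simp
  then show thesis by (rule that)
qed

lemma semisimple_iso: "\<lbrakk>semisimple_obj C M; isomorphic C M N\<rbrakk> \<Longrightarrow> semisimple_obj C N"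
  unfolding semisimple_iff isomorphic_def using biproduct_iso by (metis in_Hom)

text \<open>Identifies a complement of \<open>s\<close> with the quotient by \<open>s\<close>; hence
  all complements of \<open>s\<close> are isomorphic.\<close>

lemma split_cokernel:
  assumes "s \<in> Arr C" "r \<in> Arr C" "Cod C s = Dom C r" "Cod C r = Dom C s"
    "p \<in> Arr C" "k \<in> Arr C" "Dom C p = Dom C r" "Cod C k = Dom C r" "Cod C p = Dom C k"
    "p \<cdot> k = Id C (Dom C k)" "p \<cdot> s = Zero C (Dom C s) (Dom C k)"
    "Add C (k \<cdot> p) (s \<cdot> r) = Id C (Dom C r)"
  shows "is_cokernel C p s"
proof (rule cokernelI)
  show "epi_arr C p" by (rule split_epi[of p k]) (use assms in simp_all)
  show "p \<cdot> s = Zero C (Dom C s) (Cod C p)" using assms(9,11) by simp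
  fix h assume h: "h \<in> Arr C" "Dom C h = Cod C s" "h \<cdot> s = Zero C (Dom C s) (Cod C h)"
  have hd: "Dom C h = Dom C r" using h(2) assms(3) by simp
  have "h = Add C (h \<cdot> k \<cdot> p) (h \<cdot> s \<cdot> r)"
    by (rule retraction_decomp) (use h(1) hd assms in simp_all)
  also have "\<dots> = h \<cdot> k \<cdot> p"
    unfolding h(3) using h(1) hd assms(1-9) Dom_in_Obj[of s] Cod_in_Obj[of h] by simp
  finally have e: "h \<cdot> k \<cdot> p = h" by (rule sym)
  have "h \<cdot> k \<in> Arr C" "Cod C (h \<cdot> k) = Cod C h" "Dom C (h \<cdot> k) = Cod C p"
    using h(1) hd assms by simp_all
  with e show "\<exists>u. u \<in> Arr C \<and> Cod C u = Cod C h \<and> Dom C u = Cod C p \<and> u \<cdot> p = h" by blast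
qed (use assms in simp_all)

text \<open>The decomposition of the identity makes f \<mapsto> (f k, f s) bijective, with inverse
  (a, b) \<mapsto> a p + b r.\<close>

lemma card_Hom_split:
  assumes s: "s \<in> Arr C" and r: "r \<in> retractions s" and k: "is_kernel C k r" and T: "T \<in> Obj C"
  shows "card (Hom C (Cod C s) T) = card (Hom C (Dom C k) T) * card (Hom C (Dom C s) T)"
proof -
  note rr = retractionsD[OF r] and kk = kernelD[OF k]
  obtain p where p: "p \<in> Arr C" "Dom C p = Dom C r" "Cod C p = Dom C k"
    "p \<cdot> k = Id C (Dom C k)" "p \<cdot> s = Zero C (Dom C s) (Dom C k)"
    "Add C (k \<cdot> p) (s \<cdot> r) = Id C (Dom C r)"
    using split_complement[OF s rr(1) rr(2)[symmetric] rr(3) rr(4) k] .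
  have rk: "r \<cdot> k = Zero C (Dom C k) (Dom C s)" using kk rr by simp
  have o: "Dom C s \<in> Obj C" "Dom C k \<in> Obj C" using s kk by simp_all
  have "bij_betw (\<lambda>f. (f \<cdot> k, f \<cdot> s)) (Hom C (Cod C s) T) (Hom C (Dom C k) T \<times> Hom C (Dom C s) T)"
  proof (rule bij_betwI[of _ _ _ "\<lambda>(a, b). Add C (a \<cdot> p) (b \<cdot> r)"])
    show "(\<lambda>f. (f \<cdot> k, f \<cdot> s)) \<in> Hom C (Cod C s) T \<rightarrow> Hom C (Dom C k) T \<times> Hom C (Dom C s) T"
      using kk rr s by auto
    show "(\<lambda>(a, b). Add C (a \<cdot> p) (b \<cdot> r)) \<in> Hom C (Dom C k) T \<times> Hom C (Dom C s) T \<rightarrow> Hom C (Cod C s) T"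
      using p(1-3) rr(1-3) by auto
    show "(\<lambda>(a, b). Add C (a \<cdot> p) (b \<cdot> r)) (f \<cdot> k, f \<cdot> s) = f" if "f \<in> Hom C (Cod C s) T" for f
    proof -
      have "f = Add C (f \<cdot> k \<cdot> p) (f \<cdot> s \<cdot> r)"
        by (rule retraction_decomp) (use that p kk rr s in simp_all)
      then show ?thesis by simp
    qed
    show "(\<lambda>f. (f \<cdot> k, f \<cdot> s)) ((\<lambda>(a, b). Add C (a \<cdot> p) (b \<cdot> r)) ab) = ab"
      if "ab \<in> Hom C (Dom C k) T \<times> Hom C (Dom C s) T" for ab
    proof -
      obtain a b where ab: "ab = (a, b)" "a \<in> Hom C (Dom C k) T" "b \<in> Hom C (Dom C s) T" using \<open>ab \<in> _\<close> by blast
      have "Add C (a \<cdot> p) (b \<cdot> r) \<cdot> k = a"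
        using ab(2,3) p(1-3) rr(1-3) kk(1,3) T o by (simp add: p(4) rk)
      moreover have "Add C (a \<cdot> p) (b \<cdot> r) \<cdot> s = b"
        using ab(2,3) p(1-3) rr(1-3) s T o by (simp add: p(5) rr(4))
      ultimately show ?thesis using ab(1) by simp
    qed
  qed
  from bij_betw_same_card[OF this] show ?thesis by (simp add: card_cartesian_product)
qed

lemma card_Hom_iso:
  assumes "isomorphic C X X'" "Y \<in> Obj C" shows "card (Hom C X Y) = card (Hom C X' Y)"
proof -
  obtain w where w: "iso_arr C w" "Dom C w = X'" "Cod C w = X"
    using isomorphic_sym[OF assms(1)] by (auto simp: isomorphic_def)
  obtain v where v: "w \<in> Arr C" "v \<in> Arr C" "Dom C v = Cod C w" "Cod C v = Dom C w"
    "v \<cdot> w = Id C (Dom C w)" "w \<cdot> v = Id C (Cod C w)" using isoE[OF w(1)] .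
  have v': "Dom C v = X" "Cod C v = X'" "v \<cdot> w = Id C X'" "w \<cdot> v = Id C X" using v w by simp_all
  have "bij_betw (\<lambda>f. f \<cdot> w) (Hom C X Y) (Hom C X' Y)"
    by (rule bij_betwI[of _ _ _ "\<lambda>f. f \<cdot> v"]) (use v(1,2) v' w(2,3) in auto)
  then show ?thesis by (rule bij_betw_same_card)
qed

lemma Hom_from_zero_obj: "\<lbrakk>zero_obj C X; Y \<in> Obj C\<rbrakk> \<Longrightarrow> Hom C X Y = {Zero C X Y}"
  using from_zero_obj zero_obj_Obj by auto

end

context abelian_category
begin

text \<open>The remaining inclusions are killed by \<open>p j\<close>, so they lift to Ker (p j).
  That the remaining terms sum to the identity can be tested after composing with the mono
  \<open>k\<close>, where term \<open>j\<close> vanishes.\<close>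

lemma biproduct_remove:
  assumes b: "biproduct C I S M i p" and j: "j \<in> I" and k: "is_kernel C k (p j)"
  obtains i' p' where "biproduct C (I - {j}) S (Dom C k) i' p'"
proof -
  note b' = biproductD[OF b] and kk = kernelD[OF k] and km = kernel_mono[OF k]
  let ?U = "Dom C k" and ?J = "I - {j}"
  have kc: "Cod C k = M" using kk b' j by simp
  have U: "?U \<in> Obj C" using kk by simp
  have "\<exists>a. a \<in> Arr C \<and> Dom C a = S l \<and> Cod C a = ?U \<and> k \<cdot> a = i l" if l: "l \<in> ?J" for l
  proof -
    have l': "l \<in> I" "l \<noteq> j" using l by auto
    have z: "p j \<cdot> i l = Zero C (Dom C (i l)) (Cod C (p j))"
      using b'(9)[OF j l'(1)] b'(4)[OF l'(1)] b'(8)[OF j] l'(2) by simp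
    obtain u where "u \<in> Arr C" "Dom C u = Dom C (i l)" "Cod C u = ?U" "k \<cdot> u = i l"
      using kernel_factor[OF k b'(3)[OF l'(1)] _ z] b'(5)[OF l'(1)] b'(7)[OF j] by auto
    then show ?thesis using b'(4)[OF l'(1)] by auto
  qed
  then obtain i' where i': "i' l \<in> Arr C" "Dom C (i' l) = S l" "Cod C (i' l) = ?U" "k \<cdot> i' l = i l"
    if "l \<in> ?J" for l by metis
  let ?p = "\<lambda>l. p l \<cdot> k"
  have pd: "?p l \<in> Arr C" "Dom C (?p l) = ?U" "Cod C (?p l) = S l" if "l \<in> I" for l
    using that b' kk(1) kc by simp_all
  have pi: "?p m \<cdot> i' l = (if m = l then Id C (S l) else Zero C (S l) (S m))" if "m \<in> ?J" "l \<in> ?J" for m l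
  proof -
    have "?p m \<cdot> i' l = p m \<cdot> i l" using that i' b' kk(1) kc by simp
    then show ?thesis using b'(9)[of m l] that by simp
  qed
  have "k \<cdot> finprod (Hom_group C ?U ?U) (\<lambda>l. i' l \<cdot> ?p l) ?J =
      finprod (Hom_group C ?U M) (\<lambda>l. k \<cdot> (i' l \<cdot> ?p l)) ?J"
    by (rule Comp_finprod_Hom) (use b'(2) kk(1) kc i' pd U in simp_all)
  also have "\<dots> = finprod (Hom_group C ?U M) (\<lambda>l. (i l \<cdot> p l) \<cdot> k) ?J"
  proof (rule finprod_Hom_cong[OF U b'(1)])
    fix l assume l: "l \<in> ?J"
    have "k \<cdot> (i' l \<cdot> ?p l) = i l \<cdot> ?p l"
      by (rule reassoc[OF i'(4)[OF l]]) (use l i' pd kk(1) in simp_all)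
    then show "k \<cdot> (i' l \<cdot> ?p l) = (i l \<cdot> p l) \<cdot> k" using l b' kk(1) kc by simp
    show "(i l \<cdot> p l) \<cdot> k \<in> Hom C ?U M" using l b' kk(1) kc by simp
  qed
  also have "\<dots> = Add C ((i j \<cdot> p j) \<cdot> k) (finprod (Hom_group C ?U M) (\<lambda>l. (i l \<cdot> p l) \<cdot> k) ?J)"
  proof -
    have "(i j \<cdot> p j) \<cdot> k = i j \<cdot> (p j \<cdot> k)" by (rule assoc) (use b' j kk(1) kc in simp_all)
    also have "\<dots> = Zero C ?U M" unfolding kk(4) using b'(3-8)[OF j] U by simp
    moreover have "finprod (Hom_group C ?U M) (\<lambda>l. (i l \<cdot> p l) \<cdot> k) ?J \<in> Hom C ?U M"
      by (rule finprod_Hom_closed[OF U b'(1)]) (use b' kk(1) kc in simp_all)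
    ultimately show ?thesis by simp
  qed
  also have "\<dots> = finprod (Hom_group C ?U M) (\<lambda>l. (i l \<cdot> p l) \<cdot> k) (insert j ?J)"
    by (rule finprod_Hom_insert[symmetric, OF U b'(1)]) (use b' kk(1) kc j in simp_all)
  also have "insert j ?J = I" using j by blast
  also have "finprod (Hom_group C ?U M) (\<lambda>l. (i l \<cdot> p l) \<cdot> k) I =
      finprod (Hom_group C M M) (\<lambda>l. i l \<cdot> p l) I \<cdot> k"
    by (rule finprod_Hom_Comp[symmetric, OF b'(2)]) (use b' kk(1) kc in simp_all)
  also have "\<dots> = k \<cdot> Id C ?U" unfolding b'(10) using kk(1) kc by simp
  finally have e: "k \<cdot> finprod (Hom_group C ?U ?U) (\<lambda>l. i' l \<cdot> ?p l) ?J = k \<cdot> Id C ?U" .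
  have cl: "finprod (Hom_group C ?U ?U) (\<lambda>l. i' l \<cdot> ?p l) ?J \<in> Hom C ?U ?U"
    by (rule finprod_Hom_closed[OF U U]) (use i' pd in simp_all)
  have "finprod (Hom_group C ?U ?U) (\<lambda>l. i' l \<cdot> ?p l) ?J = Id C ?U"
    by (rule mono_cancel[OF km _ _ _ _ _ e]) (use cl U in simp_all)
  then have "biproduct C ?J S ?U i' ?p"
    unfolding biproduct_def using b'(2) U i' pd pi by simp
  then show thesis by (rule that)
qed

text \<open>The converse of \<open>biproduct_remove\<close>: \<open>s\<close> and \<open>r\<close>
  become the inclusion and projection of index \<open>j\<close>, and the others pass through Ker
  r.\<close>

lemma biproduct_insert:
  assumes b: "biproduct C I S (Dom C k) i p" and j: "j \<notin> I"
    and s: "s \<in> Arr C" and r: "r \<in> retractions s" and k: "is_kernel C k r"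
  obtains i' p' where "biproduct C (insert j I) (S(j := Dom C s)) (Cod C s) i' p'"
proof -
  note b' = biproductD[OF b] and rr = retractionsD[OF r] and kk = kernelD[OF k]
  let ?U = "Dom C k" and ?V = "Cod C s" and ?S = "Dom C s"
  obtain q where q: "q \<in> Arr C" "Dom C q = Dom C r" "Cod C q = Dom C k"
    "q \<cdot> k = Id C (Dom C k)" "q \<cdot> s = Zero C (Dom C s) (Dom C k)"
    "Add C (k \<cdot> q) (s \<cdot> r) = Id C (Dom C r)"
    using split_complement[OF s rr(1) rr(2)[symmetric] rr(3) rr(4) k] .
  have rk: "r \<cdot> k = Zero C ?U ?S" using kk rr by simp
  have o: "?S \<in> Obj C" "?U \<in> Obj C" "?V \<in> Obj C" using s kk by simp_all
  have kV: "k \<in> Arr C" "Cod C k = ?V" and qV: "Dom C q = ?V" using kk rr q by simp_all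
  let ?i = "\<lambda>l. if l = j then s else k \<cdot> i l" and ?p = "\<lambda>l. if l = j then r else p l \<cdot> q"
  have ij: "l \<noteq> j" if "l \<in> I" for l using that j by blast
  have i: "i l \<in> Arr C" "Dom C (i l) = S l" "Cod C (i l) = ?U" "p l \<in> Arr C" "Dom C (p l) = ?U" "Cod C (p l) = S l"
    "S l \<in> Obj C" if "l \<in> I" for l using b' that by simp_all
  have "?p m \<cdot> ?i l = (if m = l then Id C ((S(j := ?S)) l) else Zero C ((S(j := ?S)) l) ((S(j := ?S)) m))"
    if ml: "m \<in> insert j I" "l \<in> insert j I" for m l
  proof -
    consider "m = j" "l = j" | "m = j" "l \<in> I" | "m \<in> I" "l = j" | "m \<in> I" "l \<in> I" using ml by blast
    then show ?thesis
    proof cases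
      case 1
      then show ?thesis using rr by simp
    next
      case 2
      have "r \<cdot> (k \<cdot> i l) = Zero C (S l) ?S"
        using i[OF 2(2)] kV rr(1-3) o by (simp add: reassoc[OF rk])
      then show ?thesis using 2 ij by auto
    next
      case 3
      have "(p m \<cdot> q) \<cdot> s = Zero C ?S (S m)"
        using i[OF 3(1)] q(1,3) qV s o by (simp add: q(5))
      then show ?thesis using 3 ij by auto
    next
      case 4
      have "(p m \<cdot> q) \<cdot> (k \<cdot> i l) = p m \<cdot> i l"
        using i[OF 4(1)] i[OF 4(2)] q(1,3) qV kV o by (simp add: reassoc[OF q(4)])
      then show ?thesis using 4 ij b'(9) by auto
    qed
  qed
  moreover have "finprod (Hom_group C ?V ?V) (\<lambda>l. ?i l \<cdot> ?p l) (insert j I) = Id C ?V"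
  proof -
    have "finprod (Hom_group C ?V ?V) (\<lambda>l. ?i l \<cdot> ?p l) (insert j I) =
        Add C (?i j \<cdot> ?p j) (finprod (Hom_group C ?V ?V) (\<lambda>l. ?i l \<cdot> ?p l) I)"
      by (rule finprod_Hom_insert[OF o(3,3) b'(2) j]) (use s rr(1-3) i q(1,3) qV kV in auto)
    also have "finprod (Hom_group C ?V ?V) (\<lambda>l. ?i l \<cdot> ?p l) I =
        finprod (Hom_group C ?V ?V) (\<lambda>l. k \<cdot> ((i l \<cdot> p l) \<cdot> q)) I"
      by (rule finprod_Hom_cong[OF o(3,3)]) (use i q(1,3) qV kV ij in auto)
    also have "\<dots> = k \<cdot> finprod (Hom_group C ?V ?U) (\<lambda>l. (i l \<cdot> p l) \<cdot> q) I"
      by (rule Comp_finprod_Hom[symmetric, OF b'(2)]) (use i q(1,3) qV kV o in simp_all)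
    also have "finprod (Hom_group C ?V ?U) (\<lambda>l. (i l \<cdot> p l) \<cdot> q) I =
        finprod (Hom_group C ?U ?U) (\<lambda>l. i l \<cdot> p l) I \<cdot> q"
      by (rule finprod_Hom_Comp[symmetric, OF b'(2)]) (use i q(1,3) qV kV o in simp_all)
    also have "\<dots> = q" unfolding b'(10) using q(1,3) by simp
    also have "Add C (?i j \<cdot> ?p j) (k \<cdot> q) = Add C (k \<cdot> q) (s \<cdot> r)"
      using Add_commute[of "s \<cdot> r" "k \<cdot> q"] s rr(1-3) q(1,3) qV kV by simp
    also have "\<dots> = Id C ?V" using q(6) rr(2) by simp
    finally show ?thesis .
  qed
  ultimately have "biproduct C (insert j I) (S(j := ?S)) ?V ?i ?p"
    unfolding biproduct_def using b'(2) o i s rr(1-3) q(1,3) qV kV ij by auto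
  then show thesis by (rule that)
qed

text \<open>Steinitz exchange: some projection \<open>p j\<close> is nonzero on the simple
  subobject, hence an isomorphism there by Schur. Composing \<open>p j\<close> with the inverse
  gives a retraction of \<open>s\<close> with the same kernel as \<open>p j\<close>.\<close>

lemma biproduct_exchange:
  assumes b: "biproduct C I S M i p" and S: "\<forall>k\<in>I. simple_obj C (S k)"
    and s: "mono_arr C s" "simple_obj C (Dom C s)" "Cod C s = M"
  obtains j r where "j \<in> I" "r \<in> retractions s" "\<forall>k. is_kernel C k (p j) \<longrightarrow> is_kernel C k r"
proof -
  note b' = biproductD[OF b]
  have sA: "s \<in> Arr C" and oS: "Dom C s \<in> Obj C" using s by simp_all
  have "\<exists>j\<in>I. p j \<cdot> s \<noteq> Zero C (Dom C s) (S j)"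
  proof (rule ccontr)
    assume "\<not> ?thesis"
    then have z: "p j \<cdot> s = Zero C (Dom C s) (S j)" if "j \<in> I" for j using that by blast
    have "s = finprod (Hom_group C M M) (\<lambda>k. i k \<cdot> p k) I \<cdot> s" unfolding b'(10) using sA s(3) by simp
    also have "\<dots> = finprod (Hom_group C (Dom C s) M) (\<lambda>k. (i k \<cdot> p k) \<cdot> s) I"
      by (rule finprod_Hom_Comp[OF b'(2)]) (use b' sA s(3) in simp_all)
    also have "\<dots> = Zero C (Dom C s) M"
      by (rule finprod_Hom_zero[OF oS b'(1)]) (use b' sA s(3) z oS in simp_all)
    finally have "s = Zero C (Dom C s) M" .
    then have "s \<cdot> Id C (Dom C s) = Zero C (Dom C s) (Cod C s)" using sA s(3) by simp
    then have "Id C (Dom C s) = Zero C (Dom C s) (Dom C s)"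
      using mono_zero[OF s(1), of "Id C (Dom C s)"] oS by simp
    then show False using s(2) oS by (simp add: simple_obj_def zero_obj_iff)
  qed
  then obtain j where j: "j \<in> I" "p j \<cdot> s \<noteq> Zero C (Dom C s) (S j)" by blast
  have pj: "p j \<in> Arr C" "Dom C (p j) = M" "Cod C (p j) = S j" using b' j by simp_all
  have "iso_arr C (p j \<cdot> s)"
    by (rule schur[of "Dom C s" "S j"]) (use S s(2,3) j pj sA in simp_all)
  then obtain v where v0: "p j \<cdot> s \<in> Arr C" "v \<in> Arr C" "Dom C v = Cod C (p j \<cdot> s)" "Cod C v = Dom C (p j \<cdot> s)"
    "v \<cdot> (p j \<cdot> s) = Id C (Dom C (p j \<cdot> s))" "p j \<cdot> s \<cdot> v = Id C (Cod C (p j \<cdot> s))" by (rule isoE)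
  have ps: "Dom C (p j \<cdot> s) = Dom C s" "Cod C (p j \<cdot> s) = S j" using pj sA s(3) by simp_all
  have v: "v \<in> Arr C" "Dom C v = S j" "Cod C v = Dom C s" "v \<cdot> (p j \<cdot> s) = Id C (Dom C s)"
    using v0(2-5) unfolding ps by simp_all
  have "iso_arr C v" by (rule isoI[of v "p j \<cdot> s"]) (use v0 in simp_all)
  then have vm: "mono_arr C v" by (rule iso_mono)
  have "v \<cdot> p j \<in> retractions s"
    unfolding retractions_def using v pj sA s(3) by simp
  moreover have "is_kernel C k (v \<cdot> p j)" if k: "is_kernel C k (p j)" for k
  proof (rule kernelI[OF kernel_mono[OF k]])
    note kk = kernelD[OF k]
    show "v \<cdot> p j \<in> Arr C" "Cod C k = Dom C (v \<cdot> p j)" using v pj kk by simp_all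
    have "v \<cdot> p j \<cdot> k = v \<cdot> (p j \<cdot> k)" by (rule assoc) (use v pj kk in simp_all)
    also have "\<dots> = Zero C (Dom C k) (Dom C s)" unfolding kk(4) using v pj kk(1) by simp
    finally show "v \<cdot> p j \<cdot> k = Zero C (Dom C k) (Cod C (v \<cdot> p j))" using v pj by simp
    fix h assume h: "h \<in> Arr C" "Cod C h = Dom C (v \<cdot> p j)" "v \<cdot> p j \<cdot> h = Zero C (Dom C h) (Cod C (v \<cdot> p j))"
    have h': "Cod C h = M" using h v pj by simp
    have ph: "p j \<cdot> h \<in> Arr C" "Dom C (p j \<cdot> h) = Dom C h" "Cod C (p j \<cdot> h) = S j" using h(1) h' pj by simp_all
    have "v \<cdot> (p j \<cdot> h) = Zero C (Dom C h) (Dom C s)" using h v pj h' by simp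
    then have "p j \<cdot> h = Zero C (Dom C h) (S j)"
      using mono_zero[OF vm ph(1)] ph v by simp
    then have z: "p j \<cdot> h = Zero C (Dom C h) (Cod C (p j))" using pj by simp
    obtain u where "u \<in> Arr C" "Dom C u = Dom C h" "Cod C u = Dom C k" "k \<cdot> u = h"
      using kernel_factor[OF k h(1) _ z] h' pj by auto
    then show "\<exists>u. u \<in> Arr C \<and> Dom C u = Dom C h \<and> Cod C u = Dom C k \<and> k \<cdot> u = h" by blast
  qed
  ultimately show thesis using that j(1) by blast
qed

lemma semisimple_retraction:
  "\<lbrakk>semisimple_obj C (Cod C s); mono_arr C s; simple_obj C (Dom C s)\<rbrakk> \<Longrightarrow> retractions s \<noteq> {}"
  unfolding semisimple_iff using biproduct_exchange by (metis empty_iff)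

text \<open>From right to left one summand is added. From left to right, the exchange lemma supplies
  some semisimple complement of \<open>s\<close>, and all complements are isomorphic, being
  cokernels of \<open>s\<close>.\<close>

lemma semisimple_split_iff:
  assumes s: "s \<in> Arr C" "simple_obj C (Dom C s)" and r: "r \<in> retractions s" and k: "is_kernel C k r"
  shows "semisimple_obj C (Cod C s) \<longleftrightarrow> semisimple_obj C (Dom C k)"
proof
  assume "semisimple_obj C (Dom C k)"
  then obtain I S i p where b: "biproduct C I S (Dom C k) i p" "\<forall>k\<in>I. simple_obj C (S k)"
    by (auto simp: semisimple_iff)
  have "\<exists>j. j \<notin> I" using biproductD(2)[OF b(1)] ex_new_if_finite[OF infinite_UNIV_nat] by blast
  then obtain j where j: "j \<notin> I" by blast
  obtain i' p' where "biproduct C (insert j I) (S(j := Dom C s)) (Cod C s) i' p'"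
    using biproduct_insert[OF b(1) j s(1) r k] .
  moreover have "\<forall>k\<in>insert j I. simple_obj C ((S(j := Dom C s)) k)" using b(2) s(2) j by auto
  ultimately show "semisimple_obj C (Cod C s)" unfolding semisimple_iff by blast
next
  assume "semisimple_obj C (Cod C s)"
  then obtain I S i p where b: "biproduct C I S (Cod C s) i p" "\<forall>k\<in>I. simple_obj C (S k)"
    by (auto simp: semisimple_iff)
  note rr = retractionsD[OF r]
  have sm: "mono_arr C s" by (rule split_mono[of r s]) (use rr s(1) in simp_all)
  obtain j r' where j: "j \<in> I" "r' \<in> retractions s" "\<forall>k. is_kernel C k (p j) \<longrightarrow> is_kernel C k r'"
    using biproduct_exchange[OF b sm s(2) refl] .
  note rr' = retractionsD[OF j(2)]
  obtain k' where k': "is_kernel C k' (p j)" using ex_kernel biproductD(6)[OF b(1) j(1)] by blast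
  have k'r: "is_kernel C k' r'" using j(3) k' by blast
  note kk = kernelD[OF k] and kk' = kernelD[OF k'r]
  obtain i' p' where "biproduct C (I - {j}) S (Dom C k') i' p'" using biproduct_remove[OF b(1) j(1) k'] .
  then have ss: "semisimple_obj C (Dom C k')" unfolding semisimple_iff using b(2) by blast
  obtain q where q: "q \<in> Arr C" "Dom C q = Dom C r" "Cod C q = Dom C k"
    "q \<cdot> k = Id C (Dom C k)" "q \<cdot> s = Zero C (Dom C s) (Dom C k)"
    "Add C (k \<cdot> q) (s \<cdot> r) = Id C (Dom C r)"
    using split_complement[OF s(1) rr(1) rr(2)[symmetric] rr(3) rr(4) k] .
  obtain q' where q': "q' \<in> Arr C" "Dom C q' = Dom C r'" "Cod C q' = Dom C k'"
    "q' \<cdot> k' = Id C (Dom C k')" "q' \<cdot> s = Zero C (Dom C s) (Dom C k')"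
    "Add C (k' \<cdot> q') (s \<cdot> r') = Id C (Dom C r')"
    using split_complement[OF s(1) rr'(1) rr'(2)[symmetric] rr'(3) rr'(4) k'r] .
  have c: "is_cokernel C q s"
    by (rule split_cokernel[OF s(1) rr(1) rr(2)[symmetric] rr(3) q(1) kk(1) q(2) kk(3) q(3-6)])
  have c': "is_cokernel C q' s"
    by (rule split_cokernel[OF s(1) rr'(1) rr'(2)[symmetric] rr'(3) q'(1) kk'(1) q'(2) kk'(3) q'(3-6)])
  obtain w where "iso_arr C w" "Cod C w = Cod C q" "Dom C w = Cod C q'"
    using cokernel_unique[OF c' c] by metis
  then have "isomorphic C (Dom C k') (Dom C k)" using isomorphicI[of w] q q' by simp
  then show "semisimple_obj C (Dom C k)" using semisimple_iso ss by blast
qed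

lemma biproduct_empty_zero_obj: "biproduct C {} S M i p \<Longrightarrow> zero_obj C M"
  by (auto simp: biproduct_def zero_obj_iff finprod_Hom_empty)

lemma zero_obj_semisimple: "zero_obj C Z \<Longrightarrow> semisimple_obj C Z"
  unfolding semisimple_iff
  by (rule exI[of _ "{}"]) (auto simp: biproduct_def zero_obj_iff finprod_Hom_empty)

lemma biproduct_retraction:
  assumes "biproduct C I S M i p" "j \<in> I" shows "p j \<in> retractions (i j)"
  using biproductD[OF assms(1)] assms(2) by (simp add: retractions_def)

text \<open>Summands are split off one at a time. By Schur each contributes the factor |End T| if it
  is isomorphic to \<open>T\<close>, and otherwise only its zero arrow.\<close>

lemma card_Hom_biproduct:
  assumes "biproduct C I S M i p" "\<forall>k\<in>I. simple_obj C (S k)" "simple_obj C T"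
  shows "card (Hom C M T) = card (Hom C T T) ^ card {k \<in> I. isomorphic C (S k) T}"
  using assms(1,2)
proof (induction "card I" arbitrary: I M i p)
  case 0
  then have "I = {}" using biproductD(2)[OF 0(2)] by simp
  then show ?case using biproduct_empty_zero_obj Hom_from_zero_obj simple_Obj[OF assms(3)] 0 by fastforce
next
  case (Suc n)
  note b = biproductD[OF Suc.prems(1)]
  obtain j where j: "j \<in> I" using Suc.hyps(2) by fastforce
  obtain k where k: "is_kernel C k (p j)" using ex_kernel b j by blast
  obtain i' p' where b1: "biproduct C (I - {j}) S (Dom C k) i' p'"
    using biproduct_remove[OF Suc.prems(1) j k] .
  have T: "T \<in> Obj C" using simple_Obj assms(3) by blast
  have "n = card (I - {j})" using Suc.hyps(2) j b(2) by simp
  from Suc.hyps(1)[OF this b1]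
  have IH: "card (Hom C (Dom C k) T) = card (Hom C T T) ^ card {k \<in> I - {j}. isomorphic C (S k) T}"
    using Suc.prems by simp
  have "card (Hom C M T) = card (Hom C (Dom C k) T) * card (Hom C (S j) T)"
    using card_Hom_split[OF b(3)[OF j] biproduct_retraction[OF Suc.prems(1) j] k T] b(4,5)[OF j] by simp
  also have "card (Hom C (S j) T) = (if isomorphic C (S j) T then card (Hom C T T) else 1)"
  proof (cases "isomorphic C (S j) T")
    case True
    then show ?thesis using card_Hom_iso T by simp
  next
    case False
    have "f = Zero C (S j) T" if "f \<in> Hom C (S j) T" for f
    proof (rule ccontr)
      assume "f \<noteq> Zero C (S j) T"
      then have "iso_arr C f" using schur[of "S j" T f] Suc.prems j assms(3) that by simp
      then show False using isomorphicI[of f] False that by simp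
    qed
    moreover have "Zero C (S j) T \<in> Hom C (S j) T" using b(11)[OF j] T by simp
    ultimately have "Hom C (S j) T = {Zero C (S j) T}" by blast
    then show ?thesis using False by simp
  qed
  moreover have "card {k \<in> I. isomorphic C (S k) T} =
      card {k \<in> I - {j}. isomorphic C (S k) T} + (if isomorphic C (S j) T then 1 else 0)"
  proof -
    have "{k \<in> I. isomorphic C (S k) T} =
      (if isomorphic C (S j) T then insert j {k \<in> I - {j}. isomorphic C (S k) T} else {k \<in> I - {j}. isomorphic C (S k) T})"
      using j by auto
    then show ?thesis using b(2) by simp
  qed
  ultimately show ?case unfolding IH by (simp add: power_add)
qed

lemma semisimple_opposite [simp]: "semisimple_obj (opposite C) M \<longleftrightarrow> semisimple_obj C M"
  by (rule semisimple_opposite_iff) simp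

end

section \<open>The inverse of Exp\<close>

lemma biproduct_opposite: "biproduct (opposite C) I S M i p \<longleftrightarrow> biproduct C I S M p i"
proof -
  have "(\<forall>j\<in>I. \<forall>k\<in>I. i k \<cdot>\<^bsub>C\<^esub> p j = (if j = k then Id C (S k) else Zero C (S j) (S k))) \<longleftrightarrow>
    (\<forall>j\<in>I. \<forall>k\<in>I. i j \<cdot>\<^bsub>C\<^esub> p k = (if j = k then Id C (S k) else Zero C (S k) (S j)))"
    by (metis (full_types))
  then show ?thesis unfolding biproduct_def by auto
qed

section \<open>Quotients as subobjects in the opposite category\<close>

context category
begin

lemma isomorphic_opposite_iff [simp]: "isomorphic (opposite C) X Y \<longleftrightarrow> isomorphic C X Y"
  using isomorphic_opposite isomorphic_sym by metis

lemma iso_class_opposite [simp]: "iso_class (opposite C) X = iso_class C X"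
  by (simp add: iso_class_def iso_rel_def)

end

context abelian_category
begin

definition cokernel_of :: "'b \<Rightarrow> 'b" where "cokernel_of f = (SOME p. is_cokernel C p f)"

lemma cokernel_of: "f \<in> Arr C \<Longrightarrow> is_cokernel C (cokernel_of f) f"
  unfolding cokernel_of_def using ex_cokernel by (rule someI_ex)

text \<open>Sends U to the quotient map K \<rightarrow> K/U: under
  \<open>sub_rel (opposite C)\<close> an epimorphism out of K represents a subobject of K in the
  opposite category.\<close>

definition quotient_object :: "'b set \<Rightarrow> 'b set" where
  "quotient_object U = sub_rel (opposite C) `` {cokernel_of (SOME u. u \<in> U)}"

lemma short_exact_quotient_object:
  assumes "U \<in> subobjects C K"
  obtains u p where "u \<in> U" "U = sub_rel C `` {u}" "short_exact C u p" "Cod C u = K"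
    "quotient_object U = sub_rel (opposite C) `` {p}" "quot_class U = iso_class C (Cod C p)"
proof -
  define u where "u = (SOME u. u \<in> U)"
  obtain v q where v: "mono_arr C v" "Cod C v = K" "U = sub_rel C `` {v}" "v \<in> U" "short_exact C v q"
    using subobjectE[OF assms] .
  have u: "u \<in> U" unfolding u_def using v(4) by (rule someI)
  then have r: "(v, u) \<in> sub_rel C" using v(3) by simp
  have m: "mono_arr C u" using r by (rule sub_relE)
  have c: "is_cokernel C (cokernel_of u) u" using cokernel_of m by simp
  have "U = sub_rel C `` {u}"
    using v(3) iffD2[OF sub_rel_class_eq_iff[OF v(1) m] r] by (rule trans)
  moreover have "Cod C u = K" using r v(2) by (metis sub_relE)
  moreover have "short_exact C u (cokernel_of u)" using short_exact_mono m c by blast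
  moreover have "quotient_object U = sub_rel (opposite C) `` {cokernel_of u}"
    by (simp add: quotient_object_def u_def)
  ultimately show thesis
    using that[of u "cokernel_of u"] u class_of_member(2)[OF assms u c] by blast
qed

text \<open>A subobject is the kernel of its quotient map, and a quotient map is the cokernel of its
  kernel, so nothing is lost in either direction.\<close>

lemma bij_quotient_object:
  "bij_betw quotient_object (subobjects C K) (subobjects (opposite C) K)"
proof (rule bij_betw_imageI)
  interpret op: abelian_category "opposite C" by (rule abelian_opposite)
  show "inj_on quotient_object (subobjects C K)"
  proof (rule inj_onI)
    fix U U' assume U: "U \<in> subobjects C K" and U': "U' \<in> subobjects C K"
      and e: "quotient_object U = quotient_object U'"
    obtain u p where u: "u \<in> U" "U = sub_rel C `` {u}" "short_exact C u p" "Cod C u = K"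
      "quotient_object U = sub_rel (opposite C) `` {p}" "quot_class U = iso_class C (Cod C p)"
      using short_exact_quotient_object[OF U] .
    obtain u' p' where u': "u' \<in> U'" "U' = sub_rel C `` {u'}" "short_exact C u' p'" "Cod C u' = K"
      "quotient_object U' = sub_rel (opposite C) `` {p'}" "quot_class U' = iso_class C (Cod C p')"
      using short_exact_quotient_object[OF U'] .
    note up = short_exactD[OF u(3)] and up' = short_exactD[OF u'(3)]
    have "(p, p') \<in> sub_rel (opposite C)"
      using e u(5) u'(5) op.sub_rel_class_eq_iff[of p p'] up(2) up'(2) by simp
    then obtain w where "mono_arr (opposite C) p" "mono_arr (opposite C) p'" "iso_arr (opposite C) w"
      "Dom (opposite C) w = Dom (opposite C) p" "Cod (opposite C) w = Dom (opposite C) p'"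
      "p' \<cdot>\<^bsub>opposite C\<^esub> w = p" "Cod (opposite C) p = Cod (opposite C) p'" by (rule op.sub_relE)
    then have w: "iso_arr C w" "Dom C w = Cod C p'" "w \<cdot> p' = p" by simp_all
    have k: "is_kernel C u' p"
      using short_exact_iso_right[OF u'(3) w(1,2)] w(3) by (simp add: short_exact_def)
    obtain x where x: "iso_arr C x" "Dom C x = Dom C u'" "Cod C x = Dom C u" "u \<cdot> x = u'"
      using kernel_unique[OF up(3) k] .
    have "(u', u) \<in> sub_rel C" by (rule sub_relI_iso[OF up'(1) up(1) x])
    then show "U = U'" using u(2) u'(2) sub_rel_class_eq_iff[OF up'(1) up(1)] by simp
  qed
  show "quotient_object ` subobjects C K = subobjects (opposite C) K"
  proof (intro subset_antisym subsetI)
    fix W assume "W \<in> quotient_object ` subobjects C K"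
    then obtain U where U: "U \<in> subobjects C K" "W = quotient_object U" by blast
    obtain u p where u: "u \<in> U" "U = sub_rel C `` {u}" "short_exact C u p" "Cod C u = K"
      "quotient_object U = sub_rel (opposite C) `` {p}" "quot_class U = iso_class C (Cod C p)"
      using short_exact_quotient_object[OF U(1)] .
    note up = short_exactD[OF u(3)]
    show "W \<in> subobjects (opposite C) K"
      using op.subobjectI[of p] up u U(2) by simp
  next
    fix W assume "W \<in> subobjects (opposite C) K"
    then obtain p where "mono_arr (opposite C) p" "Cod (opposite C) p = K" "W = sub_rel (opposite C) `` {p}"
      using op.subobjectE by metis
    then have p: "epi_arr C p" "Dom C p = K" "W = sub_rel (opposite C) `` {p}" by simp_all
    obtain u where u: "is_kernel C u p" using ex_kernel p epi_Arr by blast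
    have up: "short_exact C u p" using short_exact_epi p u by blast
    note up' = short_exactD[OF up]
    let ?U = "sub_rel C `` {u}"
    have U: "?U \<in> subobjects C K" using subobjectI[OF up'(1)] up' p by simp
    obtain v q where v: "v \<in> ?U" "?U = sub_rel C `` {v}" "short_exact C v q" "Cod C v = K"
      "quotient_object ?U = sub_rel (opposite C) `` {q}" "quot_class ?U = iso_class C (Cod C q)"
      using short_exact_quotient_object[OF U] .
    note vq = short_exactD[OF v(3)]
    have "(v, u) \<in> sub_rel C" using v(2) sub_rel_class_eq_iff[OF vq(1) up'(1)] by simp
    then obtain w where w: "mono_arr C v" "mono_arr C u" "iso_arr C w" "Dom C w = Dom C v" "Cod C w = Dom C u"
      "u \<cdot> w = v" "Cod C v = Cod C u" by (rule sub_relE)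
    have "is_cokernel C p v"
      using short_exact_iso_left[OF up w(3,5)] w(6) by (simp add: short_exact_def)
    then obtain x where x: "iso_arr C x" "Cod C x = Cod C q" "Dom C x = Cod C p" "x \<cdot> p = q"
      using cokernel_unique[OF _ vq(4)] by metis
    have "(q, p) \<in> sub_rel (opposite C)"
      by (rule op.sub_relI_iso[of q p x]) (use x vq(2) p in simp_all)
    then have "quotient_object ?U = W"
      using v(5) p op.sub_rel_class_eq_iff[of q p] vq(2) by simp
    then show "W \<in> quotient_object ` subobjects C K" using U by blast
  qed
qed

lemma sub_class_quotient_object:
  assumes "U \<in> subobjects C K"
  shows "abelian_category.sub_class (opposite C) (quotient_object U) = quot_class U"
proof -
  interpret op: abelian_category "opposite C" by (rule abelian_opposite)
  obtain u p where u: "u \<in> U" "U = sub_rel C `` {u}" "short_exact C u p" "Cod C u = K"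
    "quotient_object U = sub_rel (opposite C) `` {p}" "quot_class U = iso_class C (Cod C p)"
    using short_exact_quotient_object[OF assms] .
  show ?thesis using op.class_of_mono(1)[of p] short_exactD(2)[OF u(3)] u(5,6) by simp
qed

lemma sum_quot_class:
  fixes c :: "'a set \<Rightarrow> rat"
  shows "(\<Sum>U\<in>subobjects C K. c (quot_class U)) =
    (\<Sum>W\<in>subobjects (opposite C) K. c (abelian_category.sub_class (opposite C) W))"
proof -
  have "(\<Sum>W\<in>subobjects (opposite C) K. c (abelian_category.sub_class (opposite C) W)) =
    (\<Sum>U\<in>subobjects C K. c (abelian_category.sub_class (opposite C) (quotient_object U)))"
    by (rule sum.reindex_bij_betw[OF bij_quotient_object, symmetric])
  also have "\<dots> = (\<Sum>U\<in>subobjects C K. c (quot_class U))"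
    by (rule sum.cong) (simp_all add: sub_class_quotient_object)
  finally show ?thesis by simp
qed

lemma subobjects_zero_obj:
  assumes "zero_obj C K"
  shows "subobjects C K = {sub_rel C `` {Id C K}}" "sub_class (sub_rel C `` {Id C K}) = iso_class C K"
proof -
  have K: "K \<in> Obj C" using assms zero_obj_Obj by blast
  have I: "mono_arr C (Id C K)" using K by (simp add: iso_mono)
  show "sub_class (sub_rel C `` {Id C K}) = iso_class C K" using class_of_mono(1)[OF I] K by simp
  have "U = sub_rel C `` {Id C K}" if U: "U \<in> subobjects C K" for U
  proof -
    obtain u p where u: "mono_arr C u" "Cod C u = K" "U = sub_rel C `` {u}" "short_exact C u p"
      using subobjectE[OF U] by metis
    have "zero_obj C (Dom C u)" using zero_obj_mono u assms by blast
    then have e: "u \<cdot> Zero C K (Dom C u) = Id C K"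
      using assms u K zero_obj_Obj by (simp add: zero_obj_iff)
    have "(u, Id C K) \<in> sub_rel C"
      by (rule sub_relI[of u "Id C K" u "Zero C K (Dom C u)"]) (use u I K e in simp_all)
    then show ?thesis using u(3) sub_rel_class_eq_iff[OF u(1) I] by simp
  qed
  moreover have "sub_rel C `` {Id C K} \<in> subobjects C K" using subobjectI[OF I] K by simp
  ultimately show "subobjects C K = {sub_rel C `` {Id C K}}" by blast
qed

lemma semisimple_rep: "M \<in> Obj C \<Longrightarrow> semisimple_obj C (rep (iso_class C M)) \<longleftrightarrow> semisimple_obj C M"
  using semisimple_iso isomorphic_rep isomorphic_sym by blast

end

section \<open>Arrows and multiplicities of semisimple objects\<close>

context finite_length_category
begin

lemma factors_split:
  assumes s: "s \<in> Arr C" "simple_obj C (Dom C s)" and r: "r \<in> retractions s" and k: "is_kernel C k r"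
  shows "factors (Cod C s) = add_mset (iso_class C (Dom C s)) (factors (Dom C k))"
proof -
  note rr = retractionsD[OF r] and kk = kernelD[OF k]
  have "epi_arr C r" by (rule split_epi[of r s]) (use rr s in simp_all)
  then have "short_exact C k r" using short_exact_epi k by blast
  from factors_short_exact[OF this] show ?thesis using kk rr s factors_simple by simp
qed

lemma count_factors_biproduct:
  assumes "biproduct C I S M i p" "\<forall>k\<in>I. simple_obj C (S k)" "T \<in> Obj C"
  shows "count (factors M) (iso_class C T) = card {k \<in> I. isomorphic C (S k) T}"
  using assms(1,2)
proof (induction "card I" arbitrary: I M i p)
  case 0
  then have "I = {}" using biproductD(2)[OF 0(2)] by simp
  then show ?case using biproduct_empty_zero_obj factors_zero_iff zero_obj_Obj 0 by fastforce
next
  case (Suc n)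
  note b = biproductD[OF Suc.prems(1)]
  obtain j where j: "j \<in> I" using Suc.hyps(2) by fastforce
  obtain k where k: "is_kernel C k (p j)" using ex_kernel b j by blast
  obtain i' p' where b1: "biproduct C (I - {j}) S (Dom C k) i' p'"
    using biproduct_remove[OF Suc.prems(1) j k] .
  have "n = card (I - {j})" using Suc.hyps(2) j b(2) by simp
  from Suc.hyps(1)[OF this b1]
  have IH: "count (factors (Dom C k)) (iso_class C T) = card {k \<in> I - {j}. isomorphic C (S k) T}"
    using Suc.prems by simp
  have f: "factors M = add_mset (iso_class C (S j)) (factors (Dom C k))"
    using factors_split[OF b(3)[OF j] _ biproduct_retraction[OF Suc.prems(1) j] k] b(4,5)[OF j] Suc.prems(2) j
    by simp
  have "{k \<in> I. isomorphic C (S k) T} =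
    (if isomorphic C (S j) T then insert j {k \<in> I - {j}. isomorphic C (S k) T} else {k \<in> I - {j}. isomorphic C (S k) T})"
    using j by auto
  then have "card {k \<in> I. isomorphic C (S k) T} =
      card {k \<in> I - {j}. isomorphic C (S k) T} + (if isomorphic C (S j) T then 1 else 0)"
    using b(2) by simp
  then show ?case unfolding f using IH iso_class_eq_iff[OF b(11)[OF j] assms(3)] by simp
qed

text \<open>The second formula is the first one in the opposite category. That both sizes agree is
  what lets the same coefficients give a left and a right inverse.\<close>

lemma card_Hom_semisimple:
  assumes "semisimple_obj C M" "simple_obj C T"
  shows "card (Hom C M T) = card (Hom C T T) ^ count (factors M) (iso_class C T)"
    "card (Hom C T M) = card (Hom C T T) ^ count (factors M) (iso_class C T)"
proof -
  obtain I S i p where b: "biproduct C I S M i p" "\<forall>k\<in>I. simple_obj C (S k)"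
    using assms(1) by (auto simp: semisimple_iff)
  note c = count_factors_biproduct[OF b simple_Obj[OF assms(2)]]
  show "card (Hom C M T) = card (Hom C T T) ^ count (factors M) (iso_class C T)"
    using card_Hom_biproduct[OF b assms(2)] c by simp
  have b': "biproduct (opposite C) I S M p i" "\<forall>k\<in>I. simple_obj (opposite C) (S k)" "simple_obj (opposite C) T"
    using b assms(2) by (simp_all add: biproduct_opposite)
  show "card (Hom C T M) = card (Hom C T T) ^ count (factors M) (iso_class C T)"
    using abelian_category.card_Hom_biproduct[OF abelian_opposite b'] c by simp
qed

end

section \<open>The coefficients and their two sums\<close>

context finitary_category
begin

text \<open>For a simple class with endomorphism field of size q this is (-1)^n q^(n(n-1)/2), the
  Moebius number of the subspace lattice of an n-dimensional vector space over that field.\<close>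

definition simple_factor :: "nat \<Rightarrow> 'a set \<Rightarrow> rat" where
  "simple_factor n s = (-1) ^ n * of_nat (card (Hom C (rep s) (rep s))) ^ (n choose 2)"

lemma simple_factor_Suc:
  "simple_factor (Suc n) s = - (of_nat (card (Hom C (rep s) (rep s))) ^ n) * simple_factor n s"
proof -
  have "Suc n choose 2 = n + (n choose 2)" by (simp add: numeral_2_eq_2)
  then show ?thesis by (simp add: simple_factor_def power_add)
qed

lemma simple_factor_0 [simp]: "simple_factor 0 s = 1"
  by (simp add: simple_factor_def numeral_2_eq_2)

lemma inverse_coeff_eq:
  assumes "M \<in> Obj C"
  shows "inverse_coeff C (iso_class C M) =
    Prod_any (\<lambda>s. if s \<in> Iso C \<and> simple_obj C (rep s) then simple_factor (count (factors M) s) s else 1)"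
proof -
  have "JH_mult C (rep (iso_class C M)) (rep s) = count (factors M) s" if "s \<in> Iso C" for s
    using JH_mult_eq[of "rep (iso_class C M)" "rep s"] rep_props[OF that] rep_props[of "iso_class C M"]
      factors_rep assms by simp
  then show ?thesis unfolding inverse_coeff_def simple_factor_def
    by (intro arg_cong[where f = Prod_any] ext) simp
qed

text \<open>Only the multiplicity of \<open>S\<close> changes, from m to m + 1, which multiplies its
  factor by - |End S|^m.\<close>

lemma inverse_coeff_split:
  assumes "M \<in> Obj C" "N \<in> Obj C" "simple_obj C S" "factors M = add_mset (iso_class C S) (factors N)"
  shows "inverse_coeff C (iso_class C M) =
    - (of_nat (card (Hom C S S)) ^ count (factors N) (iso_class C S)) * inverse_coeff C (iso_class C N)"
proof -
  have S: "S \<in> Obj C" using simple_Obj assms(3) by blast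
  let ?s = "iso_class C S"
  note i = isomorphic_rep[OF S]
  have ss: "simple_obj C (rep ?s)" using simple_iso[OF assms(3) isomorphic_sym[OF i]] .
  have ro: "rep ?s \<in> Obj C" using simple_Obj ss by blast
  \<comment> \<open>The product is indexed by representatives. Passing from the representative to S
    moves first the source and then, in the opposite category, the target.\<close>
  have q: "card (Hom C (rep ?s) (rep ?s)) = card (Hom C S S)"
  proof -
    have "card (Hom C (rep ?s) (rep ?s)) = card (Hom C S (rep ?s))" using card_Hom_iso[OF i ro] .
    also have "\<dots> = card (Hom C S S)"
      using preadditive_category.card_Hom_iso[OF preadditive_opposite, of "rep ?s" S S] i S by simp
    finally show ?thesis .
  qed
  let ?f = "\<lambda>M s. if s \<in> Iso C \<and> simple_obj C (rep s) then simple_factor (count (factors M) s) s else 1"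
  let ?a = "- (of_nat (card (Hom C S S)) ^ count (factors N) ?s) :: rat"
  \<comment> \<open>The change of the factors, concentrated at the class of S; as a function of
    finite support it splits off from the product.\<close>
  let ?g = "\<lambda>s. if s = ?s then ?a else 1"
  have e: "?f M s = ?g s * ?f N s" for s
    using ss S q assms(4) by (simp add: simple_factor_Suc)
  have fin1: "finite {s. ?f N s \<noteq> 1}"
  proof (rule finite_subset)
    have "?f N s = 1" if "s \<notin># factors N" for s using that by (simp add: not_in_iff)
    then show "{s. ?f N s \<noteq> 1} \<subseteq> set_mset (factors N)" by blast
  qed simp
  have fin2: "finite {s. ?g s \<noteq> 1}" by (rule finite_subset[of _ "{?s}"]) auto
  have "inverse_coeff C (iso_class C M) = Prod_any (\<lambda>s. ?g s * ?f N s)"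
    unfolding inverse_coeff_eq[OF assms(1)] e ..
  also have "\<dots> = Prod_any ?g * Prod_any (?f N)" by (rule Prod_any.distrib[OF fin2 fin1])
  also have "Prod_any ?g = (\<Prod>s\<in>{?s}. ?g s)"
    by (rule Prod_any.expand_superset) auto
  finally show ?thesis unfolding inverse_coeff_eq[OF assms(2)] by simp
qed

definition coeff :: "'a set \<Rightarrow> rat" where
  "coeff m = (if semisimple_obj C (rep m) then inverse_coeff C m else 0)"

lemma coeff_zero_obj: assumes "zero_obj C Z" shows "coeff (iso_class C Z) = 1"
proof -
  have Z: "Z \<in> Obj C" "factors Z = {#}" using assms zero_obj_Obj factors_zero_iff by blast+
  have "inverse_coeff C (iso_class C Z) = Prod_any (\<lambda>s. 1)"
    unfolding inverse_coeff_eq[OF Z(1)] Z(2) by (simp cong: if_cong)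
  then show ?thesis
    unfolding coeff_def using semisimple_rep[OF Z(1)] zero_obj_semisimple[OF assms] by simp
qed

text \<open>If Ker r is semisimple, both Hom sets have size |End S|^[Ker r : S], which is the ratio
  of the coefficients up to sign; otherwise neither object is semisimple and both sides vanish. The
  first form serves subobjects, the second quotients.\<close>

lemma coeff_split:
  assumes s: "s \<in> Arr C" "simple_obj C (Dom C s)" and r: "r \<in> retractions s" and k: "is_kernel C k r"
  shows "coeff (iso_class C (Cod C s)) =
      - of_nat (card (Hom C (Dom C k) (Dom C s))) * coeff (iso_class C (Dom C k))"
    "coeff (iso_class C (Cod C s)) =
      - of_nat (card (Hom C (Dom C s) (Dom C k))) * coeff (iso_class C (Dom C k))"
proof -
  have o: "Cod C s \<in> Obj C" "Dom C k \<in> Obj C" using s kernelD[OF k] by simp_all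
  note f = inverse_coeff_split[OF o s(2) factors_split[OF s r k]]
  show "coeff (iso_class C (Cod C s)) =
      - of_nat (card (Hom C (Dom C k) (Dom C s))) * coeff (iso_class C (Dom C k))"
    "coeff (iso_class C (Cod C s)) =
      - of_nat (card (Hom C (Dom C s) (Dom C k))) * coeff (iso_class C (Dom C k))"
    using f semisimple_split_iff[OF s r k] semisimple_rep[OF o(1)] semisimple_rep[OF o(2)]
      card_Hom_semisimple[OF _ s(2), of "Dom C k"]
    by (simp_all add: coeff_def)
qed

lemma sum_coeff_sub_class:
  assumes K: "K \<in> Obj C"
  shows "(\<Sum>U\<in>subobjects C K. coeff (sub_class U)) = (if zero_obj C K then 1 else 0)"
proof (cases "zero_obj C K")
  case True
  then show ?thesis using subobjects_zero_obj[OF True] coeff_zero_obj by simp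
next
  case False
  obtain s where s: "mono_arr C s" "simple_obj C (Dom C s)" "Cod C s = K"
    using ex_simple_subobject[OF K False] by blast
  have "(\<Sum>U\<in>subobjects C (Cod C s). coeff (sub_class U)) = 0"
  proof (rule sum_subobjects_eq_0[OF s(1,2) finite_Hom])
    show "finite (subobjects C (Cod C s))" using finite_subobjects s(3) K by simp
    show "coeff (iso_class C (Cod C t)) = - of_nat (card (Hom C (Dom C k) (Dom C t))) * coeff (iso_class C (Dom C k))"
      if "simple_obj C (Dom C t)" "t \<in> Arr C" "r \<in> retractions t" "is_kernel C k r" for k r t
      using coeff_split(1) that by blast
    \<comment> \<open>A simple subobject of a semisimple object is a direct summand.\<close>
    show "coeff (iso_class C (Cod C t)) = 0"
      if "mono_arr C t" "simple_obj C (Dom C t)" "retractions t = {}" for t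
      using semisimple_retraction[of t] semisimple_rep[of "Cod C t"] that by (auto simp: coeff_def)
  qed
  then show ?thesis using False s by simp
qed

lemma sum_coeff_quot_class:
  assumes K: "K \<in> Obj C"
  shows "(\<Sum>U\<in>subobjects C K. coeff (quot_class U)) = (if zero_obj C K then 1 else 0)"
proof -
  interpret op: abelian_category "opposite C" by (rule abelian_opposite)
  show ?thesis
  proof (cases "zero_obj C K")
    case True
    then show ?thesis unfolding sum_quot_class
      using op.subobjects_zero_obj[of K] coeff_zero_obj by simp
  next
    case False
    obtain i p where ip: "short_exact C i p" "Cod C i = K" "simple_obj C (Cod C p)"
      using ex_simple_quotient[OF K False] by blast
    note ip' = short_exactD[OF ip(1)]
    have "(\<Sum>U\<in>subobjects (opposite C) (Cod (opposite C) p). coeff (op.sub_class U)) = 0"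
    proof (rule op.sum_subobjects_eq_0)
      show "mono_arr (opposite C) p" "simple_obj (opposite C) (Dom (opposite C) p)"
        using ip' ip by simp_all
      show "finite (Hom (opposite C) X Y)" if "X \<in> Obj (opposite C)" "Y \<in> Obj (opposite C)" for X Y
        using that finite_Hom by simp
      show "finite (subobjects (opposite C) (Cod (opposite C) p))"
        using bij_betw_finite[OF bij_quotient_object, of K] finite_subobjects[OF K] ip' ip by simp
      show "coeff (iso_class (opposite C) (Cod (opposite C) t)) =
          - of_nat (card (Hom (opposite C) (Dom (opposite C) k) (Dom (opposite C) t))) *
            coeff (iso_class (opposite C) (Dom (opposite C) k))"
        if "simple_obj (opposite C) (Dom (opposite C) t)" "t \<in> Arr (opposite C)"
          "r \<in> op.retractions t" "is_kernel (opposite C) k r" for k r t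
      proof -
        have t: "simple_obj C (Cod C t)" "t \<in> Arr C" and k: "is_cokernel C k r" using that by simp_all
        \<comment> \<open>Read in \<open>C\<close>, \<open>r\<close> is the inclusion of a simple
          direct summand with retraction \<open>t\<close>, and \<open>k\<close> is its
          cokernel.\<close>
        have r: "r \<in> Arr C" "Cod C r = Dom C t" "Dom C r = Cod C t" "t \<cdot> r = Id C (Cod C t)"
          using op.retractionsD[OF that(3)] by simp_all
        have tr: "t \<in> retractions r" unfolding retractions_def using t r by simp
        \<comment> \<open>The kernel of \<open>t\<close> is a complement of that summand, hence
          isomorphic to its cokernel; this brings the claim into the second form of
          \<open>coeff_split\<close>.\<close>
        obtain l where l: "is_kernel C l t" using ex_kernel t by blast
        note ll = kernelD[OF l]
        have sr: "simple_obj C (Dom C r)" using t r by simp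
        obtain q where q: "q \<in> Arr C" "Dom C q = Dom C t" "Cod C q = Dom C l"
          "q \<cdot> l = Id C (Dom C l)" "q \<cdot> r = Zero C (Dom C r) (Dom C l)"
          "Add C (l \<cdot> q) (r \<cdot> t) = Id C (Dom C t)"
          using split_complement[OF r(1) t(2) r(2) r(3)[symmetric] r(4)[folded r(3)] l] .
        have "is_cokernel C q r"
          by (rule split_cokernel[OF r(1) t(2) r(2) r(3)[symmetric] q(1) ll(1) q(2) ll(3) q(3-6)])
        then obtain w where w: "iso_arr C w" "Cod C w = Cod C k" "Dom C w = Cod C q"
          using cokernel_unique[OF _ k] by metis
        have i: "isomorphic C (Dom C l) (Cod C k)" using isomorphicI[OF w(1)] w q(3) by simp
        have o: "Dom C l \<in> Obj C" "Cod C k \<in> Obj C" "Cod C t \<in> Obj C"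
          using isomorphic_Obj[OF i] t(2) by simp_all
        have "card (Hom C (Cod C t) (Dom C l)) = card (Hom C (Cod C t) (Cod C k))"
          using preadditive_category.card_Hom_iso[OF preadditive_opposite, of "Dom C l" "Cod C k" "Cod C t"] i o by simp
        moreover have "iso_class C (Dom C l) = iso_class C (Cod C k)" using i iso_class_eq_iff o by simp
        ultimately show ?thesis using coeff_split(2)[OF r(1) sr tr l] r by simp
      qed
      show "coeff (iso_class (opposite C) (Cod (opposite C) t)) = 0"
        if "mono_arr (opposite C) t" "simple_obj (opposite C) (Dom (opposite C) t)" "op.retractions t = {}" for t
      proof -
        have "\<not> semisimple_obj C (Dom C t)"
          by (rule notI) (use op.semisimple_retraction[of t] that in simp)
        then show ?thesis using semisimple_rep[of "Dom C t"] that by (simp add: coeff_def)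
      qed
    qed
    then show ?thesis unfolding sum_quot_class using False ip' ip by simp
  qed
qed

end

theorem theorem1p4:
  fixes A :: "('o, 'm, 'x) preadditive_scheme"
  assumes "abelian_category A" and "finitary A" and "finite_length A"
  shows "hall_Exp A \<in> Units (completed_hall_algebra A) \<and>
    inv\<^bsub>completed_hall_algebra A\<^esub> (hall_Exp A) =
      hall_formal_sum A (\<lambda>m. if semisimple_obj A (rep m) then inverse_coeff A m else 0)"
proof -
  interpret finitary_category A
    using assms by (intro finitary_category.intro finite_length_category.intro
      finite_length_category_axioms.intro finitary_category_axioms.intro)
  show ?thesis
    using Exp_inverse[of coeff] sum_coeff_sub_class sum_coeff_quot_class unfolding coeff_def by blast
qed

end
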